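(* Let $X$ be a finite connected symmetric digraph with all $d_v\ge1$, let $\alpha:E(X)\to\Gamma\simeq\mathbb Z_p^d$ be a voltage assignment, and let $U_n$ be the Grover transition matrix on $X_n$. Let $P(A)\in K[A]$ be monic with $\gcd(P,A^2-1)=1$. Then, for every $n\ge0$, \[ \det P(U_n)=0 \] if and only if there exists $\zeta\in W_n^d$ such that $\mathcal R_{X,P}(\zeta-1)=0$.
   Context: Let $p$ be a prime, $d\ge1$, $\overline{\mathbb Q}_p$ a fixed algebraic closure of $\mathbb Q_p$, and $K\subset\overline{\mathbb Q}_p$ a finite extension of $\mathbb Q_p$. Graphs. A finite symmetric digraph $X$ has a finite vertex set $V(X)=\{v_1,\dots,v_m\}$ and a finite set $E(X)$ of directed edges (loops and multiple edges allowed) with origin $o(e)$, terminus $t(e)$ and an inversion $e\mapsto\bar e\ne e$ with $\bar{\bar e}=e$, $o(\bar e)=t(e)$. Put $\#E(X)=2l$, $d_v=\#\{e:o(e)=v\}$, and let $w(e)=2/d_{o(e)}$ be the Grover weight. Tower. A voltage assignment is a map $\alpha:E(X)\to\Gamma\simeq\mathbb Z_p^d$ with $\alpha(\bar e)=-\alpha(e)$. Let $\Gamma_n=\Gamma/p^n\Gamma$, $q_n=p^{dn}$, $\alpha_n$ the reduction of $\alpha$. $X_n$ has vertex set $V(X)\times\Gamma_n$ and directed edges $(e,g):(o(e),g)\to(t(e),g+\alpha_n(e))$, with $\overline{(e,g)}=(\bar e,g+\alpha_n(e))$. The Grover transition matrix $U_n$, indexed by $E(X_n)$ and of size $2lq_n$,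 has $(U_n)_{e,f}=\frac{2}{d_{t(f)}}-\delta_{f,\bar e}$ if $t(f)=o(e)$ and $0$ otherwise (degrees taken in $X_n$). Spectral polynomial. For $\gamma\in\Gamma\simeq\mathbb Z_p^d$ put $\tau(\gamma)=\prod_i(1+T_i)^{\gamma_i}\in\mathbb Z_p[[T_1,\dots,T_d]]$. Let $W_{\tau,\alpha}$ be the $m\times m$ matrix with $(i,j)$ entry $\sum_{e:v_i\to v_j}w(e)\tau(\alpha(e))$ and $\mathcal F_X(A,T)=\det\bigl((A^2+1)I_m-AW_{\tau,\alpha}\bigr)$, monic of degree $2m$ in $A$. Resultants: for monic $f=\prod_i(A-\alpha_i)$ over an algebraically closed field, $\operatorname{Res}_A(f,g)=\prod_ig(\alpha_i)$. Put $\mathcal R_{X,P}(T)=\operatorname{Res}_A(\mathcal F_X(A,T),P(A))\in K[[T_1,\dots,T_d]]$. Torsion points. $W_n=\mu_{p^n}(\overline{\mathbb Q}_p)$; for $\zeta\in W_n^d$, $\zeta-1=(\zeta_1-1,\dots,\zeta_d-1)$, and $\mathcal R_{X,P}(\zeta-1)$ is evaluation at $T=\zeta-1$. *)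

theory Defs
  imports
    "HOL-Algebra.Algebraic_Closure_Type"
    "HOL-Algebra.Embedded_Algebras"
    "HOL-Library.Function_Algebras"
    "HOL-Library.Set_Algebras"
    "HOL-Computational_Algebra.Polynomial_Factorial"
    "Graph_Theory.Graph_Theory"
    "Subresultants.Subresultant"
    "Berlekamp_Zassenhaus.Finite_Field"
begin

section \<open>The $p$-adic integers\<close>

text \<open>
  The prime \<open>p\<close> is \<open>CARD('p)\<close> for a type \<open>'p\<close> of prime cardinality. A $p$-adic integer is a
  compatible sequence of residues modulo \<open>p ^ n\<close>, each represented in \<open>{0..<p ^ n}\<close>.
\<close>

typedef (overloaded) ('p :: prime_card) padic_int =
  "{x :: nat \<Rightarrow> int. \<forall>n. x n mod int CARD('p) ^ n = x n \<and>
      x (Suc n) mod int CARD('p) ^ n = x n}"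
  morphisms residue Abs_padic_int
  by (rule exI[of _ "\<lambda>_. 0"]) simp

setup_lifting type_definition_padic_int

lemma mod_Suc_power_mod: "(a mod int p ^ Suc n) mod int p ^ n = a mod int p ^ n"
  by (rule mod_mod_cancel) (rule le_imp_power_dvd, simp)

lemma residue_mod [simp]:
  "residue (x :: 'p :: prime_card padic_int) n mod int CARD('p) ^ n = residue x n"
  using residue[of x] by blast

lemma residue_Suc_mod:
  "residue (x :: 'p :: prime_card padic_int) (Suc n) mod int CARD('p) ^ n = residue x n"
  using residue[of x] by blast

lemma residue_add_mod:
  "residue (x :: 'p :: prime_card padic_int) (n + m) mod int CARD('p) ^ n = residue x n"
proof (induction m)
  case (Suc m)
  have "residue x (n + Suc m) mod int CARD('p) ^ n =
        (residue x (Suc (n + m)) mod int CARD('p) ^ (n + m)) mod int CARD('p) ^ n"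
    by (subst mod_mod_cancel) (auto intro: le_imp_power_dvd)
  also have "\<dots> = residue x n"
    using Suc by (simp only: residue_Suc_mod)
  finally show ?case .
qed simp

instantiation padic_int :: (prime_card) comm_ring_1
begin

lift_definition zero_padic_int :: "'a padic_int" is "\<lambda>_. 0" by simp

lift_definition one_padic_int :: "'a padic_int" is "\<lambda>n. 1 mod int CARD('a) ^ n"
  using mod_Suc_power_mod by auto

lift_definition plus_padic_int :: "'a padic_int \<Rightarrow> 'a padic_int \<Rightarrow> 'a padic_int"
  is "\<lambda>x y n. (x n + y n) mod int CARD('a) ^ n"
  by (simp add: mod_Suc_power_mod del: power_Suc) (metis mod_add_eq)

lift_definition uminus_padic_int :: "'a padic_int \<Rightarrow> 'a padic_int"
  is "\<lambda>x n. (- x n) mod int CARD('a) ^ n"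
  by (simp add: mod_Suc_power_mod del: power_Suc) (metis mod_minus_eq)

lift_definition minus_padic_int :: "'a padic_int \<Rightarrow> 'a padic_int \<Rightarrow> 'a padic_int"
  is "\<lambda>x y n. (x n - y n) mod int CARD('a) ^ n"
  by (simp add: mod_Suc_power_mod del: power_Suc) (metis mod_diff_eq)

lift_definition times_padic_int :: "'a padic_int \<Rightarrow> 'a padic_int \<Rightarrow> 'a padic_int"
  is "\<lambda>x y n. (x n * y n) mod int CARD('a) ^ n"
  by (simp add: mod_Suc_power_mod del: power_Suc) (metis mod_mult_eq)

instance
proof
  fix a b c :: "'a padic_int"
  show "a * b * c = a * (b * c)"
    by transfer (auto simp: fun_eq_iff mod_simps mult.assoc)
  show "a * b = b * a"
    by transfer (auto simp: fun_eq_iff mult.commute)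
  show "1 * a = a"
    by transfer (auto simp: fun_eq_iff mod_simps)
  show "a + b + c = a + (b + c)"
    by transfer (auto simp: fun_eq_iff mod_simps add.assoc)
  show "a + b = b + a"
    by transfer (auto simp: fun_eq_iff add.commute)
  show "0 + a = a"
    by transfer (auto simp: fun_eq_iff)
  show "- a + a = 0"
    by transfer (auto simp: fun_eq_iff mod_simps)
  show "a - b = a + - b"
    by transfer (auto simp: fun_eq_iff mod_simps)
  show "(a + b) * c = a * c + b * c"
    by transfer (auto simp: fun_eq_iff mod_simps distrib_right)
  have "(1 :: int) mod int CARD('a) ^ 1 = 1"
    using prime_gt_1_nat[OF prime_card[where 'a = 'a]] by simp
  then show "(0 :: 'a padic_int) \<noteq> 1"
    by transfer (metis zero_neq_one)
qed

end

lemma residue_of_nat: "residue (of_nat k :: 'p :: prime_card padic_int) n = int k mod int CARD('p) ^ n"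
proof (induction k)
  case (Suc k)
  then show ?case
    by (simp add: plus_padic_int.rep_eq one_padic_int.rep_eq mod_simps algebra_simps)
qed (simp add: zero_padic_int.rep_eq)

instance padic_int :: (prime_card) idom
proof
  fix x y :: "'a padic_int"
  assume "x \<noteq> 0" "y \<noteq> 0"
  then obtain a b where a: "residue x a \<noteq> 0" and b: "residue y b \<noteq> 0"
    by (metis residue_inject zero_padic_int.rep_eq ext)
  define p where "p = int CARD('a)"
  have p: "prime_elem p"
    using prime_card[where 'a = 'a] by (simp add: p_def)
  define u v where "u = residue x (a + b)" and "v = residue y (b + a)"
  have "\<not> p ^ a dvd u" "\<not> p ^ b dvd v"
    using a b residue_add_mod[of x a b] residue_add_mod[of y b a]
    by (auto simp: u_def v_def p_def)
  moreover from this have nz: "u \<noteq> 0" "v \<noteq> 0"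
    by auto
  ultimately have "multiplicity p u < a" "multiplicity p v < b"
    by (meson multiplicity_dvd' not_le_imp_less)+
  then have "multiplicity p (u * v) < a + b"
    using nz p by (simp add: prime_elem_multiplicity_mult_distrib)
  then have "\<not> p ^ (a + b) dvd u * v"
    using nz p by (metis mult_eq_0_iff multiplicity_geI not_le prime_elem_not_unit)
  then have "residue (x * y) (a + b) \<noteq> 0"
    by (simp add: times_padic_int.rep_eq u_def v_def p_def add.commute mod_eq_0_iff_dvd)
  then show "x * y \<noteq> 0"
    by (auto simp: zero_padic_int.rep_eq)
qed

instance padic_int :: (prime_card) ring_char_0
proof
  show "inj (of_nat :: nat \<Rightarrow> 'a padic_int)"
  proof (rule injI)
    fix k l :: nat
    assume "(of_nat k :: 'a padic_int) = of_nat l"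
    then have eq: "int k mod int CARD('a) ^ (k + l) = int l mod int CARD('a) ^ (k + l)"
      by (metis residue_of_nat)
    have "k + l < CARD('a) ^ (k + l)"
      using prime_gt_1_nat[OF prime_card[where 'a = 'a]] by (simp add: power_gt_expt)
    then have "int k < int CARD('a) ^ (k + l)" "int l < int CARD('a) ^ (k + l)"
      by (metis le_less_trans le_add1 of_nat_less_iff of_nat_power)
         (metis \<open>k + l < CARD('a) ^ (k + l)\<close> le_less_trans le_add2 of_nat_less_iff of_nat_power)
    with eq show "k = l"
      by simp
  qed
qed


section \<open>The field of $p$-adic numbers and its algebraic closure\<close>

instance fract :: ("{idom, ring_char_0}") ring_char_0
  by standard (auto simp: inj_on_def of_nat_fract eq_fract)

instance fract :: ("{idom, ring_char_0}") field_char_0 ..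

type_synonym 'p padic = "'p padic_int fract"
type_synonym 'p padic_closure = "'p padic alg_closure"

definition of_padic_int :: "'p :: prime_card padic_int \<Rightarrow> 'p padic_closure" where
  "of_padic_int x = to_ac (to_fract x)"

definition finite_padic_extension :: "'p :: prime_card padic_closure set \<Rightarrow> bool" where
  "finite_padic_extension K \<longleftrightarrow>
     subfield K ring_of_type_algebra \<and> range (to_ac :: 'p padic \<Rightarrow> _) \<subseteq> K \<and>
     ring.finite_dimension ring_of_type_algebra (range (to_ac :: 'p padic \<Rightarrow> _)) K"

text \<open>
  The valuation ring of the algebraic closure is the integral closure of the $p$-adic integers;
  its multiples by the powers of \<open>p\<close> are a basis of neighbourhoods of \<open>0\<close> for the $p$-adic topology.
\<close>

definition padic_integral_closure :: "'p :: prime_card padic_closure set" where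
  "padic_integral_closure =
     {x. \<exists>f :: 'p padic_int poly. lead_coeff f = 1 \<and> poly (map_poly of_padic_int f) x = 0}"

definition padic_nbhd :: "nat \<Rightarrow> 'p :: prime_card padic_closure set" where
  "padic_nbhd k = (\<lambda>x. of_nat CARD('p) ^ k * x) ` padic_integral_closure"

definition padic_tendsto ::
    "('b \<Rightarrow> 'p :: prime_card padic_closure) \<Rightarrow> 'p padic_closure \<Rightarrow> 'b filter \<Rightarrow> bool" where
  "padic_tendsto f l F \<longleftrightarrow> (\<forall>k. eventually (\<lambda>x. f x - l \<in> padic_nbhd k) F)"


section \<open>Formal power series in the variables \<open>T i\<close>, \<open>i :: 'd\<close>\<close>

typedef ('d, 'a) mfps = "UNIV :: (('d \<Rightarrow> nat) \<Rightarrow> 'a) set"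
  morphisms mfps_nth Abs_mfps ..

setup_lifting type_definition_mfps

lemma mfps_eqI: "(\<And>k. mfps_nth f k = mfps_nth g k) \<Longrightarrow> f = g"
  by (metis mfps_nth_inject ext)

lemma mfps_nth_Abs_mfps [simp]: "mfps_nth (Abs_mfps f) = f"
  by (simp add: Abs_mfps_inverse)

lemma finite_multiindex_le: "finite {..k :: 'd :: finite \<Rightarrow> nat}"
proof -
  have "{..k} \<subseteq> (\<Pi>\<^sub>E i\<in>UNIV. {..k i})"
    by (auto simp: le_fun_def)
  then show ?thesis
    by (rule finite_subset) (auto intro: finite_PiE)
qed

instantiation mfps :: (finite, comm_ring_1) comm_ring_1
begin

lift_definition zero_mfps :: "('a, 'b) mfps" is "\<lambda>_. 0" .

lift_definition one_mfps :: "('a, 'b) mfps" is "\<lambda>k. if k = (\<lambda>_. 0) then 1 else 0" .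

lift_definition plus_mfps :: "('a, 'b) mfps \<Rightarrow> ('a, 'b) mfps \<Rightarrow> ('a, 'b) mfps"
  is "\<lambda>f g k. f k + g k" .

lift_definition uminus_mfps :: "('a, 'b) mfps \<Rightarrow> ('a, 'b) mfps" is "\<lambda>f k. - f k" .

lift_definition minus_mfps :: "('a, 'b) mfps \<Rightarrow> ('a, 'b) mfps \<Rightarrow> ('a, 'b) mfps"
  is "\<lambda>f g k. f k - g k" .

lift_definition times_mfps :: "('a, 'b) mfps \<Rightarrow> ('a, 'b) mfps \<Rightarrow> ('a, 'b) mfps"
  is "\<lambda>f g k. \<Sum>i\<le>k. f i * g (k - i)" .

instance
proof
  fix a b c :: "('a, 'b) mfps"
  show "a * b * c = a * (b * c)"
  proof (transfer, rule ext)
    fix a b c :: "('a \<Rightarrow> nat) \<Rightarrow> 'b" and k :: "'a \<Rightarrow> nat"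
    have "(\<Sum>i\<le>k. (\<Sum>j\<le>i. a j * b (i - j)) * c (k - i)) =
          (\<Sum>(i, j)\<in>(SIGMA i:{..k}. {..i}). a j * b (i - j) * c (k - i))"
      by (simp add: sum_distrib_right sum.Sigma finite_multiindex_le)
    also have "\<dots> = (\<Sum>(j, l)\<in>(SIGMA j:{..k}. {..k - j}). a j * (b l * c (k - j - l)))"
    proof (rule sum.reindex_bij_witness[where i = "\<lambda>(j, l). (j + l, j)" and j = "\<lambda>(i, j). (j, i - j)"])
      fix x assume "x \<in> (SIGMA i:{..k}. {..i})"
      then obtain i j where x: "x = (i, j)" "i \<le> k" "j \<le> i"
        by auto
      then have "k - j - (i - j) = k - i"
        by (auto simp: le_fun_def fun_eq_iff)
      with x show "(case case x of (i, j) \<Rightarrow> (j, i - j) of (j, l) \<Rightarrow> a j * (b l * c (k - j - l))) =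
          (case x of (i, j) \<Rightarrow> a j * b (i - j) * c (k - i))"
        by (simp add: mult.assoc)
    qed (auto simp: le_fun_def fun_eq_iff le_diff_conv2 add.commute diff_le_mono intro: order_trans)
    also have "\<dots> = (\<Sum>j\<le>k. a j * (\<Sum>l\<le>k - j. b l * c (k - j - l)))"
      by (simp add: sum_distrib_left sum.Sigma finite_multiindex_le)
    finally show "(\<Sum>i\<le>k. (\<Sum>j\<le>i. a j * b (i - j)) * c (k - i)) =
                  (\<Sum>j\<le>k. a j * (\<Sum>l\<le>k - j. b l * c (k - j - l)))" .
  qed
  show "a * b = b * a"
  proof (transfer, rule ext)
    fix a b :: "('a \<Rightarrow> nat) \<Rightarrow> 'b" and k :: "'a \<Rightarrow> nat"
    show "(\<Sum>i\<le>k. a i * b (k - i)) = (\<Sum>i\<le>k. b i * a (k - i))"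
    proof (rule sum.reindex_bij_witness[where i = "\<lambda>i. k - i" and j = "\<lambda>i. k - i"])
      fix i assume "i \<in> {..k}"
      then have "k - (k - i) = i"
        by (auto simp: le_fun_def fun_eq_iff)
      then show "b (k - i) * a (k - (k - i)) = a i * b (k - i)"
        by (simp add: mult.commute)
    qed (auto simp: le_fun_def fun_eq_iff)
  qed
  show "1 * a = a"
  proof (transfer, rule ext)
    fix a :: "('a \<Rightarrow> nat) \<Rightarrow> 'b" and k :: "'a \<Rightarrow> nat"
    have "(\<Sum>i\<le>k. (if i = (\<lambda>_. 0) then 1 else 0) * a (k - i)) =
          (\<Sum>i\<in>{\<lambda>_. 0}. (if i = (\<lambda>_. 0) then 1 else 0) * a (k - i))"
      by (rule sum.mono_neutral_right) (auto simp: finite_multiindex_le le_fun_def)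
    also have "\<dots> = a k"
      by (simp add: fun_diff_def)
    finally show "(\<Sum>i\<le>k. (if i = (\<lambda>_. 0) then 1 else 0) * a (k - i)) = a k" .
  qed
  show "(a + b) * c = a * c + b * c"
    by transfer (simp add: fun_eq_iff distrib_right sum.distrib)
  show "(0 :: ('a, 'b) mfps) \<noteq> 1"
    by transfer (metis zero_neq_one)
qed (transfer, simp add: fun_eq_iff algebra_simps)+

end

definition mfps_const :: "'a :: zero \<Rightarrow> ('d, 'a) mfps" where
  "mfps_const c = Abs_mfps (\<lambda>k. if k = (\<lambda>_. 0) then c else 0)"

text \<open>The value at \<open>t\<close> is an unordered sum over all multi-indices in the $p$-adic topology.\<close>

definition mfps_has_value ::
    "('d :: finite, 'p :: prime_card padic_closure) mfps \<Rightarrow> ('d \<Rightarrow> 'p padic_closure) \<Rightarrow>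
       'p padic_closure \<Rightarrow> bool" where
  "mfps_has_value f t v \<longleftrightarrow>
     padic_tendsto (\<lambda>S. \<Sum>k\<in>S. mfps_nth f k * (\<Prod>i\<in>UNIV. t i ^ k i)) v (finite_subsets_at_top UNIV)"


section \<open>Matrices indexed by finite sets\<close>

text \<open>
  The elements of \<open>S\<close> are listed in an arbitrary order; determinants (of the matrix itself or of a
  polynomial in it) do not depend on that order.
\<close>

definition matrix_on :: "'i set \<Rightarrow> ('i \<Rightarrow> 'i \<Rightarrow> 'a) \<Rightarrow> 'a mat" where
  "matrix_on S M = (let xs = (SOME xs. distinct xs \<and> set xs = S) in
     mat (length xs) (length xs) (\<lambda>(i, j). M (xs ! i) (xs ! j)))"

definition poly_of_mat :: "'a :: comm_ring_1 poly \<Rightarrow> 'a mat \<Rightarrow> 'a mat" where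
  "poly_of_mat P A = mat (dim_row A) (dim_row A)
     (\<lambda>(i, j). \<Sum>k\<le>degree P. coeff P k * (A ^\<^sub>m k) $$ (i, j))"


section \<open>Voltage covers\<close>

definition voltage_assignment ::
    "('v, 'e) pre_digraph \<Rightarrow> ('e \<Rightarrow> 'e) \<Rightarrow> ('e \<Rightarrow> 'd \<Rightarrow> 'p :: prime_card padic_int) \<Rightarrow> bool" where
  "voltage_assignment G arev \<alpha> \<longleftrightarrow> (\<forall>e\<in>arcs G. \<alpha> (arev e) = - \<alpha> e)"

text \<open>
  With \<open>\<Gamma> = 'd \<Rightarrow> 'p padic_int\<close>, the group \<open>\<Gamma> / p ^ n \<Gamma>\<close> consists of cosets, added elementwise.
\<close>

definition power_subgroup :: "nat \<Rightarrow> ('d \<Rightarrow> 'p :: prime_card padic_int) set" where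
  "power_subgroup n = range (\<lambda>\<gamma> i. of_nat CARD('p) ^ n * \<gamma> i)"

definition reduction ::
    "nat \<Rightarrow> ('d \<Rightarrow> 'p :: prime_card padic_int) \<Rightarrow> ('d \<Rightarrow> 'p padic_int) set" where
  "reduction n \<gamma> = \<gamma> +o power_subgroup n"

definition voltage_cover ::
    "('v, 'e) pre_digraph \<Rightarrow> ('e \<Rightarrow> 'd \<Rightarrow> 'p :: prime_card padic_int) \<Rightarrow> nat \<Rightarrow>
       ('v \<times> ('d \<Rightarrow> 'p padic_int) set, 'e \<times> ('d \<Rightarrow> 'p padic_int) set) pre_digraph" where
  "voltage_cover G \<alpha> n =
     \<lparr> verts = verts G \<times> range (reduction n),
       arcs = arcs G \<times> range (reduction n),
       tail = (\<lambda>(e, g). (tail G e, g)),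
       head = (\<lambda>(e, g). (head G e, g + reduction n (\<alpha> e))) \<rparr>"

definition cover_rev ::
    "('e \<Rightarrow> 'e) \<Rightarrow> ('e \<Rightarrow> 'd \<Rightarrow> 'p :: prime_card padic_int) \<Rightarrow> nat \<Rightarrow>
       'e \<times> ('d \<Rightarrow> 'p padic_int) set \<Rightarrow> 'e \<times> ('d \<Rightarrow> 'p padic_int) set" where
  "cover_rev arev \<alpha> n = (\<lambda>(e, g). (arev e, g + reduction n (\<alpha> e)))"

definition grover_matrix :: "('v, 'e) pre_digraph \<Rightarrow> ('e \<Rightarrow> 'e) \<Rightarrow> 'a :: field mat" where
  "grover_matrix G arev = matrix_on (arcs G) (\<lambda>e f.
     if head G f = tail G e
     then 2 / of_nat (out_degree G (head G f)) - (if f = arev e then 1 else 0)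
     else 0)"


section \<open>The resultant over an algebraically closed field\<close>

text \<open>
  The library's resultant is the determinant of the Sylvester matrix, hence defined over any
  commutative ring. Over an algebraically closed field and for a monic first argument it is the
  product of the values of the second argument at the roots of the first
  (\<open>resultant_eq_prod\<close> below).
\<close>

lemma poly_prod_linear: "poly (\<Prod>a\<in>#A. [:- a, 1:]) x = (\<Prod>a\<in>#A. x - a)" for A :: "'a :: idom multiset"
  by (induction A) (auto simp: left_diff_distrib)

lemma prod_diff_swap:
  "(\<Prod>a\<in>#A. \<Prod>b\<in>#B. a - b) = (- 1) ^ (size A * size B) * (\<Prod>b\<in>#B. \<Prod>a\<in>#A. b - a)"
  for A B :: "'a :: comm_ring_1 multiset"
proof (induction A)
  case (add x A)
  have "(\<Prod>b\<in>#B. x - b) = (- 1) ^ size B * (\<Prod>b\<in>#B. b - x)"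
    by (induction B) (auto simp: algebra_simps)
  with add show ?case
    by (simp add: prod_mset.distrib power_add mult_ac)
qed simp

lemma prod_poly_swap:
  fixes A B :: "'a :: idom multiset"
  assumes f: "f = smult c (\<Prod>a\<in>#A. [:- a, 1:])" and g: "g = smult d (\<Prod>b\<in>#B. [:- b, 1:])"
  shows "c ^ size B * (\<Prod>a\<in>#A. poly g a) =
         (- 1) ^ (size A * size B) * (d ^ size A * (\<Prod>b\<in>#B. poly f b))"
proof -
  have 1: "poly f = (\<lambda>x. c * (\<Prod>a\<in>#A. x - a))" and 2: "poly g = (\<lambda>x. d * (\<Prod>b\<in>#B. x - b))"
    unfolding f g by (simp_all only: poly_smult poly_prod_linear fun_eq_iff simp_thms)
  show ?thesis
    unfolding 1 2 prod_mset.distrib prod_mset_constant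
    by (subst prod_diff_swap) (simp only: mult_ac)
qed

lemma linear_factors_degree:
  "c \<noteq> 0 \<Longrightarrow> degree (smult c (\<Prod>a\<in>#A. [:- a, 1:])) = size A"
  "lead_coeff (smult c (\<Prod>a\<in>#A. [:- a, 1:])) = c" for A :: "'a :: idom multiset"
proof -
  have *: "degree (\<Prod>a\<in>#A. [:- a, 1:]) = size A \<and> lead_coeff (\<Prod>a\<in>#A. [:- a, 1:]) = 1"
  proof (induction A)
    case (add x A)
    then have "(\<Prod>a\<in>#A. [:- a, 1:]) \<noteq> 0"
      by auto
    then show ?case
      using add lead_coeff_mult[of "[:- x, 1:]" "\<Prod>a\<in>#A. [:- a, 1:]"]
      by (auto simp: degree_mult_eq simp del: mult_pCons_left)
  qed simp
  show "c \<noteq> 0 \<Longrightarrow> degree (smult c (\<Prod>a\<in>#A. [:- a, 1:])) = size A"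
    using * by simp
  show "lead_coeff (smult c (\<Prod>a\<in>#A. [:- a, 1:])) = c" 
    using * by (cases "c = 0") auto
qed

lemma resultant_eq_prod_le:
  fixes f g :: "'a :: alg_closed_field poly"
  assumes "f = smult c (\<Prod>a\<in>#A. [:- a, 1:])" "c \<noteq> 0" "degree g \<le> degree f"
  shows "resultant f g = c ^ degree g * (\<Prod>a\<in>#A. poly g a)"
  using assms
proof (induction "degree g" arbitrary: f g c A rule: less_induct)
  case less
  note f = less.prems(1)
  have f0: "f \<noteq> 0" and df: "degree f = size A" and lf: "lead_coeff f = c"
    using less.prems linear_factors_degree[of c A] by auto
  show ?case
  proof (cases "degree g = 0")
    case True
    then obtain k where g: "g = [:k:]"
      by (rule degree_eq_zeroE)
    then have "poly g = (\<lambda>_. k)"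
      by (simp add: fun_eq_iff)
    then have "(\<Prod>a\<in>#A. poly g a) = k ^ size A"
      by simp
    moreover have "resultant f g = k ^ size A"
      by (simp add: g df)
    ultimately show ?thesis
      using True by simp
  next
    case False
    then have g0: "g \<noteq> 0" and dg0: "degree g > 0"
      by auto
    obtain B where sB: "size B = degree g" and g: "g = smult (lead_coeff g) (\<Prod>b\<in>#B. [:- b, 1:])"
      using alg_closed_imp_factorization[OF g0] by blast
    define d where "d = lead_coeff g"
    have d0: "d \<noteq> 0" and g: "g = smult d (\<Prod>b\<in>#B. [:- b, 1:])"
      using g g0 by (simp_all add: d_def)
    define h where "h = f mod g"
    have dh: "degree h < degree g"
      using degree_mod_less_degree[of g f] g0 dg0 unfolding h_def
      by (metis degree_0 degree_mod_less g0)
    have eq: "f + (- (f div g)) * g = h"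
      unfolding h_def by (simp add: minus_div_mult_eq_mod[symmetric])
    have dvd: "poly f b = poly h b" if "b \<in># B" for b
    proof -
      have "poly g b = 0"
        unfolding g poly_smult poly_prod_linear using that by (auto simp: prod_mset_zero_iff)
      then show ?thesis
        by (simp add: eq[symmetric])
    qed
    have fh: "(\<Prod>b\<in>#B. poly f b) = (\<Prod>b\<in>#B. poly h b)"
      using dvd by (intro arg_cong[where f = prod_mset] image_mset_cong)
    have *: "c ^ degree g * (\<Prod>a\<in>#A. poly g a) =
        (- 1) ^ (degree f * degree g) * (d ^ degree f * (\<Prod>b\<in>#B. poly h b))"
      using prod_poly_swap[OF f g] by (simp add: df sB fh)
    show ?thesis
    proof (cases "degree h = 0")
      case True
      then obtain k where h: "h = [:k:]"
        by (rule degree_eq_zeroE)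
      have "[:resultant f g:] = smult ((- 1) ^ (degree f * degree g) * d ^ degree f * k ^ (degree g - 1)) h"
        using BT_lemma_1_13'[OF eq less.prems(3), of 0] dh True
        by (simp add: subresultant_resultant d_def h)
      then have res: "resultant f g =
          (- 1) ^ (degree f * degree g) * (d ^ degree f * (k ^ (degree g - 1) * k))"
        by (simp add: h mult_ac)
      have "poly h = (\<lambda>_. k)"
        by (simp add: h fun_eq_iff)
      then have "(\<Prod>b\<in>#B. poly h b) = k ^ degree g"
        by (simp add: sB)
      also have "\<dots> = k ^ (degree g - 1) * k"
        using dg0 by (metis power_minus_mult)
      finally show ?thesis
        unfolding * res by simp
    next
      case False
      have "[:resultant f g:] = smult ((- 1) ^ (degree f * degree g) * d ^ (degree f - degree h)) [:resultant g h:]"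
        using BT_lemma_1_12[OF eq less.prems(3), of 0] dh False
        by (simp add: subresultant_resultant d_def)
      then have "resultant f g = (- 1) ^ (degree f * degree g) * d ^ (degree f - degree h) * resultant g h"
        by simp
      also have "resultant g h = d ^ degree h * (\<Prod>b\<in>#B. poly h b)"
        using less.hyps[OF dh g d0] dh by simp
      also have "(- 1) ^ (degree f * degree g) * d ^ (degree f - degree h) * \<dots> =
          (- 1) ^ (degree f * degree g) * ((d ^ (degree f - degree h) * d ^ degree h) * (\<Prod>b\<in>#B. poly h b))"
        by (simp only: mult_ac)
      also have "d ^ (degree f - degree h) * d ^ degree h = d ^ degree f"
        using dh less.prems(3) by (simp flip: power_add)
      finally show ?thesis
        unfolding * .
    qed
  qed
qed

lemma resultant_eq_prod:
  fixes g :: "'a :: alg_closed_field poly"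
  shows "resultant (\<Prod>a\<in>#A. [:- a, 1:]) g = (\<Prod>a\<in>#A. poly g a)"
proof -
  define f where "f = (\<Prod>a\<in>#A. [:- a, 1:])"
  have f: "f = smult 1 (\<Prod>a\<in>#A. [:- a, 1:])"
    by (simp add: f_def)
  have df: "degree f = size A"
    using linear_factors_degree(1)[of 1 A] by (simp add: f_def)
  show ?thesis
  proof (cases "degree g \<le> degree f")
    case True
    then show ?thesis
      using resultant_eq_prod_le[OF f] unfolding f_def[symmetric] by simp
  next
    case False
    then have "g \<noteq> 0"
      by auto
    then obtain B where sB: "size B = degree g" and g: "g = smult (lead_coeff g) (\<Prod>b\<in>#B. [:- b, 1:])"
      using alg_closed_imp_factorization by blast
    have "resultant f g = (- 1) ^ (degree f * degree g) * resultant g f"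
      by (rule resultant_swap)
    also have "resultant g f = lead_coeff g ^ degree f * (\<Prod>b\<in>#B. poly f b)"
      using False \<open>g \<noteq> 0\<close> by (intro resultant_eq_prod_le[OF g]) auto
    finally show ?thesis
      using prod_poly_swap[OF f g] unfolding df sB f_def[symmetric] by simp
  qed
qed


section \<open>The spectral polynomial and its resultant\<close>

text \<open>
  \<open>(1 + T)\<close> to a $p$-adic power is given by the binomial series. The coefficients below are taken
  in the algebraic closure.
\<close>

definition tau :: "('d :: finite \<Rightarrow> 'p :: prime_card padic_int) \<Rightarrow> ('d, 'p padic_closure) mfps" where
  "tau \<gamma> = Abs_mfps (\<lambda>k. \<Prod>i\<in>UNIV. of_padic_int (\<gamma> i) gchoose k i)"

definition weighted_matrix ::
    "('v, 'e) pre_digraph \<Rightarrow> ('e \<Rightarrow> 'd :: finite \<Rightarrow> 'p :: prime_card padic_int) \<Rightarrow>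
       ('d, 'p padic_closure) mfps mat" where
  "weighted_matrix G \<alpha> = matrix_on (verts G) (\<lambda>u v.
     \<Sum>e\<in>{e \<in> arcs G. tail G e = u \<and> head G e = v}.
       mfps_const (2 / of_nat (out_degree G (tail G e))) * tau (\<alpha> e))"

definition spectral_poly ::
    "('v, 'e) pre_digraph \<Rightarrow> ('e \<Rightarrow> 'd :: finite \<Rightarrow> 'p :: prime_card padic_int) \<Rightarrow>
       ('d, 'p padic_closure) mfps poly" where
  "spectral_poly G \<alpha> =
     det ([:1, 0, 1:] \<cdot>\<^sub>m 1\<^sub>m (card (verts G)) -
          [:0, 1:] \<cdot>\<^sub>m map_mat (\<lambda>x. [:x:]) (weighted_matrix G \<alpha>))"

definition spectral_resultant ::
    "('v, 'e) pre_digraph \<Rightarrow> ('e \<Rightarrow> 'd :: finite \<Rightarrow> 'p :: prime_card padic_int) \<Rightarrow>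
       'p padic_closure poly \<Rightarrow> ('d, 'p padic_closure) mfps" where
  "spectral_resultant G \<alpha> P = resultant (spectral_poly G \<alpha>) (map_poly mfps_const P)"

end

theory Submission
  imports Defs "Jordan_Normal_Form.Char_Poly"
begin

text \<open>
  If \<open>u\<^sup>2 \<noteq> 1\<close>, summing an eigenfunction of the Grover matrix over the arcs into each vertex turns
  \<open>det (u - U\<^sub>n) = 0\<close> into the existence of \<open>S \<noteq> 0\<close> on the vertices of the cover with
  \<open>(u\<^sup>2 + 1) S = u W S\<close>. The finite group \<open>\<Gamma> / p ^ n \<Gamma>\<close> acts on these \<open>S\<close>, so by Fourier inversion one may
  take \<open>S\<close> to transform under a character, given by a tuple \<open>\<zeta>\<close> of \<open>p ^ n\<close>-th roots of unity; on the
  base graph the equation becomes \<open>(u\<^sup>2 + 1) x = u W\<^sub>\<zeta> x\<close>, that is, \<open>u\<close> is a root of the spectral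
  polynomial at \<open>T = \<zeta> - 1\<close>. Since evaluation at \<open>\<zeta> - 1\<close> respects the ring operations on series with
  bounded coefficients and sends \<open>\<tau>(\<gamma>)\<close> to \<open>\<zeta>\<close> to the power \<open>\<gamma>\<close>, it commutes with the resultant, which
  vanishes at \<open>\<zeta> - 1\<close> iff some root \<open>u\<close> of \<open>P\<close> has this property. Coprimality of \<open>P\<close> and \<open>A\<^sup>2 - 1\<close>
  excludes \<open>u\<^sup>2 = 1\<close>.
\<close>


section \<open>Linear algebra\<close>

text \<open>No absolute value is constructed on the algebraic closure: two elements are close when
  their difference is a high power of p times an integral element. The analysis therefore rests on
  three algebraic facts. Integral elements form a ring, so neighbourhoods can be added and
  multiplied. Every element becomes integral after multiplication by a power of p, so multiplication
  by a fixed element is continuous. The p-adic integers are integrally closed, so the neighbourhoods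
  of 0 meet only in 0 and a series has at most one value. Convergence at \<zeta> - 1 comes from p
  dividing the inner binomial coefficients of p^n, which makes a power of each \<zeta> i - 1
  divisible by p. On the graph side, u^2 - 1 is the determinant of the two linear equations that
  link the values on an arc and on its reversal; when it is nonzero, the vertex sums determine the
  arc function. The number u^2 + 1 is u^2 - 1 plus the 2 left over when the Grover weight 2 / d
  meets d equal terms.\<close>

lemma matrix_on_enum:
  assumes "finite S"
  obtains xs where "distinct xs" "set xs = S" "length xs = card S"
    "\<And>M. matrix_on S M = mat (card S) (card S) (\<lambda>(i, j). M (xs ! i) (xs ! j))"
proof -
  define xs where "xs = (SOME xs. distinct xs \<and> set xs = S)"
  have "\<exists>xs. distinct xs \<and> set xs = S"
    using finite_distinct_list[OF assms] by blast
  then have xs: "distinct xs \<and> set xs = S"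
    unfolding xs_def by (rule someI_ex)
  then have l: "length xs = card S"
    using distinct_card by fastforce
  show ?thesis
    by (rule that[of xs]) (use xs l in \<open>simp_all add: matrix_on_def Let_def flip: xs_def\<close>)
qed

lemma matrix_on_carrier:
  assumes "finite S"
  shows "matrix_on S M \<in> carrier_mat (card S) (card S)"
proof -
  obtain xs where "matrix_on S M = mat (card S) (card S) (\<lambda>(i, j). M (xs ! i) (xs ! j))"
    using matrix_on_enum[OF assms] by metis
  then show ?thesis
    by simp
qed

text \<open>Kernel vectors become functions on \<open>S\<close>, so that later arguments can work
  with functions on arcs or vertices and forget the arbitrary enumeration inside
  \<open>matrix_on\<close>.\<close>

lemma det_matrix_on_eq_0_iff:
  fixes M :: "'i \<Rightarrow> 'i \<Rightarrow> 'a :: field"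
  assumes "finite S"
  shows "det (matrix_on S M) = 0 \<longleftrightarrow>
    (\<exists>x. (\<exists>s\<in>S. x s \<noteq> 0) \<and> (\<forall>s\<in>S. (\<Sum>t\<in>S. M s t * x t) = 0))"
proof -
  obtain xs where xs: "distinct xs" "set xs = S" "length xs = card S"
    and M: "matrix_on S M = mat (card S) (card S) (\<lambda>(i, j). M (xs ! i) (xs ! j))"
    using matrix_on_enum[OF assms] by metis
  let ?n = "card S"
  have bij: "bij_betw ((!) xs) {..<?n} S"
    using bij_betw_nth[of xs] xs by auto
  have prod: "(matrix_on S M *\<^sub>v v) $ i = (\<Sum>j<?n. M (xs ! i) (xs ! j) * v $ j)"
    if "v \<in> carrier_vec ?n" "i < ?n" for v i
    using that by (auto simp: M scalar_prod_def atLeast0LessThan intro!: sum.cong)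
  show ?thesis
    unfolding det_0_iff_vec_prod_zero_field[OF matrix_on_carrier[OF assms, of M]]
  proof (intro iffI; elim exE conjE)
    fix v assume v: "v \<in> carrier_vec ?n" "v \<noteq> 0\<^sub>v ?n" "matrix_on S M *\<^sub>v v = 0\<^sub>v ?n"
    define x where "x s = v $ the_inv_into {..<?n} ((!) xs) s" for s
    have x: "x (xs ! i) = v $ i" if "i < ?n" for i
      using that bij by (simp add: x_def the_inv_into_f_f bij_betw_def)
    obtain i where "i < ?n" "v $ i \<noteq> 0"
      using v(1,2) by (metis carrier_vecD dim_vec eq_vecI index_zero_vec)
    then have "\<exists>s\<in>S. x s \<noteq> 0"
      using x xs by (metis nth_mem)
    moreover have "(\<Sum>t\<in>S. M s t * x t) = 0" if "s \<in> S" for s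
    proof -
      obtain i where i: "i < ?n" "s = xs ! i"
        using \<open>s \<in> S\<close> xs by (metis in_set_conv_nth)
      have "(\<Sum>t\<in>S. M s t * x t) = (\<Sum>j<?n. M s (xs ! j) * x (xs ! j))"
        by (rule sum.reindex_bij_betw[OF bij, symmetric])
      also have "\<dots> = (matrix_on S M *\<^sub>v v) $ i"
        unfolding i(2) using i v by (subst prod) (auto simp: x)
      finally show ?thesis
        using v i by simp
    qed
    ultimately show "\<exists>x. (\<exists>s\<in>S. x s \<noteq> 0) \<and> (\<forall>s\<in>S. (\<Sum>t\<in>S. M s t * x t) = 0)"
      by blast
  next
    fix x assume x: "\<exists>s\<in>S. x s \<noteq> 0" "\<forall>s\<in>S. (\<Sum>t\<in>S. M s t * x t) = 0"
    define v where "v = vec ?n (\<lambda>i. x (xs ! i))"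
    have "v \<noteq> 0\<^sub>v ?n"
      using x(1) xs by (metis (no_types, lifting) in_set_conv_nth index_vec index_zero_vec(1) v_def)
    moreover have "matrix_on S M *\<^sub>v v = 0\<^sub>v ?n"
    proof (rule eq_vecI)
      fix i assume i: "i < dim_vec (0\<^sub>v ?n)"
      then have "(matrix_on S M *\<^sub>v v) $ i = (\<Sum>j<?n. M (xs ! i) (xs ! j) * x (xs ! j))"
        by (subst prod) (simp_all add: v_def)
      also have "\<dots> = (\<Sum>t\<in>S. M (xs ! i) t * x t)"
        by (rule sum.reindex_bij_betw[OF bij])
      also have "\<dots> = 0"
        using x(2) i xs by auto
      finally show "(matrix_on S M *\<^sub>v v) $ i = 0\<^sub>v ?n $ i"
        using i by simp
    qed (simp add: M)
    ultimately show "\<exists>v. v \<in> carrier_vec ?n \<and> v \<noteq> 0\<^sub>v ?n \<and> matrix_on S M *\<^sub>v v = 0\<^sub>v ?n"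
      by (intro exI[of _ v]) (simp add: v_def)
  qed
qed

text \<open>Distinctness of the enumeration turns the identity matrix into equality on
  \<open>S\<close>, so characteristic matrices stay within \<open>matrix_on\<close>.\<close>

lemma matrix_on_diff_diag:
  fixes M :: "'i \<Rightarrow> 'i \<Rightarrow> 'a :: comm_ring_1"
  assumes "finite S"
  shows "a \<cdot>\<^sub>m 1\<^sub>m (card S) - b \<cdot>\<^sub>m matrix_on S M =
    matrix_on S (\<lambda>s t. (if s = t then a else 0) - b * M s t)"
proof -
  obtain xs where xs: "distinct xs" "set xs = S" "length xs = card S"
    and M: "\<And>M :: 'i \<Rightarrow> 'i \<Rightarrow> 'a. matrix_on S M = mat (card S) (card S) (\<lambda>(i, j). M (xs ! i) (xs ! j))"
    using matrix_on_enum[OF assms] by metis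
  show ?thesis
    unfolding M using xs by (intro eq_matI) (auto simp: nth_eq_iff_index_eq)
qed

section \<open>Polynomials in a matrix, their kernels and the resultant\<close>

lemma poly_of_mat_carrier: "A \<in> carrier_mat n n \<Longrightarrow> poly_of_mat P A \<in> carrier_mat n n"
  by (simp add: poly_of_mat_def)

text \<open>The bound \<open>N\<close> is free so that the sums for \<open>Q\<close> and for a
  linear multiple of \<open>Q\<close> can run over one common range.\<close>

lemma poly_of_mat_mult_vec:
  fixes A :: "'a :: field mat"
  assumes A: "A \<in> carrier_mat n n" and v: "v \<in> carrier_vec n" and "i < n" "degree P \<le> N"
  shows "(poly_of_mat P A *\<^sub>v v) $ i = (\<Sum>k\<le>N. coeff P k * (A ^\<^sub>m k *\<^sub>v v) $ i)"
proof -
  have "(poly_of_mat P A *\<^sub>v v) $ i = (\<Sum>j<n. (\<Sum>k\<le>degree P. coeff P k * (A ^\<^sub>m k) $$ (i, j)) * v $ j)"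
    using assms by (auto simp: poly_of_mat_def scalar_prod_def atLeast0LessThan intro!: sum.cong)
  also have "\<dots> = (\<Sum>k\<le>degree P. coeff P k * (\<Sum>j<n. (A ^\<^sub>m k) $$ (i, j) * v $ j))"
    unfolding sum_distrib_right sum_distrib_left by (subst sum.swap) (simp add: mult_ac)
  also have "\<dots> = (\<Sum>k\<le>degree P. coeff P k * (A ^\<^sub>m k *\<^sub>v v) $ i)"
  proof (rule sum.cong)
    fix k
    have "A ^\<^sub>m k \<in> carrier_mat n n"
      using A by simp
    then show "coeff P k * (\<Sum>j<n. (A ^\<^sub>m k) $$ (i, j) * v $ j) = coeff P k * (A ^\<^sub>m k *\<^sub>v v) $ i"
      using A assms(2,3) by (simp add: scalar_prod_def atLeast0LessThan)
  qed simp
  also have "\<dots> = (\<Sum>k\<le>N. coeff P k * (A ^\<^sub>m k *\<^sub>v v) $ i)"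
    using assms(4) by (intro sum.mono_neutral_left) (auto simp: coeff_eq_0)
  finally show ?thesis .
qed

text \<open>Multiplication by the indeterminate shifts the coefficients, which matches one more
  application of \<open>A\<close>. Comparing actions on vectors spares a proof that
  \<open>poly_of_mat\<close> is a ring homomorphism.\<close>

lemma poly_of_mat_linear_mult_vec:
  fixes A :: "'a :: field mat"
  assumes A: "A \<in> carrier_mat n n" and v: "v \<in> carrier_vec n"
  shows "poly_of_mat ([:- a, 1:] * Q) A *\<^sub>v v = poly_of_mat Q A *\<^sub>v (A *\<^sub>v v - a \<cdot>\<^sub>v v)"
proof (rule eq_vecI)
  fix i assume "i < dim_vec (poly_of_mat Q A *\<^sub>v (A *\<^sub>v v - a \<cdot>\<^sub>v v))"
  then have i: "i < n"
    using A by (simp add: poly_of_mat_def)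
  define N where "N = degree Q"
  let ?b = "\<lambda>k. (A ^\<^sub>m k *\<^sub>v v) $ i"
  have P: "[:- a, 1:] * Q = pCons 0 Q - smult a Q"
    by simp
  have "degree ([:- a, 1:] * Q) \<le> Suc N"
    unfolding P N_def using degree_smult_le[of a Q]
    by (intro degree_diff_le) (auto simp: degree_pCons_le le_SucI)
  then have "(poly_of_mat ([:- a, 1:] * Q) A *\<^sub>v v) $ i = (\<Sum>k\<le>Suc N. coeff (pCons 0 Q - smult a Q) k * ?b k)"
    unfolding P[symmetric] by (rule poly_of_mat_mult_vec[OF A v i])
  also have "\<dots> = (\<Sum>k\<le>Suc N. coeff (pCons 0 Q) k * ?b k) - a * (\<Sum>k\<le>Suc N. coeff Q k * ?b k)"
    by (simp only: coeff_diff coeff_smult left_diff_distrib sum_subtractf sum_distrib_left mult.assoc)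
  also have "(\<Sum>k\<le>Suc N. coeff (pCons 0 Q) k * ?b k) = (\<Sum>k\<le>N. coeff Q k * ?b (Suc k))"
    by (simp add: sum.atMost_Suc_shift del: sum.atMost_Suc)
  also have "(\<Sum>k\<le>Suc N. coeff Q k * ?b k) = (\<Sum>k\<le>N. coeff Q k * ?b k)"
    by (simp add: N_def coeff_eq_0)
  also have "(\<Sum>k\<le>N. coeff Q k * ?b (Suc k)) - a * \<dots> =
      (\<Sum>k\<le>N. coeff Q k * (A ^\<^sub>m k *\<^sub>v (A *\<^sub>v v - a \<cdot>\<^sub>v v)) $ i)"
    unfolding sum_distrib_left sum_subtractf[symmetric]
  proof (rule sum.cong)
    fix k
    have Ak: "A ^\<^sub>m k \<in> carrier_mat n n"
      using A by simp
    have "A ^\<^sub>m k *\<^sub>v (A *\<^sub>v v - a \<cdot>\<^sub>v v) = A ^\<^sub>m k *\<^sub>v (A *\<^sub>v v) - a \<cdot>\<^sub>v (A ^\<^sub>m k *\<^sub>v v)"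
      using A v by (simp add: mult_minus_distrib_mat_vec[OF Ak] mult_mat_vec[OF Ak v])
    also have "A ^\<^sub>m k *\<^sub>v (A *\<^sub>v v) = A ^\<^sub>m Suc k *\<^sub>v v"
      using assoc_mult_mat_vec[OF Ak A v] by simp
    finally show "coeff Q k * ?b (Suc k) - a * (coeff Q k * ?b k) =
        coeff Q k * (A ^\<^sub>m k *\<^sub>v (A *\<^sub>v v - a \<cdot>\<^sub>v v)) $ i"
      using i Ak A v by (simp add: right_diff_distrib mult_ac del: pow_mat.simps)
  qed simp
  also have "\<dots> = (poly_of_mat Q A *\<^sub>v (A *\<^sub>v v - a \<cdot>\<^sub>v v)) $ i"
    using A v i by (intro poly_of_mat_mult_vec[symmetric]) (auto simp: N_def)
  finally show "(poly_of_mat ([:- a, 1:] * Q) A *\<^sub>v v) $ i = (poly_of_mat Q A *\<^sub>v (A *\<^sub>v v - a \<cdot>\<^sub>v v)) $ i" .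
qed (simp add: poly_of_mat_def)

lemma alg_closed_monic_factorization:
  fixes P :: "'a :: alg_closed_field poly"
  assumes "lead_coeff P = 1"
  obtains B where "P = (\<Prod>b\<in>#B. [:- b, 1:])"
proof -
  have "P \<noteq> 0" using assms by auto
  with alg_closed_imp_factorization[OF this] assms that show ?thesis by auto
qed

text \<open>Apply the factors \<open>A - b\<close> one after the other: the last nonzero vector
  before 0 is reached is an eigenvector for the factor applied to it.\<close>

lemma linear_factors_kernel:
  fixes A :: "'a :: field mat"
  assumes A: "A \<in> carrier_mat n n" and "v \<in> carrier_vec n" "v \<noteq> 0\<^sub>v n"
    and "poly_of_mat (\<Prod>b\<in>#B. [:- b, 1:]) A *\<^sub>v v = 0\<^sub>v n"
  shows "\<exists>b w. b \<in># B \<and> w \<in> carrier_vec n \<and> w \<noteq> 0\<^sub>v n \<and> A *\<^sub>v w - b \<cdot>\<^sub>v w = 0\<^sub>v n"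
  using assms(2-)
proof (induction B arbitrary: v)
  case empty
  have "poly_of_mat (1 :: 'a poly) A = 1\<^sub>m n"
    using A by (intro eq_matI) (auto simp: poly_of_mat_def)
  then show ?case
    using empty by simp
next
  case (add b B)
  define w where "w = A *\<^sub>v v - b \<cdot>\<^sub>v v"
  have w: "w \<in> carrier_vec n"
    using A add.prems by (simp add: w_def)
  have "poly_of_mat ([:- b, 1:] * (\<Prod>b\<in>#B. [:- b, 1:])) A *\<^sub>v v = 0\<^sub>v n"
    using add.prems(3) by (simp del: mult_pCons_left)
  then have "poly_of_mat (\<Prod>b\<in>#B. [:- b, 1:]) A *\<^sub>v w = 0\<^sub>v n"
    unfolding poly_of_mat_linear_mult_vec[OF A add.prems(1)] w_def .
  then show ?case
    using add.IH[OF w] add.prems w_def by (cases "w = 0\<^sub>v n") auto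
qed

lemma poly_of_mat_eigenvector:
  fixes A :: "'a :: field mat"
  assumes A: "A \<in> carrier_mat n n" and v: "v \<in> carrier_vec n" and ev: "A *\<^sub>v v = u \<cdot>\<^sub>v v"
  shows "poly_of_mat P A *\<^sub>v v = poly P u \<cdot>\<^sub>v v"
proof (rule eq_vecI)
  have pow: "A ^\<^sub>m k *\<^sub>v v = u ^ k \<cdot>\<^sub>v v" for k
  proof (induction k)
    case (Suc k)
    have "A ^\<^sub>m k \<in> carrier_mat n n"
      using A by simp
    note Ak = this
    have "A ^\<^sub>m Suc k *\<^sub>v v = A ^\<^sub>m k *\<^sub>v (u \<cdot>\<^sub>v v)"
      using assoc_mult_mat_vec[OF Ak A v] by (simp add: ev)
    also have "\<dots> = u ^ Suc k \<cdot>\<^sub>v v"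
      by (simp add: mult_mat_vec[OF Ak v] Suc smult_smult_assoc)
    finally show ?case .
  qed (use A v in simp)
  fix i assume "i < dim_vec (poly P u \<cdot>\<^sub>v v)"
  then show "(poly_of_mat P A *\<^sub>v v) $ i = (poly P u \<cdot>\<^sub>v v) $ i"
    using A v by (simp add: poly_of_mat_mult_vec[OF A v _ order.refl] pow poly_altdef sum_distrib_right mult.assoc)
qed (use A v in \<open>simp add: poly_of_mat_def\<close>)

text \<open>Stripping linear factors from a kernel vector of \<open>P(A)\<close> yields an
  eigenvector for a root of \<open>P\<close>; conversely \<open>P(A)\<close> multiplies an
  eigenvector by the value of \<open>P\<close> at its eigenvalue. No triangular form of
  \<open>A\<close> enters.\<close>

lemma det_poly_of_mat_eq_0_iff:
  fixes P :: "'a :: alg_closed_field poly"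
  assumes A: "A \<in> carrier_mat n n" and P: "lead_coeff P = 1"
  shows "det (poly_of_mat P A) = 0 \<longleftrightarrow> (\<exists>u. poly P u = 0 \<and> det (u \<cdot>\<^sub>m 1\<^sub>m n - A) = 0)"
proof -
  have ker: "det (u \<cdot>\<^sub>m 1\<^sub>m n - A) = 0 \<longleftrightarrow>
      (\<exists>w. w \<in> carrier_vec n \<and> w \<noteq> 0\<^sub>v n \<and> A *\<^sub>v w - u \<cdot>\<^sub>v w = 0\<^sub>v n)" for u
  proof -
    have "(u \<cdot>\<^sub>m 1\<^sub>m n - A) *\<^sub>v w = 0\<^sub>v n \<longleftrightarrow> A *\<^sub>v w - u \<cdot>\<^sub>v w = 0\<^sub>v n" if w: "w \<in> carrier_vec n" for w
    proof -
      have "u \<cdot>\<^sub>m 1\<^sub>m n *\<^sub>v w = u \<cdot>\<^sub>v w"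
        using w by (intro eq_vecI) (auto simp: row_smult)
      then have "(u \<cdot>\<^sub>m 1\<^sub>m n - A) *\<^sub>v w = u \<cdot>\<^sub>v w - A *\<^sub>v w"
        using A w by (simp add: minus_mult_distrib_mat_vec[of _ n n])
      then show ?thesis
        using A w by (auto simp: vec_eq_iff)
    qed
    moreover have "u \<cdot>\<^sub>m 1\<^sub>m n - A \<in> carrier_mat n n"
      using A by (rule minus_carrier_mat)
    ultimately show ?thesis
      by (simp add: det_0_iff_vec_prod_zero_field) blast
  qed
  obtain B where B: "P = (\<Prod>b\<in>#B. [:- b, 1:])"
    using alg_closed_monic_factorization[OF P] .
  have root: "poly P b = 0 \<longleftrightarrow> b \<in># B" for b
    unfolding B poly_prod_linear by (auto simp: prod_mset_zero_iff)
  show ?thesis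
  proof
    assume "det (poly_of_mat P A) = 0"
    then obtain v where v: "v \<in> carrier_vec n" "v \<noteq> 0\<^sub>v n" "poly_of_mat P A *\<^sub>v v = 0\<^sub>v n"
      using det_0_iff_vec_prod_zero_field[OF poly_of_mat_carrier[OF A, of P]] by auto
    then show "\<exists>u. poly P u = 0 \<and> det (u \<cdot>\<^sub>m 1\<^sub>m n - A) = 0"
      unfolding ker root using linear_factors_kernel[OF A v(1,2), of B] B by blast
  next
    assume "\<exists>u. poly P u = 0 \<and> det (u \<cdot>\<^sub>m 1\<^sub>m n - A) = 0"
    then obtain u w where u: "poly P u = 0" and w: "w \<in> carrier_vec n" "w \<noteq> 0\<^sub>v n"
      and ev: "A *\<^sub>v w - u \<cdot>\<^sub>v w = 0\<^sub>v n"
      unfolding ker by blast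
    have "A *\<^sub>v w = u \<cdot>\<^sub>v w"
      using ev A w by (auto simp: vec_eq_iff)
    then have "poly_of_mat P A *\<^sub>v w = 0\<^sub>v n"
      using poly_of_mat_eigenvector[OF A w(1)] u w by auto
    then show "det (poly_of_mat P A) = 0"
      using det_0_iff_vec_prod_zero_field[OF poly_of_mat_carrier[OF A, of P]] w by auto
  qed
qed

lemma resultant_monic_eq_0_iff:
  fixes f g :: "'a :: alg_closed_field poly"
  assumes "lead_coeff f = 1"
  shows "resultant f g = 0 \<longleftrightarrow> (\<exists>u. poly f u = 0 \<and> poly g u = 0)"
proof -
  obtain B where B: "f = (\<Prod>b\<in>#B. [:- b, 1:])"
    using alg_closed_monic_factorization[OF assms] .
  have "poly f b = 0 \<longleftrightarrow> b \<in># B" for b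
    unfolding B poly_prod_linear by (auto simp: prod_mset_zero_iff)
  then show ?thesis
    unfolding B resultant_eq_prod by (auto simp: prod_mset_zero_iff)
qed

text \<open>The ring may have zero divisors, so degrees of products can drop. With a common bound
  \<open>d\<close> in place of the exact degrees, the coefficient at the bound is still
  multiplicative.\<close>

lemma coeff_prod_degree_le:
  fixes f :: "'i \<Rightarrow> 'a :: comm_semiring_1 poly"
  assumes "\<And>i. i \<in> A \<Longrightarrow> degree (f i) \<le> d"
  shows "degree (prod f A) \<le> d * card A \<and> coeff (prod f A) (d * card A) = (\<Prod>i\<in>A. coeff (f i) d)"
proof (cases "finite A")
  case True
  then show ?thesis
    using assms
  proof (induction A)
    case (insert x A)
    then have IH: "degree (prod f A) \<le> d * card A" "coeff (prod f A) (d * card A) = (\<Prod>i\<in>A. coeff (f i) d)"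
      and x: "degree (f x) \<le> d"
      by auto
    have "degree (f x * prod f A) \<le> d + d * card A"
      using IH(1) x degree_mult_le[of "f x" "prod f A"] by simp
    moreover have "coeff (f x * prod f A) (d + d * card A) = coeff (f x) d * coeff (prod f A) (d * card A)"
    proof -
      have "(\<Sum>i\<le>d + d * card A. coeff (f x) i * coeff (prod f A) (d + d * card A - i)) =
          (\<Sum>i\<in>{d}. coeff (f x) i * coeff (prod f A) (d + d * card A - i))"
      proof (rule sum.mono_neutral_right)
        have "coeff (f x) i * coeff (prod f A) (d + d * card A - i) = 0" if "i \<noteq> d" for i
        proof (cases "i < d")
          case True
          then have "degree (prod f A) < d + d * card A - i"
            using IH(1) by (simp add: less_diff_conv)
          then show ?thesis
            by (simp add: coeff_eq_0)
        next
          case False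
          then show ?thesis
            using that x by (simp add: coeff_eq_0)
        qed
        then show "\<forall>i\<in>{..d + d * card A} - {d}. coeff (f x) i * coeff (prod f A) (d + d * card A - i) = 0"
          by blast
      qed auto
      then show ?thesis
        by (simp add: coeff_mult)
    qed
    ultimately show ?case
      using insert IH by simp
  qed simp
qed simp

text \<open>The Leibniz formula reduces this to products. Its purpose is to find the degree and
  leading coefficient of the spectral polynomial from the constant matrix of top
  coefficients.\<close>

lemma coeff_det_degree_le:
  fixes A :: "'a :: comm_ring_1 poly mat"
  assumes A: "A \<in> carrier_mat n n" and d: "\<And>i j. i < n \<Longrightarrow> j < n \<Longrightarrow> degree (A $$ (i, j)) \<le> d"
  shows "degree (det A) \<le> d * n \<and> coeff (det A) (d * n) = det (map_mat (\<lambda>p. coeff p d) A)"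
proof -
  have *: "degree (\<Prod>i = 0..<n. A $$ (i, \<pi> i)) \<le> d * n \<and>
      coeff (\<Prod>i = 0..<n. A $$ (i, \<pi> i)) (d * n) = (\<Prod>i = 0..<n. coeff (A $$ (i, \<pi> i)) d)"
    if "\<pi> permutes {0..<n}" for \<pi>
    using coeff_prod_degree_le[of "{0..<n}" "\<lambda>i. A $$ (i, \<pi> i)" d] d permutes_in_image[OF that] by auto
  have s: "signof \<pi> * q = (if evenperm \<pi> then q else - q)" for \<pi> and q :: "'b :: comm_ring_1"
    by (simp add: sign_def)
  have "degree (det A) \<le> d * n"
    unfolding det_def'[OF A] using * by (intro degree_sum_le) (auto simp: s finite_permutations)
  moreover have "coeff (det A) (d * n) = det (map_mat (\<lambda>p. coeff p d) A)"
    unfolding det_def'[OF A] det_def'[OF map_carrier_mat[THEN iffD2, OF A]] coeff_sum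
  proof (rule sum.cong)
    fix \<pi> assume "\<pi> \<in> {\<pi>. \<pi> permutes {0..<n}}"
    then have \<pi>: "\<pi> permutes {0..<n}"
      by simp
    then have "(\<Prod>i = 0..<n. map_mat (\<lambda>p. coeff p d) A $$ (i, \<pi> i)) = (\<Prod>i = 0..<n. coeff (A $$ (i, \<pi> i)) d)"
      using A permutes_in_image[OF \<pi>] by (intro prod.cong) auto
    then show "coeff (signof \<pi> * (\<Prod>i = 0..<n. A $$ (i, \<pi> i))) (d * n) =
        signof \<pi> * (\<Prod>i = 0..<n. map_mat (\<lambda>p. coeff p d) A $$ (i, \<pi> i))"
      using *[OF \<pi>] by (simp add: s)
  qed simp
  ultimately show ?thesis
    by simp
qed

text \<open>
  Evaluation of power series is only a partial map on \<open>mfps\<close>, so its compatibility with determinants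
  and resultants is expressed by a relation in place of a ring homomorphism.
\<close>

locale ring_rel =
  fixes R :: "'a :: comm_ring_1 \<Rightarrow> 'b :: comm_ring_1 \<Rightarrow> bool"
  assumes rel_0: "R 0 0" and rel_1: "R 1 1"
    and rel_add: "R a b \<Longrightarrow> R a' b' \<Longrightarrow> R (a + a') (b + b')"
    and rel_mult: "R a b \<Longrightarrow> R a' b' \<Longrightarrow> R (a * a') (b * b')"
    and rel_uminus: "R a b \<Longrightarrow> R (- a) (- b)"
begin

lemma rel_diff: "R a b \<Longrightarrow> R a' b' \<Longrightarrow> R (a - a') (b - b')"
  using rel_add[OF _ rel_uminus, of a b a' b'] by simp

lemma rel_sum: "(\<And>i. i \<in> A \<Longrightarrow> R (f i) (g i)) \<Longrightarrow> R (sum f A) (sum g A)"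
  by (induction A rule: infinite_finite_induct) (auto intro: rel_0 rel_add)

lemma rel_prod: "(\<And>i. i \<in> A \<Longrightarrow> R (f i) (g i)) \<Longrightarrow> R (prod f A) (prod g A)"
  by (induction A rule: infinite_finite_induct) (auto intro: rel_1 rel_mult)

lemma rel_det:
  assumes A: "A \<in> carrier_mat n n" and B: "B \<in> carrier_mat n n"
    and "\<And>i j. i < n \<Longrightarrow> j < n \<Longrightarrow> R (A $$ (i, j)) (B $$ (i, j))"
  shows "R (det A) (det B)"
proof -
  have "R (signof \<pi>) (signof \<pi>)" for \<pi> :: "nat \<Rightarrow> nat"
    by (auto simp: sign_def intro: rel_1 rel_uminus)
  then show ?thesis
    unfolding det_def'[OF A] det_def'[OF B]
    using assms(3) by (intro rel_sum rel_mult rel_prod) (auto dest: permutes_in_image)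
qed

definition rel_poly where "rel_poly p q \<longleftrightarrow> (\<forall>i. R (coeff p i) (coeff q i))"

lemma ring_rel_poly: "ring_rel rel_poly"
proof
  show "rel_poly 0 0" "rel_poly 1 1"
    by (auto simp: rel_poly_def coeff_1 rel_0 rel_1)
next
  fix a b a' b' assume "rel_poly a b" "rel_poly a' b'"
  then show "rel_poly (a + a') (b + b')" "rel_poly (a * a') (b * b')"
    by (auto simp: rel_poly_def coeff_mult intro!: rel_add rel_mult rel_sum)
qed (auto simp: rel_poly_def intro: rel_uminus)

lemma rel_poly_pCons: "R a b \<Longrightarrow> rel_poly p q \<Longrightarrow> rel_poly (pCons a p) (pCons b q)"
  by (auto simp: rel_poly_def coeff_pCons split: nat.split)

text \<open>\<open>R\<close> need not preserve degrees, since a nonzero series can have value 0.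
  Equal degrees give the two Sylvester matrices the same size and layout.\<close>

lemma rel_resultant:
  assumes "rel_poly f f'" "rel_poly g g'" "degree f = degree f'" "degree g = degree g'"
  shows "R (resultant f g) (resultant f' g')"
  unfolding resultant_def
proof (rule rel_det)
  show "sylvester_mat f g \<in> carrier_mat (degree f + degree g) (degree f + degree g)"
    "sylvester_mat f' g' \<in> carrier_mat (degree f + degree g) (degree f + degree g)"
    by (auto simp: assms)
  fix i j assume "i < degree f + degree g" "j < degree f + degree g"
  then show "R (sylvester_mat f g $$ (i, j)) (sylvester_mat f' g' $$ (i, j))"
    using assms by (auto simp: sylvester_index_mat rel_poly_def rel_0)
qed

end


section \<open>$p$-adic integers and their integral closure\<close>

lemma residue_of_nat_power [simp]:
  "residue (of_nat CARD('p) ^ k :: 'p :: prime_card padic_int) n = int CARD('p) ^ k mod int CARD('p) ^ n"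
  using residue_of_nat[of "CARD('p) ^ k" n, where 'p = 'p] by simp

lemma card_prime_gt_1: "int CARD('p :: prime_card) > 1"
  using prime_gt_1_nat[OF prime_card[where 'a = 'p]] by simp

lemma residue_nonneg: "0 \<le> residue (x :: 'p :: prime_card padic_int) n"
  and residue_less: "residue (x :: 'p :: prime_card padic_int) n < int CARD('p) ^ n"
proof -
  have "0 < int CARD('p) ^ n"
    using card_prime_gt_1[where 'p = 'p] by simp
  then show "0 \<le> residue x n" "residue x n < int CARD('p) ^ n"
    using residue_mod[of x n] by (metis pos_mod_sign, metis pos_mod_bound)
qed

text \<open>The quotient is read off the residues of \<open>x\<close>: shift the sequence by
  \<open>k\<close> places and divide by the k-th power of p.\<close>

lemma power_dvd_padic_iff:
  "of_nat CARD('p) ^ k dvd (x :: 'p :: prime_card padic_int) \<longleftrightarrow> residue x k = 0"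
proof
  assume "of_nat CARD('p) ^ k dvd x"
  then show "residue x k = 0"
    by (auto simp: times_padic_int.rep_eq)
next
  assume x: "residue x k = 0"
  define p where "p = int CARD('p)"
  have p: "p > 1"
    using card_prime_gt_1[where 'p = 'p] by (simp add: p_def)
  have dvd: "p ^ k dvd residue x (n + k)" for n
    using residue_add_mod[of x k n] x by (simp add: p_def add.commute mod_eq_0_iff_dvd)
  define y where "y n = residue x (n + k) div p ^ k" for n
  have y: "residue x (n + k) = p ^ k * y n" for n
    using dvd by (simp add: y_def)
  have "y n mod p ^ n = y n" for n
  proof -
    have "0 \<le> p ^ k * y n" "p ^ k * y n < p ^ k * p ^ n"
      unfolding y[symmetric] power_add[symmetric]
      using residue_nonneg[of x "n + k"] residue_less[of x "n + k"] by (simp_all add: p_def add.commute)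
    moreover have "p ^ k > 0"
      using p by simp
    ultimately have "0 \<le> y n" "y n < p ^ n"
      by (simp_all add: zero_le_mult_iff)
    then show ?thesis
      by simp
  qed
  moreover have "y (Suc n) mod p ^ n = y n" for n
  proof -
    have "p ^ k * (y (Suc n) mod p ^ n) = (p ^ k * y (Suc n)) mod (p ^ k * p ^ n)"
      by (rule mult_mod_right)
    also have "\<dots> = p ^ k * y n"
      unfolding y[symmetric] power_add[symmetric]
      using residue_Suc_mod[of x "n + k"] by (simp add: p_def add.commute)
    finally show ?thesis
      using p by simp
  qed
  ultimately have res: "residue (Abs_padic_int y :: 'p padic_int) = y"
    by (subst Abs_padic_int_inverse) (simp_all add: p_def)
  have "x = of_nat CARD('p) ^ k * Abs_padic_int y"
  proof (rule residue_inject[THEN iffD1], rule ext)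
    fix n
    have "residue (of_nat CARD('p) ^ k * Abs_padic_int y :: 'p padic_int) n = (p ^ k * y n) mod p ^ n"
      by (simp add: times_padic_int.rep_eq res p_def mod_simps)
    also have "\<dots> = residue x n"
      unfolding y[symmetric] using residue_add_mod[of x n k] by (simp add: p_def)
    finally show "residue x n = residue (of_nat CARD('p) ^ k * Abs_padic_int y :: 'p padic_int) n" ..
  qed
  then show "of_nat CARD('p) ^ k dvd x"
    by simp
qed

lemma prime_elem_padic: "prime_elem (of_nat CARD('p) :: 'p :: prime_card padic_int)"
proof (rule prime_elemI)
  let ?p = "of_nat CARD('p) :: 'p padic_int"
  have dvd: "?p dvd x \<longleftrightarrow> residue x 1 = 0" for x
    using power_dvd_padic_iff[of 1 x] by simp
  show "?p \<noteq> 0"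
    by simp
  show "\<not> ?p dvd 1"
    unfolding dvd using card_prime_gt_1[where 'p = 'p] by (simp add: one_padic_int.rep_eq)
  fix a b assume "?p dvd a * b"
  then have "int CARD('p) dvd residue a 1 * residue b 1"
    unfolding dvd by (simp add: times_padic_int.rep_eq mod_eq_0_iff_dvd)
  then have "int CARD('p) dvd residue a 1 \<or> int CARD('p) dvd residue b 1"
    using prime_card[where 'a = 'p] by (simp add: prime_dvd_mult_iff)
  then show "?p dvd a \<or> ?p dvd b"
    unfolding dvd using residue_mod[of a 1] residue_mod[of b 1] by auto
qed

text \<open>An element prime to p has an inverse modulo every power of p. Such inverses are unique
  modulo that power, so arbitrarily chosen ones are compatible once reduced, and they form a p-adic
  integer.\<close>

lemma padic_unit:
  fixes x :: "'p :: prime_card padic_int"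
  assumes "\<not> of_nat CARD('p) dvd x"
  shows "x dvd 1"
proof -
  define p where "p = int CARD('p)"
  have p: "prime p" "p > 1"
    using prime_card[where 'a = 'p] card_prime_gt_1[where 'p = 'p] by (simp_all add: p_def)
  have "residue x 1 \<noteq> 0"
    using assms power_dvd_padic_iff[of 1 x] by simp
  have cop: "coprime (residue x n) (p ^ n)" for n
  proof (cases n)
    case (Suc m)
    have "residue x n mod p \<noteq> 0"
      using residue_add_mod[of x 1 m] \<open>residue x 1 \<noteq> 0\<close> by (simp add: p_def Suc)
    then have "coprime p (residue x n)"
      using p(1) by (intro prime_imp_coprime) auto
    then show ?thesis
      by (simp add: coprime_commute)
  qed simp
  have "\<exists>z. [residue x n * z = 1] (mod p ^ n)" for n
    by (rule cong_solve_coprime_int[OF cop])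
  then obtain z where z: "\<And>n. [residue x n * z n = 1] (mod p ^ n)"
    by metis
  define y where "y n = z n mod p ^ n" for n
  have inv: "[residue x n * y n = 1] (mod p ^ n)" for n
    using z[of n] by (simp add: y_def cong_def mod_simps)
  have y: "y n mod p ^ n = y n" for n
    by (simp add: y_def)
  have "y (Suc n) mod p ^ n = y n" for n
  proof -
    have "[residue x (Suc n) * y (Suc n) = 1] (mod p ^ n)"
      by (rule cong_dvd_modulus[OF inv]) (simp add: le_imp_power_dvd)
    moreover have "[residue x (Suc n) = residue x n] (mod p ^ n)"
      using residue_Suc_mod[of x n] by (simp add: cong_def p_def)
    ultimately have "[residue x n * y (Suc n) = residue x n * y n] (mod p ^ n)"
      by (meson cong_scalar_right cong_sym cong_trans inv)
    then have "[y (Suc n) = y n] (mod p ^ n)"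
      using cop by (simp add: cong_mult_lcancel)
    then show ?thesis
      using y[of n] by (simp add: cong_def)
  qed
  with y have res: "residue (Abs_padic_int y :: 'p padic_int) = y"
    by (subst Abs_padic_int_inverse) (simp_all add: p_def)
  have "x * Abs_padic_int y = 1"
    using inv by (intro residue_inject[THEN iffD1] ext)
      (simp add: times_padic_int.rep_eq one_padic_int.rep_eq res cong_def p_def)
  then show ?thesis
    by (metis dvd_triv_left)
qed

lemma padic_eq_0:
  assumes "\<And>k. of_nat CARD('p) ^ k dvd (x :: 'p :: prime_card padic_int)"
  shows "x = 0"
  using assms by (intro residue_inject[THEN iffD1] ext) (simp add: power_dvd_padic_iff zero_padic_int.rep_eq)

text \<open>A nonzero \<open>x\<close> is a power of p times a unit. This is what allows
  denominators in the closure to be taken as powers of p.\<close>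

lemma padic_dvd_prime_power:
  fixes x :: "'p :: prime_card padic_int"
  assumes "x \<noteq> 0"
  shows "\<exists>k. x dvd of_nat CARD('p) ^ k"
proof -
  let ?p = "of_nat CARD('p) :: 'p padic_int"
  \<comment> \<open>The least failing exponent, one more than the valuation of
    \<open>x\<close>.\<close>
  define n where "n = (LEAST n. \<not> ?p ^ n dvd x)"
  have "\<exists>n. \<not> ?p ^ n dvd x"
    using padic_eq_0 assms by blast
  then have n: "\<not> ?p ^ n dvd x"
    unfolding n_def by (rule LeastI_ex)
  then obtain k where k: "n = Suc k"
    by (cases n) auto
  then have "?p ^ k dvd x"
    using not_less_Least[of k "\<lambda>n. \<not> ?p ^ n dvd x"] by (auto simp: n_def)
  then obtain u where u: "x = ?p ^ k * u" ..
  with n k have "\<not> ?p dvd u"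
    by (auto simp: mult.commute)
  then obtain w where "1 = u * w"
    using padic_unit by (auto simp: dvd_def)
  then have "?p ^ k = x * w"
    by (simp add: u mult.assoc)
  then show ?thesis
    by (metis dvd_triv_left)
qed

lemma padic_approx:
  fixes x :: "'p :: prime_card padic_int"
  shows "\<exists>y. x = of_nat (nat (residue x n)) + of_nat CARD('p) ^ n * y"
proof -
  have "of_nat CARD('p) ^ n dvd x - of_nat (nat (residue x n))"
    unfolding power_dvd_padic_iff minus_padic_int.rep_eq residue_of_nat
    by (simp add: residue_nonneg)
  then obtain y where "x - of_nat (nat (residue x n)) = of_nat CARD('p) ^ n * y" ..
  then show ?thesis
    by (metis add.commute diff_add_cancel)
qed

interpretation of_padic_int: inj_idom_hom "of_padic_int :: 'p :: prime_card padic_int \<Rightarrow> 'p padic_closure"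
  by unfold_locales (simp_all add: of_padic_int_def)

lemma of_padic_int_simps [simp]:
  "of_padic_int (x + y) = of_padic_int x + of_padic_int y"
  "of_padic_int (x * y) = of_padic_int x * of_padic_int y"
  "of_padic_int (x - y) = of_padic_int x - of_padic_int y"
  "of_padic_int (- x) = - of_padic_int x"
  "of_padic_int (x ^ n) = of_padic_int x ^ n"
  "of_padic_int (of_nat n) = of_nat n"
proof -
  show "of_padic_int (x ^ n) = of_padic_int x ^ n"
    by (induction n) (simp_all add: of_padic_int_def)
  show "of_padic_int (of_nat n) = of_nat n"
    by (induction n) (simp_all add: of_padic_int_def)
qed (simp_all add: of_padic_int_def)

section \<open>The integral closure is a ring\<close>

definition padic_span :: "('i \<Rightarrow> 'p :: prime_card padic_closure) \<Rightarrow> 'i set \<Rightarrow> 'p padic_closure set" where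
  "padic_span b I = {z. \<exists>c. z = (\<Sum>i\<in>I. of_padic_int (c i) * b i)}"

lemma padic_span_add: "x \<in> padic_span b I \<Longrightarrow> y \<in> padic_span b I \<Longrightarrow> x + y \<in> padic_span b I"
proof -
  assume "x \<in> padic_span b I" "y \<in> padic_span b I"
  then obtain c d where "x = (\<Sum>i\<in>I. of_padic_int (c i) * b i)" "y = (\<Sum>i\<in>I. of_padic_int (d i) * b i)"
    by (auto simp: padic_span_def)
  then have "x + y = (\<Sum>i\<in>I. of_padic_int (c i + d i) * b i)"
    by (simp add: distrib_right sum.distrib)
  then show ?thesis
    unfolding padic_span_def by (intro CollectI exI)
qed

lemma padic_span_scale: "x \<in> padic_span b I \<Longrightarrow> of_padic_int a * x \<in> padic_span b I"
proof -
  assume "x \<in> padic_span b I"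
  then obtain c where "x = (\<Sum>i\<in>I. of_padic_int (c i) * b i)"
    by (auto simp: padic_span_def)
  then have "of_padic_int a * x = (\<Sum>i\<in>I. of_padic_int (a * c i) * b i)"
    by (simp add: sum_distrib_left mult.assoc)
  then show ?thesis
    unfolding padic_span_def by (intro CollectI exI)
qed

lemma padic_span_0: "0 \<in> padic_span b I"
  unfolding padic_span_def by (rule CollectI, rule exI[of _ "\<lambda>_. 0"]) simp

lemma padic_span_sum: "(\<And>j. j \<in> J \<Longrightarrow> f j \<in> padic_span b I) \<Longrightarrow> sum f J \<in> padic_span b I"
  by (induction J rule: infinite_finite_induct) (auto intro: padic_span_0 padic_span_add)

lemma padic_span_base:
  assumes "finite I" "i \<in> I"
  shows "b i \<in> padic_span b I"
proof -
  have "b i = (\<Sum>j\<in>I. of_padic_int (if j = i then 1 else 0) * b j)"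
    using assms by (simp add: if_distrib[of of_padic_int] if_distrib[of "\<lambda>x. x * _"] cong: if_cong)
  then show ?thesis
    unfolding padic_span_def by (intro CollectI exI)
qed

lemma padic_span_mult:
  assumes "\<And>i. i \<in> I \<Longrightarrow> z * b i \<in> padic_span b I" "x \<in> padic_span b I"
  shows "z * x \<in> padic_span b I"
proof -
  obtain c where "x = (\<Sum>i\<in>I. of_padic_int (c i) * b i)"
    using assms(2) by (auto simp: padic_span_def)
  then have "z * x = (\<Sum>i\<in>I. of_padic_int (c i) * (z * b i))"
    by (simp add: sum_distrib_left mult_ac)
  then show ?thesis
    using assms(1) by (auto intro: padic_span_sum padic_span_scale)
qed

text \<open>The characteristic polynomial of multiplication by \<open>z\<close> on the module is monic and kills \<open>z\<close>.\<close>

lemma integral_if_stable_span: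
  assumes "finite I" "k \<in> I" "b k \<noteq> 0" "\<And>i. i \<in> I \<Longrightarrow> z * b i \<in> padic_span b I"
  shows "z \<in> padic_integral_closure"
proof -
  have "\<forall>i\<in>I. \<exists>c. z * b i = (\<Sum>j\<in>I. of_padic_int (c j) * b j)"
    using assms(4) by (auto simp: padic_span_def)
  then obtain a where a: "\<And>i. i \<in> I \<Longrightarrow> z * b i = (\<Sum>j\<in>I. of_padic_int (a i j) * b j)"
    by metis
  define A where "A = matrix_on I a"
  let ?B = "map_mat of_padic_int A" and ?n = "card I"
  have A: "A \<in> carrier_mat ?n ?n"
    unfolding A_def by (rule matrix_on_carrier[OF assms(1)])
  obtain xs where xs: "distinct xs" "set xs = I" "length xs = card I"
    and "matrix_on I a = mat ?n ?n (\<lambda>(i, j). a (xs ! i) (xs ! j))"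
    using matrix_on_enum[OF assms(1)] by metis
  then have A_eq: "A = mat ?n ?n (\<lambda>(i, j). a (xs ! i) (xs ! j))"
    by (simp add: A_def)
  have bij: "bij_betw ((!) xs) {..<?n} I"
    using bij_betw_nth[of xs] xs by auto
  \<comment> \<open>The generators may be linearly dependent, so \<open>a\<close> is merely one
    choice of coefficients. It suffices that the nonzero vector of generators is an eigenvector with
    eigenvalue \<open>z\<close>.\<close>
  define v where "v = vec ?n (\<lambda>i. b (xs ! i))"
  have "?B *\<^sub>v v = z \<cdot>\<^sub>v v"
  proof (rule eq_vecI)
    fix i assume "i < dim_vec (z \<cdot>\<^sub>v v)"
    then have i: "i < ?n"
      by (simp add: v_def)
    have "(?B *\<^sub>v v) $ i = (\<Sum>j<?n. of_padic_int (a (xs ! i) (xs ! j)) * b (xs ! j))"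
      using i by (simp add: A_eq v_def scalar_prod_def atLeast0LessThan)
    also have "\<dots> = (\<Sum>t\<in>I. of_padic_int (a (xs ! i) t) * b t)"
      by (rule sum.reindex_bij_betw[OF bij])
    also have "\<dots> = z * b (xs ! i)"
      using i xs by (intro a[symmetric]) auto
    finally show "(?B *\<^sub>v v) $ i = (z \<cdot>\<^sub>v v) $ i"
      using i by (simp add: v_def)
  qed (simp add: v_def A_eq)
  moreover obtain i where "i < ?n" "xs ! i = k"
    using xs assms(2) by (metis in_set_conv_nth)
  then have "v $ i \<noteq> 0" "i < ?n"
    using assms(3) by (simp_all add: v_def)
  then have "v \<noteq> 0\<^sub>v ?n"
    by auto
  ultimately have "eigenvector ?B v z"
    using A by (simp add: eigenvector_def v_def)
  then have "poly (char_poly ?B) z = 0"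
    using eigenvalue_root_char_poly[of ?B ?n z] A by (auto simp: eigenvalue_def)
  then have "poly (map_poly of_padic_int (char_poly A)) z = 0"
    by (simp add: of_padic_int.char_poly_hom[OF A])
  moreover have "lead_coeff (char_poly A) = 1"
    using degree_monic_char_poly[OF A] by auto
  ultimately show ?thesis
    unfolding padic_integral_closure_def by (intro CollectI exI conjI)
qed

text \<open>A relation between powers spares the construction of monic polynomials: it makes the
  span of \<open>1, z, ..., z ^ (m - 1)\<close> stable under \<open>z\<close>. The case
  \<open>m = 0\<close> would read \<open>1 = 0\<close>.\<close>

lemma integral_iff:
  "z \<in> padic_integral_closure \<longleftrightarrow> (\<exists>m c. z ^ m = (\<Sum>i<m. of_padic_int (c i) * z ^ i))"
proof
  assume "z \<in> padic_integral_closure"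
  then obtain f where f: "lead_coeff f = 1" "poly (map_poly of_padic_int f) z = 0"
    by (auto simp: padic_integral_closure_def)
  have "0 = (\<Sum>i\<le>degree f. of_padic_int (coeff f i) * z ^ i)"
    using f(2) by (simp add: poly_altdef)
  also have "\<dots> = (\<Sum>i<degree f. of_padic_int (coeff f i) * z ^ i) + z ^ degree f"
    using f(1) by (simp add: lessThan_Suc_atMost[symmetric])
  finally have "z ^ degree f = (\<Sum>i<degree f. of_padic_int (- coeff f i) * z ^ i)"
    by (simp add: sum_negf eq_neg_iff_add_eq_0 add.commute)
  then show "\<exists>m c. z ^ m = (\<Sum>i<m. of_padic_int (c i) * z ^ i)"
    by (intro exI)
next
  assume "\<exists>m c. z ^ m = (\<Sum>i<m. of_padic_int (c i) * z ^ i)"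
  then obtain m c where z: "z ^ m = (\<Sum>i<m. of_padic_int (c i) * z ^ i)"
    by blast
  then have m: "m > 0"
    by (cases m) auto
  have "z * z ^ i \<in> padic_span ((^) z) {..<m}" if "i < m" for i
  proof (cases "Suc i < m")
    case True
    then show ?thesis
      using padic_span_base[of "{..<m}" "Suc i" "(^) z"] by simp
  next
    case False
    then have "z * z ^ i = (\<Sum>i<m. of_padic_int (c i) * z ^ i)"
      using that z by (metis Suc_lessI power_Suc)
    then show ?thesis
      by (auto simp: padic_span_def)
  qed
  then show "z \<in> padic_integral_closure"
    using m by (intro integral_if_stable_span[of "{..<m}" 0 "(^) z"]) auto
qed

lemma integral_of_padic_int [simp]: "of_padic_int a \<in> padic_integral_closure"
  unfolding integral_iff by (rule exI[of _ 1], rule exI[of _ "\<lambda>_. a"]) simp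

lemma integral_of_nat [simp]: "of_nat n \<in> padic_integral_closure"
  using integral_of_padic_int[of "of_nat n"] by simp

lemma integral_0 [simp]: "0 \<in> padic_integral_closure"
  using integral_of_padic_int[of 0] by simp

lemma integral_1 [simp]: "1 \<in> padic_integral_closure"
  using integral_of_padic_int[of 1] by simp

text \<open>The monomials \<open>x ^ i * y ^ j\<close> with \<open>i < m\<close> and
  \<open>j < n\<close> span a module stable under \<open>x\<close> and under \<open>y\<close>, hence
  under their sum and their product.\<close>

lemma integral_add_mult:
  assumes "x \<in> padic_integral_closure" "y \<in> padic_integral_closure"
  shows "x + y \<in> padic_integral_closure" "x * y \<in> padic_integral_closure"
proof -
  obtain m c where x: "x ^ m = (\<Sum>i<m. of_padic_int (c i) * x ^ i)"
    using assms(1) integral_iff by blast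
  obtain n d where y: "y ^ n = (\<Sum>i<n. of_padic_int (d i) * y ^ i)"
    using assms(2) integral_iff by blast
  have mn: "m > 0" "n > 0"
    using x y by (auto intro: Nat.gr0I)
  define I where "I = {..<m} \<times> {..<n}"
  define b where "b = (\<lambda>(i, j). x ^ i * y ^ j)"
  have I: "finite I"
    by (simp add: I_def)
  have stable_x: "x * b p \<in> padic_span b I" if "p \<in> I" for p
  proof -
    obtain i j where p: "p = (i, j)" "i < m" "j < n"
      using \<open>p \<in> I\<close> by (auto simp: I_def)
    show ?thesis
    proof (cases "Suc i < m")
      case True
      then show ?thesis
        using padic_span_base[OF I, of "(Suc i, j)" b] p by (simp add: b_def I_def mult_ac)
    next
      case False
      then have "x * b p = x ^ m * y ^ j"
        using p by (metis (no_types, lifting) Suc_lessI b_def case_prod_conv mult.assoc power_Suc)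
      also have "\<dots> = (\<Sum>i<m. of_padic_int (c i) * b (i, j))"
        by (simp add: x sum_distrib_right b_def mult.assoc)
      also have "\<dots> \<in> padic_span b I"
        using p by (intro padic_span_sum padic_span_scale padic_span_base[OF I]) (auto simp: I_def)
      finally show ?thesis .
    qed
  qed
  have stable_y: "y * b p \<in> padic_span b I" if "p \<in> I" for p
  proof -
    obtain i j where p: "p = (i, j)" "i < m" "j < n"
      using \<open>p \<in> I\<close> by (auto simp: I_def)
    show ?thesis
    proof (cases "Suc j < n")
      case True
      then show ?thesis
        using padic_span_base[OF I, of "(i, Suc j)" b] p by (simp add: b_def I_def mult_ac)
    next
      case False
      then have "Suc j = n"
        using p by simp
      then have "x ^ i * y ^ n = y * b p"
        using p by (auto simp: b_def mult_ac)
      then have "y * b p = x ^ i * y ^ n" ..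
      also have "\<dots> = (\<Sum>j<n. of_padic_int (d j) * b (i, j))"
        by (simp add: y sum_distrib_left b_def mult_ac)
      also have "\<dots> \<in> padic_span b I"
        using p by (intro padic_span_sum padic_span_scale padic_span_base[OF I]) (auto simp: I_def)
      finally show ?thesis .
    qed
  qed
  have "(x + y) * b p \<in> padic_span b I" "(x * y) * b p \<in> padic_span b I" if "p \<in> I" for p
    using padic_span_add[OF stable_x[OF that] stable_y[OF that]] padic_span_mult[OF stable_x stable_y[OF that]]
    by (simp_all add: distrib_right mult.assoc)
  moreover have "(0, 0) \<in> I" "b (0, 0) \<noteq> 0"
    using mn by (auto simp: I_def b_def)
  ultimately show "x + y \<in> padic_integral_closure" "x * y \<in> padic_integral_closure"
    using integral_if_stable_span[OF I] by blast+
qed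

lemma integral_uminus:
  assumes "x \<in> padic_integral_closure"
  shows "- x \<in> padic_integral_closure"
  using integral_add_mult(2)[OF integral_of_padic_int[of "- 1"] assms] by simp

lemma integral_diff:
  "x \<in> padic_integral_closure \<Longrightarrow> y \<in> padic_integral_closure \<Longrightarrow> x - y \<in> padic_integral_closure"
  using integral_add_mult(1)[OF _ integral_uminus] by fastforce

lemma integral_power: "x \<in> padic_integral_closure \<Longrightarrow> x ^ n \<in> padic_integral_closure"
  by (induction n) (auto intro: integral_add_mult)

lemma integral_sum: "(\<And>i. i \<in> A \<Longrightarrow> f i \<in> padic_integral_closure) \<Longrightarrow> sum f A \<in> padic_integral_closure"
  by (induction A rule: infinite_finite_induct) (auto intro: integral_add_mult)

lemma integral_prod: "(\<And>i. i \<in> A \<Longrightarrow> f i \<in> padic_integral_closure) \<Longrightarrow> prod f A \<in> padic_integral_closure"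
  by (induction A rule: infinite_finite_induct) (auto intro: integral_add_mult)

lemma integral_root_of_unity:
  assumes "z ^ N = 1" "N > 0"
  shows "z \<in> padic_integral_closure"
  unfolding integral_iff
proof (intro exI)
  show "z ^ N = (\<Sum>i<N. of_padic_int (if i = 0 then 1 else 0) * z ^ i)"
    using assms by (simp add: if_distrib[of of_padic_int] if_distrib[of "\<lambda>x. x * _"] cong: if_cong)
qed

section \<open>Denominators, and integral closedness of the p-adic integers\<close>

lemma clear_denominators:
  fixes f :: "nat \<Rightarrow> 'a :: idom fract"
  shows "\<exists>d. d \<noteq> 0 \<and> (\<forall>i\<le>n. to_fract d * f i \<in> range to_fract)"
proof (induction n)
  case 0
  obtain a b where "f 0 = Fract a b" "b \<noteq> 0"
    by (cases "f 0") auto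
  then show ?case
    by (intro exI[of _ b]) (auto simp: Fract_conv_to_fract)
next
  case (Suc n)
  then obtain d where d: "d \<noteq> 0" "\<And>i. i \<le> n \<Longrightarrow> to_fract d * f i \<in> range to_fract"
    by blast
  obtain a b where ab: "f (Suc n) = Fract a b" "b \<noteq> 0"
    by (cases "f (Suc n)") auto
  show ?case
  proof (intro exI[of _ "b * d"] conjI allI impI)
    fix i assume "i \<le> Suc n"
    show "to_fract (b * d) * f i \<in> range to_fract"
    proof (cases "i = Suc n")
      case True
      then have "to_fract (b * d) * f i = to_fract (d * a)"
        using ab by (simp add: Fract_conv_to_fract)
      then show ?thesis
        by blast
    next
      case False
      with \<open>i \<le> Suc n\<close> obtain c where "to_fract d * f i = to_fract c"
        using d(2)[of i] by auto
      then have "to_fract (b * d) * f i = to_fract (b * c)"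
        by (simp add: mult.assoc)
      then show ?thesis
        by blast
    qed
  qed (use d ab in auto)
qed

text \<open>Clear denominators in an algebraic equation of degree \<open>m\<close> for
  \<open>x\<close> and let \<open>a\<close> be the new leading coefficient. Multiplied by
  \<open>a ^ (m - 1)\<close>, it becomes a monic equation for \<open>a * x\<close>.\<close>

lemma integral_multiple:
  fixes x :: "'p :: prime_card padic_closure"
  shows "\<exists>a. a \<noteq> 0 \<and> of_padic_int a * x \<in> padic_integral_closure"
proof -
  obtain f :: "'p padic poly" where f: "f \<noteq> 0" "poly (map_poly to_ac f) x = 0"
    by (rule alg_closure_algebraic)
  define m where "m = degree f"
  obtain d where d: "d \<noteq> 0" "\<And>i. i \<le> m \<Longrightarrow> to_fract d * coeff f i \<in> range to_fract"
    using clear_denominators[of m "coeff f"] by blast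
  then have "\<forall>i\<in>{..m}. \<exists>g. to_fract d * coeff f i = to_fract g"
    by auto
  then obtain g where g: "\<And>i. i \<le> m \<Longrightarrow> to_fract d * coeff f i = to_fract (g i)"
    by (metis atMost_iff)
  define a where "a = g m"
  have "to_fract a = to_fract d * lead_coeff f"
    unfolding a_def m_def[symmetric] by (rule g[symmetric]) simp
  moreover have "to_fract d \<noteq> 0" "lead_coeff f \<noteq> 0"
    using d(1) f(1) by (simp_all only: to_fract_eq_0_iff leading_coeff_0_iff not_False_eq_True)
  ultimately have "to_fract a \<noteq> 0"
    by (simp only: mult_eq_0_iff) simp
  then have a0: "a \<noteq> 0"
    by simp
  have c: "coeff (map_poly to_ac f) i = to_ac (coeff f i)" for i
    by (simp add: coeff_map_poly)
  have deg: "degree (map_poly to_ac f) = m"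
    unfolding m_def by (rule degree_map_poly) auto
  have "0 = to_ac (to_fract d) * poly (map_poly to_ac f) x"
    by (simp add: f)
  also have "\<dots> = (\<Sum>i\<le>m. to_ac (to_fract d * coeff f i) * x ^ i)"
    by (simp add: poly_altdef deg c sum_distrib_left mult.assoc)
  also have "\<dots> = (\<Sum>i\<le>m. of_padic_int (g i) * x ^ i)"
    using g by (intro sum.cong) (simp_all add: of_padic_int_def)
  also have "\<dots> = (\<Sum>i<m. of_padic_int (g i) * x ^ i) + of_padic_int a * x ^ m"
    by (simp add: lessThan_Suc_atMost[symmetric] a_def)
  finally have rel: "of_padic_int a * x ^ m = (\<Sum>i<m. of_padic_int (- g i) * x ^ i)"
    by (simp add: sum_negf eq_neg_iff_add_eq_0 add.commute)
  then have m: "m > 0"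
    using a0 by (cases m) auto
  define z where "z = of_padic_int a * x"
  have "z ^ m = of_padic_int a ^ (m - 1) * (of_padic_int a * x ^ m)"
    using m unfolding z_def by (cases m) (simp_all add: power_mult_distrib mult_ac)
  also have "\<dots> = (\<Sum>i<m. of_padic_int (- g i * a ^ (m - 1 - i)) * z ^ i)"
    unfolding rel sum_distrib_left
  proof (rule sum.cong)
    fix i assume "i \<in> {..<m}"
    then have "a ^ (m - 1) = a ^ (m - 1 - i) * a ^ i"
      by (simp flip: power_add)
    then have "of_padic_int a ^ (m - 1) = of_padic_int a ^ (m - 1 - i) * of_padic_int a ^ i"
      by (metis of_padic_int_simps(2,5))
    then show "of_padic_int a ^ (m - 1) * (of_padic_int (- g i) * x ^ i) =
        of_padic_int (- g i * a ^ (m - 1 - i)) * z ^ i"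
      by (simp add: z_def power_mult_distrib mult_ac del: One_nat_def)
  qed simp
  finally have "z \<in> padic_integral_closure"
    unfolding integral_iff by (intro exI)
  with a0 show ?thesis
    by (auto simp: z_def)
qed

text \<open>With a power of p as denominator, scaling by \<open>x\<close> lowers the index of a
  neighbourhood by a fixed amount.\<close>

lemma integral_prime_power_multiple:
  fixes x :: "'p :: prime_card padic_closure"
  shows "\<exists>k. of_nat CARD('p) ^ k * x \<in> padic_integral_closure"
proof -
  obtain a where a: "a \<noteq> 0" "of_padic_int a * x \<in> padic_integral_closure"
    using integral_multiple by blast
  obtain k b where "of_nat CARD('p) ^ k = a * b"
    using padic_dvd_prime_power[OF a(1)] by (auto simp: dvd_def)
  then have "of_nat CARD('p) ^ k = of_padic_int a * of_padic_int b"
    by (metis of_padic_int_simps(2,5,6))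
  then have "of_nat CARD('p) ^ k * x = of_padic_int b * (of_padic_int a * x)"
    by simp
  then show ?thesis
    using integral_add_mult(2)[OF integral_of_padic_int[of b] a(2)] by metis
qed

text \<open>Multiply a monic equation of degree \<open>m\<close> for \<open>c / p\<close> by the
  m-th power of p: every term but \<open>c ^ m\<close> carries a factor p, so p divides
  \<open>c ^ m\<close>, and p is prime.\<close>

lemma integrally_closed_step:
  fixes c :: "'p :: prime_card padic_int"
  assumes "of_padic_int c / of_nat CARD('p) \<in> padic_integral_closure"
  shows "of_nat CARD('p) dvd c"
proof -
  let ?p = "of_nat CARD('p) :: 'p padic_int"
  define z where "z = of_padic_int c / of_nat CARD('p)"
  have c: "of_padic_int c = of_padic_int ?p * z"
    by (simp add: z_def)
  obtain m a where z: "z ^ m = (\<Sum>i<m. of_padic_int (a i) * z ^ i)"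
    using assms integral_iff unfolding z_def by blast
  have "of_padic_int (c ^ m) = of_padic_int ?p ^ m * z ^ m"
    by (simp only: of_padic_int_simps(5) c power_mult_distrib)
  also have "\<dots> = (\<Sum>i<m. of_padic_int (?p * (a i * ?p ^ (m - Suc i) * c ^ i)))"
    unfolding z sum_distrib_left
  proof (rule sum.cong)
    fix i assume "i \<in> {..<m}"
    then have "m = Suc ((m - Suc i) + i)"
      by simp
    then have "of_padic_int ?p ^ m = of_padic_int ?p * (of_padic_int ?p ^ (m - Suc i) * of_padic_int ?p ^ i)"
      by (metis power_Suc power_add)
    then show "of_padic_int ?p ^ m * (of_padic_int (a i) * z ^ i) =
        of_padic_int (?p * (a i * ?p ^ (m - Suc i) * c ^ i))"
      unfolding of_padic_int_simps(2,5) c power_mult_distrib by (simp only: mult_ac)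
  qed simp
  also have "\<dots> = of_padic_int (?p * (\<Sum>i<m. a i * ?p ^ (m - Suc i) * c ^ i))"
    by (simp only: of_padic_int.hom_sum sum_distrib_left)
  finally have "c ^ m = ?p * (\<Sum>i<m. a i * ?p ^ (m - Suc i) * c ^ i)"
    by (simp only: of_padic_int.eq_iff)
  then have "?p dvd c ^ m"
    by (metis dvd_triv_left)
  then show ?thesis
    by (rule prime_elem_dvd_power[OF prime_elem_padic])
qed

lemma integrally_closed:
  fixes c :: "'p :: prime_card padic_int"
  assumes "of_padic_int c = of_nat CARD('p) ^ k * z" "z \<in> padic_integral_closure"
  shows "of_nat CARD('p) ^ k dvd c"
  using assms
proof (induction k arbitrary: z)
  case (Suc k)
  have "of_nat CARD('p) * z \<in> padic_integral_closure"
    using Suc.prems(2) by (intro integral_add_mult) simp_all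
  then obtain b where b: "c = of_nat CARD('p) ^ k * b"
    using Suc.IH[of "of_nat CARD('p) * z"] Suc.prems(1) by (auto simp: mult_ac)
  then have "of_padic_int b = of_nat CARD('p) * z"
    using Suc.prems(1) by simp
  then have "of_nat CARD('p) dvd b"
    using Suc.prems(2) by (intro integrally_closed_step) simp
  then show ?case
    unfolding b by (simp add: mult_dvd_mono mult.commute)
qed simp

section \<open>Neighbourhoods of zero\<close>

lemma padic_nbhd_add: "x \<in> padic_nbhd k \<Longrightarrow> y \<in> padic_nbhd k \<Longrightarrow> x + y \<in> padic_nbhd k"
  unfolding padic_nbhd_def by (auto simp flip: distrib_left intro!: imageI integral_add_mult)

lemma padic_nbhd_uminus: "x \<in> padic_nbhd k \<Longrightarrow> - x \<in> padic_nbhd k"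
  unfolding padic_nbhd_def by (auto simp flip: mult_minus_right intro!: imageI integral_uminus)

lemma padic_nbhd_diff: "x \<in> padic_nbhd k \<Longrightarrow> y \<in> padic_nbhd k \<Longrightarrow> x - y \<in> padic_nbhd k"
  using padic_nbhd_add[OF _ padic_nbhd_uminus] by fastforce

lemma padic_nbhd_mult: "x \<in> padic_nbhd k \<Longrightarrow> y \<in> padic_nbhd l \<Longrightarrow> x * y \<in> padic_nbhd (k + l)"
proof -
  assume "x \<in> padic_nbhd k" "y \<in> padic_nbhd l"
  then obtain u w where u: "u \<in> padic_integral_closure" "x = of_nat CARD('a) ^ k * u"
    and w: "w \<in> padic_integral_closure" "y = of_nat CARD('a) ^ l * w"
    by (auto simp: padic_nbhd_def)
  then have "x * y = of_nat CARD('a) ^ (k + l) * (u * w)"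
    by (simp add: power_add mult_ac)
  moreover have "u * w \<in> padic_integral_closure"
    using u w by (intro integral_add_mult)
  ultimately show ?thesis
    unfolding padic_nbhd_def by (rule image_eqI)
qed

lemma padic_nbhd_0_eq: "padic_nbhd 0 = padic_integral_closure"
  by (simp add: padic_nbhd_def)

lemma padic_nbhd_scale: "x \<in> padic_nbhd k \<Longrightarrow> y \<in> padic_integral_closure \<Longrightarrow> x * y \<in> padic_nbhd k"
  using padic_nbhd_mult[of x k y 0] by (simp add: padic_nbhd_0_eq)

lemma padic_nbhd_zero [simp]: "0 \<in> padic_nbhd k"
  unfolding padic_nbhd_def by (rule image_eqI[of _ _ 0]) simp_all

lemma padic_nbhd_sum: "(\<And>i. i \<in> A \<Longrightarrow> f i \<in> padic_nbhd k) \<Longrightarrow> sum f A \<in> padic_nbhd k"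
  by (induction A rule: infinite_finite_induct) (auto intro: padic_nbhd_add)

lemma prime_power_in_nbhd: "of_nat CARD('p) ^ k \<in> (padic_nbhd k :: 'p :: prime_card padic_closure set)"
  unfolding padic_nbhd_def by (rule image_eqI[of _ _ 1]) simp_all

lemma padic_nbhd_mono: "k \<le> l \<Longrightarrow> padic_nbhd l \<subseteq> padic_nbhd k"
proof
  fix x :: "'p :: prime_card padic_closure"
  assume kl: "k \<le> l" and "x \<in> padic_nbhd l"
  then obtain u where u: "u \<in> padic_integral_closure" "x = of_nat CARD('p) ^ l * u"
    by (auto simp: padic_nbhd_def)
  have "l = k + (l - k)"
    using kl by simp
  then have "x = of_nat CARD('p) ^ k * (of_nat CARD('p) ^ (l - k) * u)"
    unfolding u(2) by (metis mult.assoc power_add)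
  then show "x \<in> padic_nbhd k"
    unfolding padic_nbhd_def using u(1) by (auto intro!: integral_add_mult integral_power)
qed

text \<open>For \<open>x \<noteq> 0\<close> some \<open>a \<noteq> 0\<close> makes
  \<open>a / x\<close> integral. Then \<open>a = x * (a / x)\<close> lies in every neighbourhood,
  and integral closedness turns this into divisibility of \<open>a\<close> by all powers of
  p.\<close>

lemma padic_nbhd_separated:
  fixes x :: "'p :: prime_card padic_closure"
  assumes "\<And>k. x \<in> padic_nbhd k"
  shows "x = 0"
proof (rule ccontr)
  assume x0: "x \<noteq> 0"
  obtain a where a: "a \<noteq> 0" "of_padic_int a * inverse x \<in> padic_integral_closure"
    using integral_multiple by blast
  have "of_nat CARD('p) ^ k dvd a" for k
  proof -
    obtain u where u: "u \<in> padic_integral_closure" "x = of_nat CARD('p) ^ k * u"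
      using assms[of k] by (auto simp: padic_nbhd_def)
    have "of_padic_int a = x * (of_padic_int a * inverse x)"
      using x0 by simp
    then have "of_padic_int a = of_nat CARD('p) ^ k * (u * (of_padic_int a * inverse x))"
      by (simp add: u(2) mult.assoc)
    then show ?thesis
      by (rule integrally_closed) (intro integral_add_mult u a)
  qed
  then have "a = 0"
    by (rule padic_eq_0)
  with a show False
    by simp
qed


section \<open>Evaluation of power series\<close>

text \<open>A factor with denominator at most the c-th power of p costs \<open>c\<close> in
  precision; this is the continuity used in every later estimate.\<close>

lemma nbhd_bounded_mult:
  assumes "x \<in> padic_nbhd (m + c)" "of_nat CARD('p) ^ c * y \<in> (padic_integral_closure :: 'p :: prime_card padic_closure set)"
  shows "y * x \<in> padic_nbhd m"
proof -
  obtain u where u: "u \<in> padic_integral_closure" "x = of_nat CARD('p) ^ (m + c) * u"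
    using assms(1) by (auto simp: padic_nbhd_def)
  have "y * x = of_nat CARD('p) ^ m * ((of_nat CARD('p) ^ c * y) * u)"
    by (simp add: u(2) power_add mult_ac)
  moreover have "(of_nat CARD('p) ^ c * y) * u \<in> padic_integral_closure"
    by (rule integral_add_mult(2)[OF assms(2) u(1)])
  ultimately show ?thesis
    unfolding padic_nbhd_def by (rule image_eqI)
qed

lemma nbhd_power:
  assumes "x \<in> padic_nbhd k"
  shows "x ^ n \<in> padic_nbhd (k * n)"
proof (induction n)
  case (Suc n)
  then show ?case
    using padic_nbhd_mult[OF assms Suc] by simp
qed (simp add: padic_nbhd_0_eq)

lemma nbhd_prod_diff:
  assumes "\<And>i. i \<in> A \<Longrightarrow> x i - y i \<in> padic_nbhd m" "\<And>i. i \<in> A \<Longrightarrow> y i \<in> padic_integral_closure"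
  shows "prod x A - prod y A \<in> padic_nbhd m"
  using assms
proof (induction A rule: infinite_finite_induct)
  case (insert i A)
  have "x i \<in> padic_integral_closure"
  proof -
    have "x i - y i \<in> padic_nbhd 0"
      using insert.prems(1)[of i] padic_nbhd_mono[of 0 m] by auto
    then show ?thesis
      using integral_add_mult(1)[of "x i - y i" "y i"] insert.prems(2) by (simp add: padic_nbhd_0_eq)
  qed
  moreover have "prod y A \<in> padic_integral_closure"
    using insert.prems by (intro integral_prod) auto
  \<comment> \<open>Replacing one factor at a time: this sum equals the difference of the two
    enlarged products.\<close>
  ultimately have "(prod x A - prod y A) * x i + (x i - y i) * prod y A \<in> padic_nbhd m"
    using insert by (intro padic_nbhd_add padic_nbhd_scale) auto
  then show ?case
    using insert by (simp add: algebra_simps)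
qed simp_all

section \<open>Binomial coefficients and roots of unity of p-power order\<close>

lemma prime_dvd_choose_prime_power:
  fixes p :: nat
  assumes "prime p" "0 < j" "j < p ^ n"
  shows "p dvd (p ^ n choose j)"
proof (rule ccontr)
  assume "\<not> p dvd (p ^ n choose j)"
  then have "coprime (p ^ n) (p ^ n choose j)"
    using assms(1) by (simp add: prime_imp_coprime)
  moreover have "p ^ n dvd j * (p ^ n choose j)"
    \<comment> \<open>The identity is
      \<open>j * (p ^ n choose j) = p ^ n * (p ^ n - 1 choose j - 1)\<close>.\<close>
    using times_binomial_minus1_eq[OF assms(2), of "p ^ n"] by simp
  ultimately have "p ^ n dvd j"
    by (simp add: coprime_dvd_mult_left_iff)
  then show False
    using assms by (simp add: nat_dvd_not_less)
qed

text \<open>Expand \<open>1 = ((z - 1) + 1) ^ N\<close> for \<open>N\<close> the n-th power of p.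
  The end terms are 1 and \<open>(z - 1) ^ N\<close>, and p divides all the others.\<close>

lemma root_of_unity_minus_1_nilpotent:
  fixes z :: "'p :: prime_card padic_closure"
  assumes "z ^ (CARD('p) ^ n) = 1"
  shows "(z - 1) ^ (CARD('p) ^ n) \<in> padic_nbhd 1"
proof -
  define s where "s = z - 1"
  define N where "N = CARD('p) ^ n"
  have N: "N > 0"
    by (simp add: N_def)
  have "z \<in> padic_integral_closure"
    using assms N by (intro integral_root_of_unity[of _ N]) (simp_all add: N_def)
  then have s: "s \<in> padic_integral_closure"
    by (simp add: s_def integral_diff)
  have "1 = (s + 1) ^ N"
    using assms by (simp add: s_def N_def)
  also have "\<dots> = (\<Sum>j\<le>N. of_nat (N choose j) * s ^ j)"
    by (simp add: binomial_ring)
  also have "{..N} = insert 0 (insert N {0<..<N})"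
    using N by auto
  also have "(\<Sum>j\<in>\<dots>. of_nat (N choose j) * s ^ j) = 1 + (s ^ N + (\<Sum>j\<in>{0<..<N}. of_nat (N choose j) * s ^ j))"
    using N by simp
  finally have "s ^ N = - (\<Sum>j\<in>{0<..<N}. of_nat (N choose j) * s ^ j)"
    by (simp add: eq_neg_iff_add_eq_0)
  also have "\<dots> \<in> padic_nbhd 1"
  proof (intro padic_nbhd_uminus padic_nbhd_sum padic_nbhd_scale)
    fix j assume "j \<in> {0<..<N}"
    then have "CARD('p) dvd (N choose j)"
      unfolding N_def using prime_card[where 'a = 'p] by (intro prime_dvd_choose_prime_power) auto
    then obtain q where "N choose j = CARD('p) * q" ..
    then show "of_nat (N choose j) \<in> (padic_nbhd 1 :: 'p padic_closure set)"
      using padic_nbhd_scale[OF prime_power_in_nbhd[of 1] integral_of_nat[of q]] by simp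
    show "s ^ j \<in> padic_integral_closure"
      using s by (rule integral_power)
  qed
  finally show ?thesis
    by (simp add: s_def N_def)
qed

text \<open>The products are falling factorials, that is, binomial coefficients freed of their
  denominator \<open>k!\<close>, so congruences pass through them.\<close>

lemma dvd_diff_prod:
  fixes x y :: "'a :: comm_ring_1"
  assumes "m dvd x - y"
  shows "m dvd (\<Prod>i<k. x - of_nat i) - (\<Prod>i<k. y - of_nat i)"
proof (induction k)
  case (Suc k)
  have "m dvd ((\<Prod>i<k. x - of_nat i) - (\<Prod>i<k. y - of_nat i)) * (x - of_nat k) + (\<Prod>i<k. y - of_nat i) * (x - y)"
    using Suc assms by (intro dvd_add dvd_mult dvd_mult2)
  then show ?case
    by (simp add: algebra_simps)
qed simp

text \<open>
  The exponent \<open>j\<close> absorbs the denominator \<open>k!\<close>; with \<open>N = 0\<close> this gives the integrality of the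
  binomial coefficients.
\<close>

lemma gchoose_approx:
  "\<exists>j. \<forall>N a y. (of_padic_int (of_nat a + of_nat CARD('p) ^ (j + N) * y) gchoose k) - of_nat (a choose k)
     \<in> (padic_nbhd N :: 'p :: prime_card padic_closure set)"
proof -
  have "(fact k :: 'p padic_int) \<noteq> 0"
    using of_nat_eq_0_iff[of "fact k", where 'a = "'p padic_int"] by simp
  then obtain j e where e: "of_nat CARD('p) ^ j = fact k * (e :: 'p padic_int)"
    using padic_dvd_prime_power[of "fact k :: 'p padic_int"] by (auto simp: dvd_def)
  have "of_padic_int (of_nat (fact k) :: 'p padic_int) = of_nat (fact k)"
    by (rule of_padic_int_simps)
  then have f: "of_padic_int (fact k :: 'p padic_int) = fact k"
    by (simp only: of_nat_fact)
  have prod: "of_padic_int (\<Prod>i<k. x - of_nat i) = fact k * (of_padic_int x gchoose k)" for x :: "'p padic_int"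
    by (simp add: gbinomial_mult_fact of_padic_int.hom_prod atLeast0LessThan)
  have "(of_padic_int (of_nat a + of_nat CARD('p) ^ (j + N) * y) gchoose k) - of_nat (a choose k)
     \<in> (padic_nbhd N :: 'p padic_closure set)" for N a y
  proof -
    let ?x = "of_nat a + of_nat CARD('p) ^ (j + N) * y"
    have "of_nat CARD('p) ^ (j + N) dvd (\<Prod>i<k. ?x - of_nat i) - (\<Prod>i<k. of_nat a - of_nat i)"
      by (rule dvd_diff_prod) simp
    then obtain w where "(\<Prod>i<k. ?x - of_nat i) - (\<Prod>i<k. of_nat a - of_nat i) = of_nat CARD('p) ^ (j + N) * w" ..
    then have "of_padic_int (\<Prod>i<k. ?x - of_nat i) - of_padic_int (\<Prod>i<k. of_nat a - of_nat i) =
        of_padic_int (of_nat CARD('p) ^ (j + N) * w)"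
      by (metis of_padic_int_simps(3))
    also have "of_nat CARD('p) ^ (j + N) * w = fact k * (of_nat CARD('p) ^ N * (e * w))"
      by (simp add: power_add e mult_ac)
    finally have "fact k * ((of_padic_int ?x gchoose k) - of_nat (a choose k)) =
        fact k * (of_nat CARD('p) ^ N * of_padic_int (e * w))"
      unfolding prod by (simp add: f binomial_gbinomial right_diff_distrib)
    then have "(of_padic_int ?x gchoose k) - of_nat (a choose k) = of_nat CARD('p) ^ N * of_padic_int (e * w)"
      by (simp only: mult_cancel_left fact_nonzero simp_thms)
    then show ?thesis
      by (simp only: padic_nbhd_scale[OF prime_power_in_nbhd integral_of_padic_int])
  qed
  then show ?thesis
    by blast
qed

lemma gchoose_integral: "of_padic_int x gchoose k \<in> padic_integral_closure"
proof -
  obtain j where j: "\<And>N a y. (of_padic_int (of_nat a + of_nat CARD('a) ^ (j + N) * y) gchoose k) - of_nat (a choose k)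
     \<in> (padic_nbhd N :: 'a padic_closure set)"
    using gchoose_approx[of k, where 'p = 'a] by blast
  obtain y where "x = of_nat (nat (residue x j)) + of_nat CARD('a) ^ j * y"
    using padic_approx[of x j] by blast
  then have "(of_padic_int x gchoose k) - of_nat (nat (residue x j) choose k) \<in> padic_integral_closure"
    using j[of "nat (residue x j)" 0 y] by (simp add: padic_nbhd_0_eq)
  from integral_add_mult(1)[OF this integral_of_nat[of "nat (residue x j) choose k"]] show ?thesis
    by simp
qed

lemma gchoose_residue_approx:
  "\<exists>j. \<forall>M\<ge>j. (of_padic_int x gchoose k) - of_nat (nat (residue x M) choose k)
     \<in> (padic_nbhd N :: 'p :: prime_card padic_closure set)"
proof -
  obtain j where j: "\<And>N a y. (of_padic_int (of_nat a + of_nat CARD('p) ^ (j + N) * y) gchoose k) - of_nat (a choose k)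
     \<in> (padic_nbhd N :: 'p padic_closure set)"
    using gchoose_approx[of k, where 'p = 'p] by blast
  have "(of_padic_int x gchoose k) - of_nat (nat (residue x M) choose k) \<in> padic_nbhd N" if "M \<ge> j + N" for M
  proof -
    obtain y where "x = of_nat (nat (residue x M)) + of_nat CARD('p) ^ M * y"
      using padic_approx[of x M] by blast
    then have "(of_padic_int x gchoose k) - of_nat (nat (residue x M) choose k) \<in> padic_nbhd (M - j)"
      using j[of "nat (residue x M)" "M - j" y] that by simp
    moreover have "N \<le> M - j"
      using that by simp
    ultimately show ?thesis
      using padic_nbhd_mono by blast
  qed
  then show ?thesis
    by blast
qed

text \<open>Replace \<open>x\<close> by a natural number \<open>a\<close> close enough to it that
  the first binomial coefficients agree up to the required precision. The finite binomial theorem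
  then gives \<open>z ^ a\<close>, and its terms beyond \<open>L\<close> are small by
  assumption.\<close>

lemma binomial_series_root_of_unity:
  fixes z :: "'p :: prime_card padic_closure"
  assumes z: "z ^ (CARD('p) ^ n) = 1" and L: "\<And>k. k > L \<Longrightarrow> (z - 1) ^ k \<in> padic_nbhd m"
  shows "(\<Sum>k\<le>L. (of_padic_int x gchoose k) * (z - 1) ^ k) - z ^ nat (residue x n) \<in> padic_nbhd m"
proof -
  have "z \<in> padic_integral_closure"
    using z by (intro integral_root_of_unity[of _ "CARD('p) ^ n"]) simp_all
  then have int: "(z - 1) ^ k \<in> padic_integral_closure" for k
    by (simp add: integral_diff integral_power)
  obtain j where j: "\<And>k M. M \<ge> j k \<Longrightarrow> (of_padic_int x gchoose k) - of_nat (nat (residue x M) choose k)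
     \<in> (padic_nbhd m :: 'p padic_closure set)"
    using gchoose_residue_approx[of x _ m] by metis
  \<comment> \<open>The sum dominates every \<open>j k\<close> at once, and the summand
    \<open>n\<close> ensures that \<open>a\<close> is congruent to \<open>x\<close> modulo the n-th
    power of p, which fixes \<open>z ^ a\<close>.\<close>
  define M where "M = n + (\<Sum>k\<le>L. j k)"
  have M: "M \<ge> j k" if "k \<le> L" for k
    using that member_le_sum[of k "{..L}" j] by (simp add: M_def)
  define a where "a = nat (residue x M)"
  have "a mod CARD('p) ^ n = nat (residue x n)"
    unfolding a_def M_def using residue_add_mod[of x n "\<Sum>k\<le>L. j k"] residue_nonneg[of x]
    by (metis nat_int nat_mod_as_int nat_power_eq of_nat_0_le_iff of_nat_power int_nat_eq)
  moreover have "z ^ a = z ^ (a mod CARD('p) ^ n)"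
  proof -
    have "z ^ a = z ^ (CARD('p) ^ n * (a div CARD('p) ^ n) + a mod CARD('p) ^ n)"
      by simp
    then show ?thesis
      unfolding power_add power_mult z by simp
  qed
  ultimately have za: "z ^ nat (residue x n) = z ^ a"
    by simp
  have "z ^ a = ((z - 1) + 1) ^ a"
    by simp
  also have "\<dots> = (\<Sum>k\<le>a. of_nat (a choose k) * (z - 1) ^ k)"
    by (subst binomial_ring) simp
  also have "\<dots> = (\<Sum>k\<le>L + a. of_nat (a choose k) * (z - 1) ^ k)"
    by (intro sum.mono_neutral_left) auto
  also have "\<dots> = (\<Sum>k\<le>L. of_nat (a choose k) * (z - 1) ^ k) + (\<Sum>k\<in>{L<..L + a}. of_nat (a choose k) * (z - 1) ^ k)"
    by (subst sum.union_disjoint[symmetric]) (auto intro!: sum.cong)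
  finally have "(\<Sum>k\<le>L. (of_padic_int x gchoose k) * (z - 1) ^ k) - z ^ a =
      (\<Sum>k\<le>L. ((of_padic_int x gchoose k) - of_nat (a choose k)) * (z - 1) ^ k) -
      (\<Sum>k\<in>{L<..L + a}. of_nat (a choose k) * (z - 1) ^ k)"
    by (simp add: sum_subtractf left_diff_distrib)
  also have "\<dots> \<in> padic_nbhd m"
  proof (intro padic_nbhd_diff padic_nbhd_sum)
    show "((of_padic_int x gchoose k) - of_nat (a choose k)) * (z - 1) ^ k \<in> padic_nbhd m" if "k \<in> {..L}" for k
      unfolding a_def using that by (intro padic_nbhd_scale j M int) simp
    show "of_nat (a choose k) * (z - 1) ^ k \<in> padic_nbhd m" if "k \<in> {L<..L + a}" for k
      using that padic_nbhd_scale[OF L integral_of_nat, of k] by (simp add: mult.commute)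
  qed
  finally show ?thesis
    unfolding za .
qed

section \<open>Series with bounded coefficients at topologically nilpotent points\<close>

locale nilpotent_point =
  fixes t :: "'d :: finite \<Rightarrow> 'p :: prime_card padic_closure"
  assumes t_integral: "t i \<in> padic_integral_closure"
    and t_nilpotent: "\<exists>L. \<forall>k>L. \<forall>i. t i ^ k \<in> padic_nbhd m"
begin

text \<open>p-adic boundedness without an absolute value: one power of p clears all denominators. At
  an integral, topologically nilpotent point this makes all terms outside a large cube
  small.\<close>

definition bounded :: "('d, 'p padic_closure) mfps \<Rightarrow> bool" where
  "bounded f \<longleftrightarrow> (\<exists>c. \<forall>k. of_nat CARD('p) ^ c * mfps_nth f k \<in> padic_integral_closure)"

definition tmonom :: "('d \<Rightarrow> nat) \<Rightarrow> 'p padic_closure" where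
  "tmonom k = (\<Prod>i\<in>UNIV. t i ^ k i)"

text \<open>Cubes are cofinal among the finite sets of multi-indices, and over a cube a sum of
  products of one-variable terms factors by coordinate.\<close>

definition partial :: "('d, 'p padic_closure) mfps \<Rightarrow> nat \<Rightarrow> 'p padic_closure" where
  "partial f L = (\<Sum>k\<le>(\<lambda>_. L). mfps_nth f k * tmonom k)"

text \<open>Boundedness is built in because the product rule relies on it and it must survive the
  ring operations.\<close>

definition evaluates :: "('d, 'p padic_closure) mfps \<Rightarrow> 'p padic_closure \<Rightarrow> bool" where
  "evaluates f v \<longleftrightarrow> bounded f \<and> (\<forall>m. \<exists>L0. \<forall>L\<ge>L0. partial f L - v \<in> padic_nbhd m)"

lemma tmonom_integral: "tmonom k \<in> padic_integral_closure"
  unfolding tmonom_def by (intro integral_prod integral_power t_integral)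

lemma tmonom_add: "tmonom (j + k) = tmonom j * tmonom k"
  by (simp add: tmonom_def power_add prod.distrib)

lemma tmonom_small: "\<exists>L. \<forall>k. \<not> k \<le> (\<lambda>_. L) \<longrightarrow> tmonom k \<in> padic_nbhd m"
proof -
  obtain L where L: "\<And>i k. k > L \<Longrightarrow> t i ^ k \<in> padic_nbhd m"
    using t_nilpotent[of m] by blast
  have "tmonom k \<in> padic_nbhd m" if "\<not> k \<le> (\<lambda>_. L)" for k
  proof -
    obtain i where "k i > L"
      using \<open>\<not> k \<le> (\<lambda>_. L)\<close> by (auto simp: le_fun_def not_le)
    then have "t i ^ k i * (\<Prod>i\<in>UNIV - {i}. t i ^ k i) \<in> padic_nbhd m"
      by (intro padic_nbhd_scale L integral_prod integral_power t_integral)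
    then show ?thesis
      by (simp add: tmonom_def prod.remove[of UNIV i])
  qed
  then show ?thesis
    by blast
qed

lemma bounded_small:
  assumes "bounded f"
  shows "\<exists>L. \<forall>k. \<not> k \<le> (\<lambda>_. L) \<longrightarrow> mfps_nth f k * tmonom k \<in> padic_nbhd m"
proof -
  obtain c where c: "\<And>k. of_nat CARD('p) ^ c * mfps_nth f k \<in> padic_integral_closure"
    using assms by (auto simp: bounded_def)
  obtain L where "\<forall>k. \<not> k \<le> (\<lambda>_. L) \<longrightarrow> tmonom k \<in> padic_nbhd (m + c)"
    using tmonom_small by blast
  with c show ?thesis
    using nbhd_bounded_mult by blast
qed

text \<open>Terms outside a large cube are small, so every finite set containing that cube has
  nearly the same sum; conversely every finite set of multi-indices lies in a cube.\<close>

lemma evaluates_iff_has_value: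
  assumes "bounded f"
  shows "evaluates f v \<longleftrightarrow> mfps_has_value f t v"
proof
  assume "evaluates f v"
  show "mfps_has_value f t v"
    unfolding mfps_has_value_def padic_tendsto_def eventually_finite_subsets_at_top tmonom_def[symmetric]
  proof
    fix m
    obtain L1 where L1: "\<And>L. L \<ge> L1 \<Longrightarrow> partial f L - v \<in> padic_nbhd m"
      using \<open>evaluates f v\<close> by (auto simp: evaluates_def)
    obtain L2 where L2: "\<And>k. \<not> k \<le> (\<lambda>_. L2) \<Longrightarrow> mfps_nth f k * tmonom k \<in> padic_nbhd m"
      using bounded_small[OF assms] by blast
    define B where "B = {..(\<lambda>_ :: 'd. max L1 L2)}"
    have B: "finite B"
      unfolding B_def by (rule finite_multiindex_le)
    have "(\<Sum>k\<in>Y. mfps_nth f k * tmonom k) - v \<in> padic_nbhd m" if Y: "finite Y" "B \<subseteq> Y" for Y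
    proof -
      have "\<not> k \<le> (\<lambda>_. L2)" if "k \<in> Y - B" for k
        using that by (auto simp: B_def le_fun_def le_max_iff_disj)
      then have "(partial f (max L1 L2) - v) + (\<Sum>k\<in>Y - B. mfps_nth f k * tmonom k) \<in> padic_nbhd m"
        by (intro padic_nbhd_add padic_nbhd_sum L1 L2) auto
      then show ?thesis
        by (simp add: partial_def sum.subset_diff[OF Y(2,1)] algebra_simps flip: B_def)
    qed
    with B show "\<exists>B. finite B \<and> B \<subseteq> UNIV \<and> (\<forall>Y. finite Y \<and> B \<subseteq> Y \<and> Y \<subseteq> UNIV \<longrightarrow>
        (\<Sum>k\<in>Y. mfps_nth f k * tmonom k) - v \<in> padic_nbhd m)"
      by blast
  qed
next
  assume v: "mfps_has_value f t v"
  have "\<exists>L0. \<forall>L\<ge>L0. partial f L - v \<in> padic_nbhd m" for m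
  proof -
    have "\<exists>B. finite B \<and> B \<subseteq> UNIV \<and> (\<forall>Y. finite Y \<and> B \<subseteq> Y \<and> Y \<subseteq> UNIV \<longrightarrow>
        (\<Sum>k\<in>Y. mfps_nth f k * tmonom k) - v \<in> padic_nbhd m)"
      using v unfolding mfps_has_value_def padic_tendsto_def eventually_finite_subsets_at_top tmonom_def[symmetric]
      by (rule spec)
    then obtain B where B: "finite B"
      "\<forall>Y. finite Y \<and> B \<subseteq> Y \<and> Y \<subseteq> UNIV \<longrightarrow> (\<Sum>k\<in>Y. mfps_nth f k * tmonom k) - v \<in> padic_nbhd m"
      by (elim exE conjE)
    define L0 where "L0 = (\<Sum>k\<in>B. \<Sum>i\<in>UNIV. k i)"
    have L0: "k i \<le> L0" if "k \<in> B" for k i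
    proof -
      have "k i \<le> (\<Sum>i\<in>UNIV. k i)"
        by (rule member_le_sum) auto
      also have "\<dots> \<le> L0"
        unfolding L0_def using that B(1) by (intro member_le_sum) auto
      finally show ?thesis .
    qed
    have "partial f L - v \<in> padic_nbhd m" if "L \<ge> L0" for L
      unfolding partial_def
    proof (rule B(2)[rule_format], intro conjI finite_multiindex_le subset_UNIV subsetI)
      fix k assume "k \<in> B"
      then show "k \<in> {..(\<lambda>_. L)}"
        using that by (auto simp: le_fun_def intro: order_trans[OF L0])
    qed
    then show ?thesis
      by blast
  qed
  with assms show "evaluates f v"
    by (simp add: evaluates_def)
qed

lemma evaluates_unique:
  assumes "evaluates f v" "evaluates f w"
  shows "v = w"
proof -
  have "v - w \<in> padic_nbhd m" for m
  proof -
    obtain L1 where L1: "\<And>L. L \<ge> L1 \<Longrightarrow> partial f L - v \<in> padic_nbhd m"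
      using assms(1) by (auto simp: evaluates_def)
    obtain L2 where L2: "\<And>L. L \<ge> L2 \<Longrightarrow> partial f L - w \<in> padic_nbhd m"
      using assms(2) by (auto simp: evaluates_def)
    have "(partial f (max L1 L2) - w) - (partial f (max L1 L2) - v) \<in> padic_nbhd m"
      by (intro padic_nbhd_diff L1 L2) auto
    then show ?thesis
      by simp
  qed
  then show ?thesis
    using padic_nbhd_separated[of "v - w"] by simp
qed

lemma evaluates_const: "evaluates (mfps_const c) c"
proof -
  obtain e where e: "of_nat CARD('p) ^ e * c \<in> padic_integral_closure"
    using integral_prime_power_multiple by blast
  have "partial (mfps_const c) L = c" for L
  proof -
    have "partial (mfps_const c) L = (\<Sum>k\<in>{\<lambda>_. 0}. mfps_nth (mfps_const c) k * tmonom k)"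
      unfolding partial_def
      by (rule sum.mono_neutral_right) (auto simp: mfps_const_def finite_multiindex_le le_fun_def)
    then show ?thesis
      by (simp add: mfps_const_def tmonom_def)
  qed
  with e show ?thesis
    by (auto simp: evaluates_def bounded_def mfps_const_def)
qed

lemma evaluates_add:
  assumes "evaluates f v" "evaluates g w"
  shows "evaluates (f + g) (v + w)"
proof -
  obtain c where c: "\<And>k. of_nat CARD('p) ^ c * mfps_nth f k \<in> padic_integral_closure"
    using assms by (auto simp: bounded_def evaluates_def)
  obtain d where d: "\<And>k. of_nat CARD('p) ^ d * mfps_nth g k \<in> padic_integral_closure"
    using assms by (auto simp: bounded_def evaluates_def)
  have "of_nat CARD('p) ^ (c + d) * mfps_nth (f + g) k =
      of_nat CARD('p) ^ d * (of_nat CARD('p) ^ c * mfps_nth f k) +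
      of_nat CARD('p) ^ c * (of_nat CARD('p) ^ d * mfps_nth g k)" for k
    by (simp add: plus_mfps.rep_eq power_add algebra_simps)
  also have "\<dots> k \<in> padic_integral_closure" for k
    by (intro integral_add_mult c d integral_power integral_of_nat)
  finally have "bounded (f + g)"
    unfolding bounded_def by blast
  moreover have "\<exists>L0. \<forall>L\<ge>L0. partial (f + g) L - (v + w) \<in> padic_nbhd m" for m
  proof -
    obtain L1 where L1: "\<And>L. L \<ge> L1 \<Longrightarrow> partial f L - v \<in> padic_nbhd m"
      using assms(1) by (auto simp: evaluates_def)
    obtain L2 where L2: "\<And>L. L \<ge> L2 \<Longrightarrow> partial g L - w \<in> padic_nbhd m"
      using assms(2) by (auto simp: evaluates_def)
    have eq: "partial (f + g) L - (v + w) = (partial f L - v) + (partial g L - w)" for L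
      by (simp add: partial_def plus_mfps.rep_eq distrib_right sum.distrib)
    show ?thesis
      unfolding eq by (rule exI[of _ "max L1 L2"], intro allI impI padic_nbhd_add L1 L2) auto
  qed
  ultimately show ?thesis
    by (simp add: evaluates_def)
qed

text \<open>Expanding the product of two cube sums also produces pairs with \<open>i + j\<close>
  outside the cube. If \<open>i + j\<close> lies inside, then so do \<open>i\<close> and
  \<open>j\<close>, so these excess pairs are the whole discrepancy.\<close>

lemma partial_mult:
  "partial (f * g) L = partial f L * partial g L -
     (\<Sum>(i, j)\<in>{(i, j) \<in> {..(\<lambda>_. L)} \<times> {..(\<lambda>_. L)}. \<not> i + j \<le> (\<lambda>_. L)}.
        (mfps_nth f i * tmonom i) * (mfps_nth g j * tmonom j))"
proof -
  let ?B = "{..(\<lambda>_ :: 'd. L)}"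
  let ?h = "\<lambda>(i, j). (mfps_nth f i * tmonom i) * (mfps_nth g j * tmonom j)"
  have fin: "finite ?B"
    by (rule finite_multiindex_le)
  have split: "?B \<times> ?B = {(i, j) \<in> ?B \<times> ?B. i + j \<le> (\<lambda>_. L)} \<union> {(i, j) \<in> ?B \<times> ?B. \<not> i + j \<le> (\<lambda>_. L)}"
    by auto
  have "partial f L * partial g L = sum ?h (?B \<times> ?B)"
    by (simp add: partial_def sum_product sum.cartesian_product)
  also have "\<dots> = sum ?h {(i, j) \<in> ?B \<times> ?B. i + j \<le> (\<lambda>_. L)} + sum ?h {(i, j) \<in> ?B \<times> ?B. \<not> i + j \<le> (\<lambda>_. L)}"
    by (subst split, rule sum.union_disjoint) (auto intro: finite_subset[OF _ finite_cartesian_product[OF fin fin]])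
  also have "sum ?h {(i, j) \<in> ?B \<times> ?B. i + j \<le> (\<lambda>_. L)} =
      (\<Sum>(k, i)\<in>(SIGMA k:?B. {..k}). mfps_nth f i * mfps_nth g (k - i) * tmonom k)"
  proof (rule sum.reindex_bij_witness[where i = "\<lambda>(k, i). (i, k - i)" and j = "\<lambda>(i, j). (i + j, i)"])
    fix x assume "x \<in> (SIGMA k:?B. {..k})"
    then obtain k i where x: "x = (k, i)" "k \<le> (\<lambda>_. L)" "i \<le> k"
      by auto
    then have ik: "i + (k - i) = k"
      by (auto simp: le_fun_def fun_eq_iff)
    with x show "(case case x of (k, i) \<Rightarrow> (i, k - i) of (i, j) \<Rightarrow> (i + j, i)) = x"
      by simp
    have "i \<le> (\<lambda>_. L)" "k - i \<le> (\<lambda>_. L)"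
      using x(2,3) by (auto simp: le_fun_def) (meson diff_le_self order_trans)+
    with x ik show "(case x of (k, i) \<Rightarrow> (i, k - i)) \<in> {(i, j) \<in> ?B \<times> ?B. i + j \<le> (\<lambda>_. L)}"
      by simp
  next
    fix x assume "x \<in> {(i, j) \<in> ?B \<times> ?B. i + j \<le> (\<lambda>_. L)}"
    then obtain i j where x: "x = (i, j)" "i + j \<le> (\<lambda>_. L)"
      by auto
    have ij: "i + j - i = j"
      by (auto simp: fun_eq_iff)
    with x show "(case case x of (i, j) \<Rightarrow> (i + j, i) of (k, i) \<Rightarrow> (i, k - i)) = x"
      by simp
    show "(case x of (i, j) \<Rightarrow> (i + j, i)) \<in> (SIGMA k:?B. {..k})"
      using x by (auto simp: le_fun_def)
    show "(case case x of (i, j) \<Rightarrow> (i + j, i) of (k, i) \<Rightarrow> mfps_nth f i * mfps_nth g (k - i) * tmonom k) = ?h x"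
      using x ij by (simp add: tmonom_add mult_ac)
  qed
  also have "\<dots> = partial (f * g) L"
    by (simp add: partial_def times_mfps.rep_eq sum_distrib_right sum.Sigma fin finite_multiindex_le)
  finally show ?thesis
    by (simp only: eq_diff_eq)
qed

text \<open>The error is \<open>partial g L * (partial f L - v) + v * (partial g L - w)\<close>
  minus the excess pairs of \<open>partial_mult\<close>. In such a pair some coordinate has
  \<open>i x + j x > L \<ge> L3 + L4\<close>, so \<open>i\<close> leaves the cube of side
  \<open>L3\<close> or \<open>j\<close> that of side \<open>L4\<close>, where terms are
  small.\<close>

lemma evaluates_mult:
  assumes "evaluates f v" "evaluates g w"
  shows "evaluates (f * g) (v * w)"
proof -
  have bf: "bounded f" and bg: "bounded g"
    using assms by (auto simp: evaluates_def)
  obtain c where c: "\<And>k. of_nat CARD('p) ^ c * mfps_nth f k \<in> padic_integral_closure"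
    using bf by (auto simp: bounded_def)
  obtain d where d: "\<And>k. of_nat CARD('p) ^ d * mfps_nth g k \<in> padic_integral_closure"
    using bg by (auto simp: bounded_def)
  have c': "of_nat CARD('p) ^ c * (mfps_nth f k * tmonom k) \<in> padic_integral_closure" for k
    using integral_add_mult(2)[OF c tmonom_integral] by (simp add: mult.assoc)
  have d': "of_nat CARD('p) ^ d * (mfps_nth g k * tmonom k) \<in> padic_integral_closure" for k
    using integral_add_mult(2)[OF d tmonom_integral] by (simp add: mult.assoc)
  have "of_nat CARD('p) ^ (c + d) * mfps_nth (f * g) k =
      (\<Sum>i\<le>k. (of_nat CARD('p) ^ c * mfps_nth f i) * (of_nat CARD('p) ^ d * mfps_nth g (k - i)))" for k
    by (simp add: times_mfps.rep_eq power_add sum_distrib_left mult_ac)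
  also have "\<dots> k \<in> padic_integral_closure" for k
    by (intro integral_sum integral_add_mult c d)
  finally have "bounded (f * g)"
    unfolding bounded_def by blast
  moreover have "\<exists>L0. \<forall>L\<ge>L0. partial (f * g) L - v * w \<in> padic_nbhd m" for m
  proof -
    obtain e where e: "of_nat CARD('p) ^ e * v \<in> padic_integral_closure"
      using integral_prime_power_multiple by blast
    \<comment> \<open>The extra precision \<open>d\<close>, \<open>e\<close> or \<open>c\<close> in
      these four choices pays for the denominator of the factor that will be multiplied on.\<close>
    obtain L1 where L1: "\<And>L. L \<ge> L1 \<Longrightarrow> partial f L - v \<in> padic_nbhd (m + d)"
      using assms(1) by (auto simp: evaluates_def)
    obtain L2 where L2: "\<And>L. L \<ge> L2 \<Longrightarrow> partial g L - w \<in> padic_nbhd (m + e)"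
      using assms(2) by (auto simp: evaluates_def)
    obtain L3 where L3: "\<And>k. \<not> k \<le> (\<lambda>_. L3) \<Longrightarrow> mfps_nth f k * tmonom k \<in> padic_nbhd (m + d)"
      using bounded_small[OF bf] by blast
    obtain L4 where L4: "\<And>k. \<not> k \<le> (\<lambda>_. L4) \<Longrightarrow> mfps_nth g k * tmonom k \<in> padic_nbhd (m + c)"
      using bounded_small[OF bg] by blast
    have pg: "of_nat CARD('p) ^ d * partial g L \<in> padic_integral_closure" for L
      unfolding partial_def sum_distrib_left using d' by (intro integral_sum)
    have "partial (f * g) L - v * w \<in> padic_nbhd m" if L: "L \<ge> L1 + L2 + (L3 + L4)" for L
    proof -
      define S where "S = {(i, j) \<in> {..(\<lambda>_ :: 'd. L)} \<times> {..(\<lambda>_. L)}. \<not> i + j \<le> (\<lambda>_. L)}"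
      have "(mfps_nth f i * tmonom i) * (mfps_nth g j * tmonom j) \<in> padic_nbhd m" if "(i, j) \<in> S" for i j
      proof (cases "i \<le> (\<lambda>_. L3)")
        case False
        then show ?thesis
          using nbhd_bounded_mult[OF L3 d'] by (simp add: mult.commute)
      next
        case True
        obtain x where "i x + j x > L"
          using \<open>(i, j) \<in> S\<close> by (auto simp: S_def le_fun_def not_le)
        moreover have "i x \<le> L3"
          using True by (simp add: le_fun_def)
        ultimately have "\<not> j x \<le> L4"
          using L by simp
        then have "\<not> j \<le> (\<lambda>_. L4)"
          by (auto simp: le_fun_def)
        then show ?thesis
          using nbhd_bounded_mult[OF L4 c'] by simp
      qed
      then have "(\<Sum>(i, j)\<in>S. (mfps_nth f i * tmonom i) * (mfps_nth g j * tmonom j)) \<in> padic_nbhd m"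
        by (intro padic_nbhd_sum) auto
      moreover have "partial g L * (partial f L - v) \<in> padic_nbhd m"
        using L by (intro nbhd_bounded_mult[OF L1 pg]) simp
      moreover have "v * (partial g L - w) \<in> padic_nbhd m"
        using L by (intro nbhd_bounded_mult[OF L2 e]) simp
      ultimately have "partial g L * (partial f L - v) + v * (partial g L - w) -
          (\<Sum>(i, j)\<in>S. (mfps_nth f i * tmonom i) * (mfps_nth g j * tmonom j)) \<in> padic_nbhd m"
        by (intro padic_nbhd_diff padic_nbhd_add)
      then show ?thesis
        unfolding partial_mult S_def[symmetric] by (simp add: algebra_simps)
    qed
    then show ?thesis
      by blast
  qed
  ultimately show ?thesis
    by (simp add: evaluates_def)
qed

lemma mfps_const_0_1: "mfps_const 0 = 0" "mfps_const 1 = 1"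
  by (rule mfps_eqI, simp add: mfps_const_def zero_mfps.rep_eq one_mfps.rep_eq)+

lemma ring_rel_evaluates: "ring_rel evaluates"
proof
  show "evaluates 0 0" "evaluates 1 1"
    using evaluates_const[of 0] evaluates_const[of 1] by (simp_all add: mfps_const_0_1)
  fix f v assume "evaluates f v"
  then have "evaluates (mfps_const (- 1) * f) (- 1 * v)"
    by (intro evaluates_mult evaluates_const)
  moreover have "mfps_const (- 1) + 1 = (0 :: ('d, 'p padic_closure) mfps)"
    by (rule mfps_eqI) (simp add: mfps_const_def zero_mfps.rep_eq one_mfps.rep_eq plus_mfps.rep_eq)
  then have "mfps_const (- 1) = - (1 :: ('d, 'p padic_closure) mfps)"
    by (simp add: eq_neg_iff_add_eq_0)
  ultimately show "evaluates (- f) (- v)"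
    by simp
qed (auto intro: evaluates_add evaluates_mult)

end

lemma nilpotent_point_root_of_unity:
  fixes \<zeta> :: "'d :: finite \<Rightarrow> 'p :: prime_card padic_closure"
  assumes "\<And>i. \<zeta> i ^ (CARD('p) ^ n) = 1"
  shows "nilpotent_point (\<lambda>i. \<zeta> i - 1)"
proof
  fix i
  have "\<zeta> i \<in> padic_integral_closure"
    using assms[of i] by (intro integral_root_of_unity[of _ "CARD('p) ^ n"]) simp_all
  then show int: "\<zeta> i - 1 \<in> padic_integral_closure"
    by (simp add: integral_diff)
next
  fix m
  let ?N = "CARD('p) ^ n"
  \<comment> \<open>Each block of \<open>?N\<close> factors contributes one power of p.\<close>
  have "(\<zeta> i - 1) ^ k \<in> padic_nbhd m" if "k > ?N * m" for i k
  proof -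
    have "\<zeta> i \<in> padic_integral_closure"
      using assms[of i] by (intro integral_root_of_unity[of _ ?N]) simp_all
    then have "(\<zeta> i - 1) ^ (k - ?N * m) \<in> padic_integral_closure"
      by (simp add: integral_diff integral_power)
    moreover have "((\<zeta> i - 1) ^ ?N) ^ m \<in> padic_nbhd (1 * m)"
      by (intro nbhd_power root_of_unity_minus_1_nilpotent assms)
    ultimately have "((\<zeta> i - 1) ^ ?N) ^ m * (\<zeta> i - 1) ^ (k - ?N * m) \<in> padic_nbhd m"
      by (intro padic_nbhd_scale) simp_all
    then show ?thesis
      using that by (simp flip: power_mult power_add)
  qed
  then show "\<exists>L. \<forall>k>L. \<forall>i. (\<zeta> i - 1) ^ k \<in> padic_nbhd m"
    by blast
qed

text \<open>A cube sum of \<open>tau \<gamma>\<close> is a product over the coordinates of truncated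
  binomial series, each close to the corresponding power of \<open>\<zeta> i\<close>.\<close>

lemma evaluates_tau:
  fixes \<zeta> :: "'d :: finite \<Rightarrow> 'p :: prime_card padic_closure"
  assumes z: "\<And>i. \<zeta> i ^ (CARD('p) ^ n) = 1"
  shows "nilpotent_point.evaluates (\<lambda>i. \<zeta> i - 1) (tau \<gamma>) (\<Prod>i\<in>UNIV. \<zeta> i ^ nat (residue (\<gamma> i) n))"
proof -
  interpret nilpotent_point "\<lambda>i. \<zeta> i - 1"
    by (rule nilpotent_point_root_of_unity[OF z])
  have "bounded (tau \<gamma>)"
    unfolding bounded_def tau_def by (rule exI[of _ 0]) (auto intro: integral_prod gchoose_integral)
  moreover have "\<exists>L0. \<forall>L\<ge>L0. partial (tau \<gamma>) L - (\<Prod>i\<in>UNIV. \<zeta> i ^ nat (residue (\<gamma> i) n)) \<in> padic_nbhd m" for m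
  proof -
    obtain L0 where L0: "\<And>k i. k > L0 \<Longrightarrow> (\<zeta> i - 1) ^ k \<in> padic_nbhd m"
      using t_nilpotent[of m] by blast
    have "partial (tau \<gamma>) L - (\<Prod>i\<in>UNIV. \<zeta> i ^ nat (residue (\<gamma> i) n)) \<in> padic_nbhd m" if "L \<ge> L0" for L
    proof -
      have box: "{..(\<lambda>_ :: 'd. L)} = PiE UNIV (\<lambda>_. {..L})"
        by (auto simp: le_fun_def PiE_def Pi_def)
      have "partial (tau \<gamma>) L = (\<Sum>k\<in>PiE UNIV (\<lambda>_. {..L}). \<Prod>i\<in>UNIV. (of_padic_int (\<gamma> i) gchoose k i) * (\<zeta> i - 1) ^ k i)"
        by (simp add: partial_def tau_def tmonom_def prod.distrib box)
      also have "\<dots> = (\<Prod>i\<in>UNIV. \<Sum>k\<le>L. (of_padic_int (\<gamma> i) gchoose k) * (\<zeta> i - 1) ^ k)"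
        by (rule prod_sum_PiE[symmetric]) simp_all
      finally have eq: "partial (tau \<gamma>) L = (\<Prod>i\<in>UNIV. \<Sum>k\<le>L. (of_padic_int (\<gamma> i) gchoose k) * (\<zeta> i - 1) ^ k)" .
      show ?thesis
        unfolding eq
      proof (rule nbhd_prod_diff)
        fix i
        show "(\<Sum>k\<le>L. (of_padic_int (\<gamma> i) gchoose k) * (\<zeta> i - 1) ^ k) - \<zeta> i ^ nat (residue (\<gamma> i) n) \<in> padic_nbhd m"
          using L0 that by (intro binomial_series_root_of_unity z) auto
        show "\<zeta> i ^ nat (residue (\<gamma> i) n) \<in> padic_integral_closure"
          using z[of i] by (intro integral_power integral_root_of_unity[of _ "CARD('p) ^ n"]) simp_all
      qed
    qed
    then show ?thesis
      by blast
  qed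
  ultimately show ?thesis
    by (simp add: evaluates_def)
qed


section \<open>Grover matrices\<close>

text \<open>
  Compared with \<open>bidirected_digraph\<close>, nothing is asked of \<open>rev\<close> outside the arcs: \<open>cover_rev\<close> does not
  fix the non-arcs of the cover.
\<close>

locale reversible_digraph = fin_digraph H for H :: "('v, 'e) pre_digraph" +
  fixes rev :: "'e \<Rightarrow> 'e"
  assumes rev_arc: "e \<in> arcs H \<Longrightarrow> rev e \<in> arcs H"
    and rev_rev: "e \<in> arcs H \<Longrightarrow> rev (rev e) = e"
    and tail_rev: "e \<in> arcs H \<Longrightarrow> tail H (rev e) = head H e"
    and out_degree_pos: "v \<in> verts H \<Longrightarrow> out_degree H v \<ge> 1"
begin

lemma head_rev: "e \<in> arcs H \<Longrightarrow> head H (rev e) = tail H e"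
  using tail_rev[OF rev_arc] rev_rev by metis

lemma bij_rev: "bij_betw rev (in_arcs H v) (out_arcs H v)"
  by (rule bij_betw_byWitness[where f' = rev]) (auto simp: rev_rev rev_arc tail_rev head_rev)

lemma card_in_arcs: "card (in_arcs H v) = out_degree H v"
  unfolding out_degree_def by (rule bij_betw_same_card[OF bij_rev])

lemma sum_in_arcs: "(\<Sum>f\<in>in_arcs H v. S (tail H f)) = (\<Sum>e\<in>out_arcs H v. S (head H e))"
proof -
  have "(\<Sum>f\<in>in_arcs H v. S (tail H f)) = (\<Sum>f\<in>in_arcs H v. S (head H (rev f)))"
    by (intro sum.cong) (auto simp: head_rev)
  also have "\<dots> = (\<Sum>e\<in>out_arcs H v. S (head H e))"
    by (rule sum.reindex_bij_betw[OF bij_rev])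
  finally show ?thesis .
qed

lemma grover_matrix_carrier: "grover_matrix H rev \<in> carrier_mat (card (arcs H)) (card (arcs H))"
  unfolding grover_matrix_def by (rule matrix_on_carrier[OF finite_arcs])

text \<open>The Kronecker delta of the Grover matrix appears on the left as
  \<open>\<phi> (rev e)\<close>; what remains on the right depends on \<open>e\<close> only through
  its tail, which is why vertex functions suffice later.\<close>

lemma grover_kernel_iff:
  "det (u \<cdot>\<^sub>m 1\<^sub>m (card (arcs H)) - grover_matrix H rev) = 0 \<longleftrightarrow>
    (\<exists>\<phi> :: 'e \<Rightarrow> 'a :: field. (\<exists>e\<in>arcs H. \<phi> e \<noteq> 0) \<and>
      (\<forall>e\<in>arcs H. u * \<phi> e + \<phi> (rev e) = 2 / of_nat (out_degree H (tail H e)) * (\<Sum>f\<in>in_arcs H (tail H e). \<phi> f)))"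
proof -
  let ?M = "\<lambda>e f. if head H f = tail H e
     then 2 / of_nat (out_degree H (head H f)) - (if f = rev e then 1 else 0) else (0 :: 'a)"
  \<comment> \<open>The scalar \<open>1\<close> merely fits the shape of
    \<open>matrix_on_diff_diag\<close>.\<close>
  have "grover_matrix H rev = 1 \<cdot>\<^sub>m matrix_on (arcs H) ?M"
    unfolding grover_matrix_def by (rule eq_matI) simp_all
  then have eq: "u \<cdot>\<^sub>m 1\<^sub>m (card (arcs H)) - grover_matrix H rev =
      matrix_on (arcs H) (\<lambda>e f. (if e = f then u else 0) - 1 * ?M e f)"
    by (simp only: matrix_on_diff_diag[OF finite_arcs])
  have "(\<Sum>f\<in>arcs H. ((if e = f then u else 0) - 1 * ?M e f) * \<phi> f) =
      u * \<phi> e + \<phi> (rev e) - 2 / of_nat (out_degree H (tail H e)) * (\<Sum>f\<in>in_arcs H (tail H e). \<phi> f)"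
    if e: "e \<in> arcs H" for e \<phi>
  proof -
    have "(\<Sum>f\<in>arcs H. ((if e = f then u else 0) - 1 * ?M e f) * \<phi> f) =
      (\<Sum>f\<in>arcs H. (if f = e then u * \<phi> f else 0) + (if f = rev e then \<phi> f else 0) -
        (if head H f = tail H e then 2 / of_nat (out_degree H (tail H e)) * \<phi> f else 0))"
      using e by (intro sum.cong refl) (auto simp: head_rev algebra_simps)
    also have "\<dots> = u * \<phi> e + \<phi> (rev e) -
        (\<Sum>f\<in>arcs H. if head H f = tail H e then 2 / of_nat (out_degree H (tail H e)) * \<phi> f else 0)"
      using e by (simp add: sum.distrib sum_subtractf rev_arc)
    also have "(\<Sum>f\<in>arcs H. if head H f = tail H e then 2 / of_nat (out_degree H (tail H e)) * \<phi> f else 0) =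
        (\<Sum>f\<in>in_arcs H (tail H e). 2 / of_nat (out_degree H (tail H e)) * \<phi> f)"
      by (rule sum.mono_neutral_cong_right) auto
    finally show ?thesis
      by (simp only: sum_distrib_left)
  qed
  then show ?thesis
    unfolding eq det_matrix_on_eq_0_iff[OF finite_arcs] by simp
qed

text \<open>
  An eigenfunction \<open>\<phi>\<close> on the arcs for an eigenvalue \<open>u\<close> with \<open>u\<^sup>2 \<noteq> 1\<close> corresponds to the function
  \<open>S v = 2 / d\<^sub>v * (\<Sum>f. \<phi> f)\<close> on the vertices, the sum being over the arcs \<open>f\<close> into \<open>v\<close>;
  conversely \<open>(u\<^sup>2 - 1) * \<phi> e = u * S (tail e) - S (head e)\<close>.
\<close>

lemma grover_eigenvalue_iff:
  fixes u :: "'a :: field_char_0"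
  assumes u: "u\<^sup>2 \<noteq> 1"
  shows "det (u \<cdot>\<^sub>m 1\<^sub>m (card (arcs H)) - grover_matrix H rev) = 0 \<longleftrightarrow>
    (\<exists>S. (\<exists>v\<in>verts H. S v \<noteq> 0) \<and>
      (\<forall>v\<in>verts H. (u\<^sup>2 + 1) * S v = u * (\<Sum>e\<in>out_arcs H v. 2 / of_nat (out_degree H v) * S (head H e))))"
  unfolding grover_kernel_iff
proof (intro iffI; elim exE conjE)
  fix \<phi> :: "'e \<Rightarrow> 'a"
  assume nz: "\<exists>e\<in>arcs H. \<phi> e \<noteq> 0" and
    \<phi>: "\<forall>e\<in>arcs H. u * \<phi> e + \<phi> (rev e) = 2 / of_nat (out_degree H (tail H e)) * (\<Sum>f\<in>in_arcs H (tail H e). \<phi> f)"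
  define S where "S v = 2 / of_nat (out_degree H v) * (\<Sum>f\<in>in_arcs H v. \<phi> f)" for v
  have eq: "(u\<^sup>2 - 1) * \<phi> e = u * S (tail H e) - S (head H e)" if e: "e \<in> arcs H" for e
  proof -
    have "u * \<phi> e + \<phi> (rev e) = S (tail H e)" "u * \<phi> (rev e) + \<phi> e = S (head H e)"
      using \<phi>[rule_format, OF e] \<phi>[rule_format, OF rev_arc[OF e]] e by (simp_all add: S_def rev_rev tail_rev)
    \<comment> \<open>Eliminates \<open>\<phi> (rev e)\<close> from the equations at
      \<open>e\<close> and at its reversal.\<close>
    moreover have "(u\<^sup>2 - 1) * \<phi> e = u * (u * \<phi> e + \<phi> (rev e)) - (u * \<phi> (rev e) + \<phi> e)"
      by (simp add: power2_eq_square algebra_simps)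
    ultimately show ?thesis
      by simp
  qed
  have "\<exists>v\<in>verts H. S v \<noteq> 0"
  proof (rule ccontr)
    assume "\<not> (\<exists>v\<in>verts H. S v \<noteq> 0)"
    then have "(u\<^sup>2 - 1) * \<phi> e = 0" if "e \<in> arcs H" for e
      using eq[OF that] that by simp
    then show False
      using nz u by auto
  qed
  moreover have "(u\<^sup>2 + 1) * S v = u * (\<Sum>e\<in>out_arcs H v. 2 / of_nat (out_degree H v) * S (head H e))"
    if v: "v \<in> verts H" for v
  proof -
    have d: "of_nat (out_degree H v) \<noteq> (0 :: 'a)"
      using out_degree_pos[OF v] by simp
    \<comment> \<open>Summing the arc formula over the arcs into \<open>v\<close> leaves
      \<open>- 2 * S v\<close> on the right; moving it to the left turns
      \<open>u\<^sup>2 - 1\<close> into \<open>u\<^sup>2 + 1\<close>.\<close>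
    have "(u\<^sup>2 - 1) * S v = 2 / of_nat (out_degree H v) * (\<Sum>f\<in>in_arcs H v. (u\<^sup>2 - 1) * \<phi> f)"
      unfolding S_def sum_distrib_left[symmetric] by (rule mult.left_commute)
    also have "(\<Sum>f\<in>in_arcs H v. (u\<^sup>2 - 1) * \<phi> f) = (\<Sum>f\<in>in_arcs H v. u * S (tail H f) - S v)"
      by (intro sum.cong) (auto simp: eq)
    also have "\<dots> = u * (\<Sum>e\<in>out_arcs H v. S (head H e)) - of_nat (out_degree H v) * S v"
      by (simp add: sum_subtractf card_in_arcs sum_in_arcs flip: sum_distrib_left)
    also have "2 / of_nat (out_degree H v) * \<dots> =
        u * (\<Sum>e\<in>out_arcs H v. 2 / of_nat (out_degree H v) * S (head H e)) - 2 * S v"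
      using d by (simp add: right_diff_distrib sum_distrib_left mult_ac)
    finally show ?thesis
      by (simp add: algebra_simps)
  qed
  ultimately show "\<exists>S. (\<exists>v\<in>verts H. S v \<noteq> 0) \<and>
      (\<forall>v\<in>verts H. (u\<^sup>2 + 1) * S v = u * (\<Sum>e\<in>out_arcs H v. 2 / of_nat (out_degree H v) * S (head H e)))"
    by blast
next
  fix S :: "'v \<Rightarrow> 'a"
  assume nz: "\<exists>v\<in>verts H. S v \<noteq> 0" and
    S: "\<forall>v\<in>verts H. (u\<^sup>2 + 1) * S v = u * (\<Sum>e\<in>out_arcs H v. 2 / of_nat (out_degree H v) * S (head H e))"
  define \<phi> where "\<phi> e = (u * S (tail H e) - S (head H e)) / (u\<^sup>2 - 1)" for e
  have u1: "u\<^sup>2 - 1 \<noteq> 0"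
    using u by simp
  have sum: "2 / of_nat (out_degree H v) * (\<Sum>f\<in>in_arcs H v. \<phi> f) = S v" if v: "v \<in> verts H" for v
  proof -
    have d: "of_nat (out_degree H v) \<noteq> (0 :: 'a)"
      using out_degree_pos[OF v] by simp
    have "(u\<^sup>2 - 1) * (\<Sum>f\<in>in_arcs H v. \<phi> f) = (\<Sum>f\<in>in_arcs H v. u * S (tail H f) - S v)"
      unfolding sum_distrib_left using u1 by (intro sum.cong) (auto simp: \<phi>_def)
    also have "\<dots> = u * (\<Sum>e\<in>out_arcs H v. S (head H e)) - of_nat (out_degree H v) * S v"
      by (simp add: sum_subtractf card_in_arcs sum_in_arcs flip: sum_distrib_left)
    finally have eq: "(u\<^sup>2 - 1) * (\<Sum>f\<in>in_arcs H v. \<phi> f) =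
        u * (\<Sum>e\<in>out_arcs H v. S (head H e)) - of_nat (out_degree H v) * S v" .
    have "(u\<^sup>2 - 1) * (2 / of_nat (out_degree H v) * (\<Sum>f\<in>in_arcs H v. \<phi> f)) =
        2 / of_nat (out_degree H v) * (u * (\<Sum>e\<in>out_arcs H v. S (head H e)) - of_nat (out_degree H v) * S v)"
      unfolding eq[symmetric] by (rule mult.left_commute)
    also have "\<dots> = u * (\<Sum>e\<in>out_arcs H v. 2 / of_nat (out_degree H v) * S (head H e)) - 2 * S v"
      using d by (simp add: right_diff_distrib sum_distrib_left mult_ac)
    also have "\<dots> = (u\<^sup>2 - 1) * S v"
      using S[rule_format, OF v] by (simp add: algebra_simps)
    finally show ?thesis
      using mult_left_cancel[OF u1] by blast
  qed
  have "u * \<phi> e + \<phi> (rev e) = S (tail H e)" if e: "e \<in> arcs H" for e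
  proof -
    have "u * \<phi> e + \<phi> (rev e) =
        (u * (u * S (tail H e) - S (head H e)) + (u * S (head H e) - S (tail H e))) / (u\<^sup>2 - 1)"
      using e by (simp add: \<phi>_def tail_rev head_rev add_divide_distrib)
    also have "u * (u * S (tail H e) - S (head H e)) + (u * S (head H e) - S (tail H e)) = (u\<^sup>2 - 1) * S (tail H e)"
      by (simp add: algebra_simps power2_eq_square)
    finally show ?thesis
      using u1 by simp
  qed
  then have "\<forall>e\<in>arcs H. u * \<phi> e + \<phi> (rev e) = 2 / of_nat (out_degree H (tail H e)) * (\<Sum>f\<in>in_arcs H (tail H e). \<phi> f)"
    by (intro ballI) (simp only: sum[OF tail_in_verts])
  moreover have "\<exists>e\<in>arcs H. \<phi> e \<noteq> 0"
  proof (rule ccontr)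
    assume "\<not> (\<exists>e\<in>arcs H. \<phi> e \<noteq> 0)"
    then have "(\<Sum>f\<in>in_arcs H v. \<phi> f) = 0" for v
      by (intro sum.neutral) auto
    then show False
      using nz sum by fastforce
  qed
  ultimately show "\<exists>\<phi>. (\<exists>e\<in>arcs H. \<phi> e \<noteq> 0) \<and>
      (\<forall>e\<in>arcs H. u * \<phi> e + \<phi> (rev e) = 2 / of_nat (out_degree H (tail H e)) * (\<Sum>f\<in>in_arcs H (tail H e). \<phi> f))"
    by blast
qed

end


section \<open>Characters of the voltage group\<close>

lemma reduction_eq_iff:
  fixes \<gamma> \<delta> :: "'d \<Rightarrow> 'p :: prime_card padic_int"
  shows "reduction n \<gamma> = reduction n \<delta> \<longleftrightarrow> (\<forall>i. residue (\<gamma> i) n = residue (\<delta> i) n)"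
proof -
  have sub: "x \<in> power_subgroup n \<longleftrightarrow> (\<forall>i. of_nat CARD('p) ^ n dvd x i)" for x :: "'d \<Rightarrow> 'p padic_int"
  proof
    assume "\<forall>i. of_nat CARD('p) ^ n dvd x i"
    then obtain y where "\<And>i. x i = of_nat CARD('p) ^ n * y i"
      unfolding dvd_def by metis
    then have "x = (\<lambda>i. of_nat CARD('p) ^ n * y i)"
      by auto
    then show "x \<in> power_subgroup n"
      by (auto simp: power_subgroup_def)
  qed (auto simp: power_subgroup_def)
  have dvd: "of_nat CARD('p) ^ n dvd x - y \<longleftrightarrow> residue x n = residue y n" for x y :: "'p padic_int"
    unfolding power_dvd_padic_iff minus_padic_int.rep_eq
    using mod_eq_dvd_iff[of "residue x n" "int CARD('p) ^ n" "residue y n"] by (auto simp: mod_eq_0_iff_dvd)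
  show ?thesis
  proof
    assume "reduction n \<gamma> = reduction n \<delta>"
    moreover have "\<gamma> + 0 \<in> reduction n \<gamma>"
      unfolding reduction_def by (rule set_plus_intro2) (simp add: sub)
    ultimately obtain x where "x \<in> power_subgroup n" "\<gamma> = \<delta> + x"
      by (auto simp: reduction_def elt_set_plus_def)
    then have "of_nat CARD('p) ^ n dvd \<gamma> i - \<delta> i" for i
      by (auto simp: sub)
    then show "\<forall>i. residue (\<gamma> i) n = residue (\<delta> i) n"
      by (simp add: dvd)
  next
    assume "\<forall>i. residue (\<gamma> i) n = residue (\<delta> i) n"
    then have d: "of_nat CARD('p) ^ n dvd \<gamma> i - \<delta> i" for i
      by (simp add: dvd)
    have "x \<in> reduction n \<gamma> \<longleftrightarrow> x \<in> reduction n \<delta>" for x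
    proof -
      have "x \<in> reduction n \<epsilon> \<longleftrightarrow> (\<forall>i. of_nat CARD('p) ^ n dvd x i - \<epsilon> i)" for \<epsilon>
        using sub[of "x - \<epsilon>"] by (auto simp: reduction_def set_minus_plus[symmetric])
      moreover have "of_nat CARD('p) ^ n dvd x i - \<gamma> i \<longleftrightarrow> of_nat CARD('p) ^ n dvd x i - \<delta> i" for i
        using dvd_add[OF _ d, of "x i - \<gamma> i" i] dvd_diff[OF _ d, of "x i - \<delta> i" i] by auto
      ultimately show ?thesis
        by simp
    qed
    then show "reduction n \<gamma> = reduction n \<delta>"
      by blast
  qed
qed

lemma reduction_add:
  fixes \<gamma> \<delta> :: "'d \<Rightarrow> 'p :: prime_card padic_int"
  shows "reduction n \<gamma> + reduction n \<delta> = reduction n (\<gamma> + \<delta>)"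
proof -
  have "power_subgroup n + power_subgroup n = (power_subgroup n :: ('d \<Rightarrow> 'p padic_int) set)"
  proof (intro equalityI subsetI)
    fix x :: "'d \<Rightarrow> 'p padic_int" assume "x \<in> power_subgroup n + power_subgroup n"
    then obtain y z where "x = (\<lambda>i. of_nat CARD('p) ^ n * y i) + (\<lambda>i. of_nat CARD('p) ^ n * z i)"
      by (auto simp: set_plus_def power_subgroup_def)
    then have "x = (\<lambda>i. of_nat CARD('p) ^ n * (y i + z i))"
      by (auto simp: distrib_left)
    then show "x \<in> power_subgroup n"
      unfolding power_subgroup_def by (intro image_eqI[of _ _ "\<lambda>i. y i + z i"]) simp_all
  next
    fix x :: "'d \<Rightarrow> 'p padic_int" assume "x \<in> power_subgroup n"
    moreover have "0 \<in> (power_subgroup n :: ('d \<Rightarrow> 'p padic_int) set)"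
      unfolding power_subgroup_def by (rule range_eqI[of _ _ "\<lambda>_. 0"]) auto
    ultimately have "x + 0 \<in> power_subgroup n + power_subgroup n"
      by (rule set_plus_intro)
    then show "x \<in> power_subgroup n + power_subgroup n"
      by simp
  qed
  then show ?thesis
    unfolding reduction_def by (simp add: set_plus_rearrange)
qed

lemma finite_range_reduction:
  "finite (range (reduction n :: ('d :: finite \<Rightarrow> 'p :: prime_card padic_int) \<Rightarrow> _))"
proof -
  let ?f = "\<lambda>\<gamma> :: 'd \<Rightarrow> 'p padic_int. \<lambda>i. residue (\<gamma> i) n"
  have "range ?f \<subseteq> PiE UNIV (\<lambda>_. {0..<int CARD('p) ^ n})"
    by (auto simp: residue_nonneg residue_less)
  then have "finite (range ?f)"
    by (rule finite_subset) (auto intro: finite_PiE)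
  then have "finite ((\<lambda>r. reduction n (SOME \<gamma>. ?f \<gamma> = r)) ` range ?f)"
    by simp
  moreover have "reduction n \<gamma> = reduction n (SOME \<gamma>'. ?f \<gamma>' = ?f \<gamma>)" for \<gamma>
    using someI[of "\<lambda>\<gamma>'. ?f \<gamma>' = ?f \<gamma>" \<gamma>] by (simp add: reduction_eq_iff fun_eq_iff)
  then have "range (reduction n) \<subseteq> (\<lambda>r. reduction n (SOME \<gamma>. ?f \<gamma> = r)) ` range ?f"
    by blast
  ultimately show ?thesis
    by (rule finite_subset[rotated])
qed

text \<open>\<open>X ^ N - 1\<close> splits into linear factors, and a double root \<open>b\<close>
  would be a zero of the derivative \<open>N * X ^ (N - 1)\<close>, which forces
  \<open>b = 0\<close>.\<close>

lemma card_roots_of_unity: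
  assumes "N > 0"
  shows "card {z :: 'a :: {alg_closed_field, field_char_0}. z ^ N = 1} = N"
proof -
  define f :: "'a poly" where "f = monom 1 N - 1"
  have pf: "poly f z = z ^ N - 1" for z
    by (simp add: f_def poly_monom)
  have "coeff f N = 1"
    using assms by (simp add: f_def coeff_1)
  moreover have "degree f \<le> N"
    unfolding f_def by (rule degree_diff_le) (simp_all add: degree_monom_le)
  ultimately have deg: "degree f = N" and f0: "f \<noteq> 0"
    using le_degree[of f N] by auto
  have "lead_coeff f = 1"
    using \<open>coeff f N = 1\<close> by (simp add: deg)
  then obtain B where B: "f = (\<Prod>b\<in>#B. [:- b, 1:])"
    by (rule alg_closed_monic_factorization)
  have size: "size B = N"
    using linear_factors_degree(1)[of 1 B] deg unfolding B by simp
  have "poly f b = 0 \<longleftrightarrow> b \<in># B" for b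
    unfolding B poly_prod_linear by (auto simp: prod_mset_zero_iff)
  then have set: "set_mset B = {z. z ^ N = 1}"
    by (auto simp: pf)
  have "count B b = 1" if b: "b \<in># B" for b
  proof (rule ccontr)
    assume "count B b \<noteq> 1"
    obtain A where A: "B = add_mset b A"
      using multi_member_split[OF b] by blast
    then have "b \<in># A"
      using \<open>count B b \<noteq> 1\<close> by (simp add: not_in_iff)
    then obtain B' where B': "B = add_mset b (add_mset b B')"
      using multi_member_split[of b A] A by blast
    have f: "f = [:- b, 1:] * ([:- b, 1:] * (\<Prod>b\<in>#B'. [:- b, 1:]))"
      unfolding B B' by (simp only: image_mset_add_mset prod_mset.add_mset)
    have "poly (pderiv f) b = 0"
      unfolding f pderiv_mult by simp
    moreover have "poly (pderiv f) b = of_nat N * b ^ (N - 1)"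
      by (simp add: f_def pderiv_diff pderiv_monom poly_monom)
    ultimately have "b = 0"
      using assms by simp
    moreover have "b ^ N = 1"
      using b set by auto
    ultimately show False
      using assms by (simp add: zero_power)
  qed
  then have "size B = card (set_mset B)"
    by (simp add: size_multiset_overloaded_eq)
  then show ?thesis
    by (simp add: size set)
qed

text \<open>For \<open>0 < k < N\<close> there are more N-th roots of unity than k-th ones, so some
  N-th root \<open>w\<close> has \<open>w ^ k \<noteq> 1\<close>. Multiplication by \<open>w\<close>
  permutes the N-th roots and scales the sum by \<open>w ^ k\<close>; no primitive root is
  required.\<close>

lemma sum_roots_of_unity:
  assumes "k < N"
  shows "(\<Sum>z | z ^ N = 1. z ^ k) = (if k = 0 then of_nat N else (0 :: 'a :: {alg_closed_field, field_char_0}))"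
proof (cases "k = 0")
  case True
  then show ?thesis
    using card_roots_of_unity[of N, where 'a = 'a] assms by simp
next
  case False
  let ?\<mu> = "{z :: 'a. z ^ N = 1}"
  have "\<not> ?\<mu> \<subseteq> {z. z ^ k = 1}"
  proof
    assume "?\<mu> \<subseteq> {z. z ^ k = 1}"
    moreover have "finite {z :: 'a. z ^ k = 1}"
      using card_roots_of_unity[of k, where 'a = 'a] False by (intro card_ge_0_finite) simp
    ultimately have "card ?\<mu> \<le> card {z :: 'a. z ^ k = 1}"
      by (intro card_mono)
    then show False
      using assms False by (simp add: card_roots_of_unity)
  qed
  then obtain w :: 'a where w: "w ^ N = 1" "w ^ k \<noteq> 1"
    by auto
  have "w \<noteq> 0"
    using w assms by (auto simp: power_0_left split: if_splits)
  have "(\<Sum>z\<in>?\<mu>. z ^ k) = (\<Sum>z\<in>?\<mu>. (w * z) ^ k)"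
    using w \<open>w \<noteq> 0\<close>
    by (intro sum.reindex_bij_witness[where i = "\<lambda>z. w * z" and j = "\<lambda>z. z / w"])
      (auto simp: power_mult_distrib power_divide)
  also have "\<dots> = w ^ k * (\<Sum>z\<in>?\<mu>. z ^ k)"
    by (simp add: power_mult_distrib sum_distrib_left)
  finally have "(1 - w ^ k) * (\<Sum>z\<in>?\<mu>. z ^ k) = 0"
    by (simp add: left_diff_distrib)
  then show ?thesis
    using w False by simp
qed

text \<open>The character sending \<gamma> to \<zeta> to the power \<gamma>. Cutting the p-adic
  exponent down to its residue is harmless when each \<open>\<zeta> i\<close> is a root of unity of
  order dividing the n-th power of p.\<close>

definition padic_char ::
    "nat \<Rightarrow> ('d \<Rightarrow> 'p padic_closure) \<Rightarrow> ('d :: finite \<Rightarrow> 'p :: prime_card padic_int) \<Rightarrow> 'p padic_closure" where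
  "padic_char n \<zeta> \<gamma> = (\<Prod>i\<in>UNIV. \<zeta> i ^ nat (residue (\<gamma> i) n))"

lemma padic_char_add:
  fixes \<zeta> :: "'d :: finite \<Rightarrow> 'p :: prime_card padic_closure"
  assumes "\<And>i. \<zeta> i ^ (CARD('p) ^ n) = 1"
  shows "padic_char n \<zeta> (\<gamma> + \<delta>) = padic_char n \<zeta> \<gamma> * padic_char n \<zeta> \<delta>"
proof -
  have "\<zeta> i ^ nat (residue (x + y) n) = \<zeta> i ^ nat (residue x n) * \<zeta> i ^ nat (residue y n)"
    for i and x y :: "'p padic_int"
  proof -
    let ?N = "CARD('p) ^ n"
    define a where "a = nat (residue x n) + nat (residue y n)"
    have "nat (residue (x + y) n) = a mod ?N"
      unfolding plus_padic_int.rep_eq a_def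
      by (simp add: nat_mod_distrib nat_add_distrib residue_nonneg nat_power_eq)
    moreover have "\<zeta> i ^ a = \<zeta> i ^ (?N * (a div ?N) + a mod ?N)"
      by simp
    then have "\<zeta> i ^ a = \<zeta> i ^ (a mod ?N)"
      unfolding power_add power_mult assms by simp
    ultimately show ?thesis
      by (simp add: a_def power_add)
  qed
  then show ?thesis
    by (simp add: padic_char_def prod.distrib)
qed

lemma padic_char_cong: "reduction n \<gamma> = reduction n \<delta> \<Longrightarrow> padic_char n \<zeta> \<gamma> = padic_char n \<zeta> \<delta>"
  by (simp add: padic_char_def reduction_eq_iff)

lemma padic_char_inverse: "padic_char n (\<lambda>i. inverse (\<zeta> i)) \<gamma> = inverse (padic_char n \<zeta> \<gamma>)"
  by (simp add: padic_char_def power_inverse prod_inversef[unfolded o_def])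

lemma padic_char_neg:
  fixes \<zeta> :: "'d :: finite \<Rightarrow> 'p :: prime_card padic_closure"
  assumes "\<And>i. \<zeta> i ^ (CARD('p) ^ n) = 1"
  shows "padic_char n \<zeta> (- \<gamma>) * padic_char n \<zeta> \<gamma> = 1"
proof -
  have "padic_char n \<zeta> (- \<gamma>) * padic_char n \<zeta> \<gamma> = padic_char n \<zeta> (- \<gamma> + \<gamma>)"
    by (rule padic_char_add[OF assms, symmetric])
  then show ?thesis
    by (simp add: padic_char_def zero_padic_int.rep_eq)
qed

lemma padic_char_orthogonal:
  fixes \<gamma> :: "'d :: finite \<Rightarrow> 'p :: prime_card padic_int"
  shows "(\<Sum>\<zeta>\<in>PiE UNIV (\<lambda>_. {z. z ^ (CARD('p) ^ n) = 1}). padic_char n \<zeta> \<gamma>) =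
    (if \<forall>i. residue (\<gamma> i) n = 0 then of_nat (CARD('p) ^ n) ^ CARD('d) else 0)"
proof -
  let ?N = "CARD('p) ^ n"
  have N: "?N > 0"
    by simp
  have "finite {z :: 'p padic_closure. z ^ ?N = 1}"
    using card_roots_of_unity[OF N, where 'a = "'p padic_closure"] N by (intro card_ge_0_finite) simp
  then have "(\<Sum>\<zeta>\<in>PiE UNIV (\<lambda>_. {z. z ^ ?N = 1}). padic_char n \<zeta> \<gamma>) =
      (\<Prod>i\<in>UNIV. \<Sum>z | z ^ ?N = 1. z ^ nat (residue (\<gamma> i) n))"
    unfolding padic_char_def by (intro prod_sum_PiE[symmetric]) simp_all
  also have "\<dots> = (\<Prod>i\<in>UNIV. if residue (\<gamma> i) n = 0 then of_nat ?N else 0)"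
  proof (rule prod.cong)
    fix i
    have "nat (residue (\<gamma> i) n) < ?N"
      using residue_less[of "\<gamma> i" n] by (simp add: nat_less_iff residue_nonneg)
    moreover have "nat (residue (\<gamma> i) n) = 0 \<longleftrightarrow> residue (\<gamma> i) n = 0"
      using residue_nonneg[of "\<gamma> i" n] by auto
    ultimately show "(\<Sum>z | z ^ ?N = 1. z ^ nat (residue (\<gamma> i) n)) =
        (if residue (\<gamma> i) n = 0 then of_nat ?N else (0 :: 'p padic_closure))"
      by (subst sum_roots_of_unity) auto
  qed simp
  also have "\<dots> = (if \<forall>i. residue (\<gamma> i) n = 0 then of_nat ?N ^ CARD('d) else 0)"
    by auto
  finally show ?thesis .
qed


section \<open>Voltage covers\<close>

locale voltage_graph = fin_digraph G + bidirected_digraph G arev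
  for G :: "('v, 'e) pre_digraph" and arev +
  fixes \<alpha> :: "'e \<Rightarrow> 'd :: finite \<Rightarrow> 'p :: prime_card padic_int"
  assumes out_degree_ge_1: "\<forall>v\<in>verts G. out_degree G v \<ge> 1"
    and voltage: "voltage_assignment G arev \<alpha>"
begin

abbreviation "cover n \<equiv> voltage_cover G \<alpha> n"
abbreviation "cosets n \<equiv> range (reduction n :: ('d \<Rightarrow> 'p padic_int) \<Rightarrow> _)"

lemma coset_add: "g \<in> cosets n \<Longrightarrow> g + reduction n \<gamma> \<in> cosets n"
  by (auto simp: reduction_add)

lemma coset_add_neg: "g \<in> cosets n \<Longrightarrow> g + reduction n \<gamma> + reduction n (- \<gamma>) = g"
  "g \<in> cosets n \<Longrightarrow> g + reduction n (- \<gamma>) + reduction n \<gamma> = g"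
  by (auto simp: reduction_add)

lemma out_arcs_cover: "g \<in> cosets n \<Longrightarrow> out_arcs (cover n) (v, g) = (\<lambda>e. (e, g)) ` out_arcs G v"
  by (auto simp: voltage_cover_def)

lemma out_degree_cover: "g \<in> cosets n \<Longrightarrow> out_degree (cover n) (v, g) = out_degree G v"
  unfolding out_degree_def by (simp add: out_arcs_cover card_image inj_on_def)

text \<open>Antisymmetry of the voltage is what brings the second reversal back to the original
  coset.\<close>

lemma reversible_cover: "reversible_digraph (cover n) (cover_rev arev \<alpha> n)"
proof
  fix a assume "a \<in> arcs (cover n)"
  then obtain e g where a: "a = (e, g)" and e: "e \<in> arcs G" and g: "g \<in> cosets n"
    by (auto simp: voltage_cover_def)
  have neg: "\<alpha> (arev e) = - \<alpha> e"
    using voltage e by (simp add: voltage_assignment_def)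
  show "tail (cover n) a \<in> verts (cover n)" "head (cover n) a \<in> verts (cover n)"
    "cover_rev arev \<alpha> n a \<in> arcs (cover n)" "tail (cover n) (cover_rev arev \<alpha> n a) = head (cover n) a"
    using e coset_add[OF g] g by (auto simp: voltage_cover_def cover_rev_def a)
  show "cover_rev arev \<alpha> n (cover_rev arev \<alpha> n a) = a"
    using coset_add_neg[OF g] by (simp add: cover_rev_def a neg)
next
  show "finite (verts (cover n))" "finite (arcs (cover n))"
    by (simp_all add: voltage_cover_def finite_range_reduction)
next
  fix x assume "x \<in> verts (cover n)"
  then obtain v g where "x = (v, g)" "v \<in> verts G" "g \<in> cosets n"
    by (auto simp: voltage_cover_def)
  then show "1 \<le> out_degree (cover n) x"
    using out_degree_ge_1 by (simp add: out_degree_cover)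
qed

text \<open>The choice of representative is immaterial by \<open>padic_char_cong\<close>.\<close>

definition coset_char :: "nat \<Rightarrow> ('d \<Rightarrow> 'p padic_closure) \<Rightarrow> ('d \<Rightarrow> 'p padic_int) set \<Rightarrow> 'p padic_closure" where
  "coset_char n \<zeta> g = padic_char n \<zeta> (SOME \<gamma>. reduction n \<gamma> = g)"

lemma coset_char_reduction: "coset_char n \<zeta> (reduction n \<gamma>) = padic_char n \<zeta> \<gamma>"
  unfolding coset_char_def by (rule padic_char_cong, rule someI[of _ \<gamma>]) simp

lemma coset_char_add:
  assumes "\<And>i. \<zeta> i ^ (CARD('p) ^ n) = 1" "g \<in> cosets n"
  shows "coset_char n \<zeta> (g + reduction n \<gamma>) = coset_char n \<zeta> g * padic_char n \<zeta> \<gamma>"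
  using assms(2) by (auto simp: reduction_add coset_char_reduction padic_char_add[OF assms(1)])

text \<open>Written with sums over out-arcs, as in \<open>grover_eigenvalue_iff\<close>, so that it
  compares term by term with the equation on the cover.\<close>

definition twisted_eigenvalue :: "nat \<Rightarrow> ('d \<Rightarrow> 'p padic_closure) \<Rightarrow> 'p padic_closure \<Rightarrow> bool" where
  "twisted_eigenvalue n \<zeta> u \<longleftrightarrow> (\<exists>x. (\<exists>v\<in>verts G. x v \<noteq> 0) \<and>
    (\<forall>v\<in>verts G. (u\<^sup>2 + 1) * x v =
       u * (\<Sum>e\<in>out_arcs G v. 2 / of_nat (out_degree G v) * padic_char n \<zeta> (\<alpha> e) * x (head G e))))"

definition cover_eigenfunction :: "nat \<Rightarrow> 'p padic_closure \<Rightarrow> ('v \<times> ('d \<Rightarrow> 'p padic_int) set \<Rightarrow> 'p padic_closure) \<Rightarrow> bool" where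
  "cover_eigenfunction n u S \<longleftrightarrow> (\<exists>x\<in>verts (cover n). S x \<noteq> 0) \<and>
    (\<forall>x\<in>verts (cover n). (u\<^sup>2 + 1) * S x =
       u * (\<Sum>e\<in>out_arcs (cover n) x. 2 / of_nat (out_degree (cover n) x) * S (head (cover n) e)))"

lemma cover_eigenfunction_iff:
  "cover_eigenfunction n u S \<longleftrightarrow> (\<exists>v\<in>verts G. \<exists>g\<in>cosets n. S (v, g) \<noteq> 0) \<and>
    (\<forall>v\<in>verts G. \<forall>g\<in>cosets n. (u\<^sup>2 + 1) * S (v, g) =
       u * (\<Sum>e\<in>out_arcs G v. 2 / of_nat (out_degree G v) * S (head G e, g + reduction n (\<alpha> e))))"
proof -
  have verts: "verts (cover n) = verts G \<times> cosets n"
    by (simp add: voltage_cover_def)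
  have "(\<Sum>e\<in>out_arcs (cover n) (v, g). 2 / of_nat (out_degree (cover n) (v, g)) * S (head (cover n) e)) =
      (\<Sum>e\<in>out_arcs G v. 2 / of_nat (out_degree G v) * S (head G e, g + reduction n (\<alpha> e)))"
    if "g \<in> cosets n" for v g
    using that
    by (simp add: out_degree_cover out_arcs_cover sum.reindex inj_on_def del: out_arcs_in_arcs)
      (simp add: voltage_cover_def)
  then show ?thesis
    unfolding cover_eigenfunction_def verts by auto
qed

text \<open>Spread \<open>x\<close> over the fibres by the character: following an arc
  \<open>e\<close> translates the coset by \<alpha> e, which multiplies the character by exactly the
  twist in the base equation.\<close>

lemma lift_eigenfunction:
  assumes \<zeta>: "\<And>i. \<zeta> i ^ (CARD('p) ^ n) = 1" and "twisted_eigenvalue n \<zeta> u"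
  shows "\<exists>S. cover_eigenfunction n u S"
proof -
  obtain x where nz: "\<exists>v\<in>verts G. x v \<noteq> 0" and x: "\<And>v. v \<in> verts G \<Longrightarrow> (u\<^sup>2 + 1) * x v =
      u * (\<Sum>e\<in>out_arcs G v. 2 / of_nat (out_degree G v) * padic_char n \<zeta> (\<alpha> e) * x (head G e))"
    using assms(2) by (auto simp: twisted_eigenvalue_def)
  define S where "S = (\<lambda>(v, g). coset_char n \<zeta> g * x v)"
  have "(u\<^sup>2 + 1) * S (v, g) =
      u * (\<Sum>e\<in>out_arcs G v. 2 / of_nat (out_degree G v) * S (head G e, g + reduction n (\<alpha> e)))"
    if v: "v \<in> verts G" and g: "g \<in> cosets n" for v g
  proof -
    have "(u\<^sup>2 + 1) * S (v, g) = coset_char n \<zeta> g * ((u\<^sup>2 + 1) * x v)"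
      by (simp add: S_def mult_ac)
    then show ?thesis
      unfolding x[OF v] by (simp add: S_def coset_char_add[OF \<zeta> g] sum_distrib_left mult_ac)
  qed
  moreover have "coset_char n \<zeta> (reduction n 0) = 1"
    unfolding coset_char_reduction by (simp add: padic_char_def zero_padic_int.rep_eq)
  then have "\<exists>v\<in>verts G. \<exists>g\<in>cosets n. S (v, g) \<noteq> 0"
    using nz unfolding S_def by (auto intro!: exI[of _ 0])
  ultimately have "cover_eigenfunction n u S"
    unfolding cover_eigenfunction_iff by blast
  then show ?thesis
    by blast
qed

text \<open>
  By orthogonality some Fourier coefficient \<open>x \<eta>\<close> of \<open>S\<close> is nonzero; translating the summation index
  shows that it is an eigenfunction for the inverse character.
\<close>

lemma project_eigenfunction:
  assumes S: "cover_eigenfunction n u S"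
  shows "\<exists>\<zeta>. (\<forall>i. \<zeta> i ^ (CARD('p) ^ n) = 1) \<and> twisted_eigenvalue n \<zeta> u"
proof -
  let ?N = "CARD('p) ^ n"
  let ?\<mu> = "PiE (UNIV :: 'd set) (\<lambda>_. {z :: 'p padic_closure. z ^ ?N = 1})"
  obtain v0 g0 where v0: "v0 \<in> verts G" "g0 \<in> cosets n" "S (v0, g0) \<noteq> 0"
    using S unfolding cover_eigenfunction_iff by blast
  obtain \<gamma>0 where \<gamma>0: "g0 = reduction n \<gamma>0"
    using v0 by blast
  define x where "x \<eta> v = (\<Sum>g\<in>cosets n. coset_char n \<eta> g * S (v, g))" for \<eta> v
  have \<mu>: "\<eta> i ^ ?N = 1" if "\<eta> \<in> ?\<mu>" for \<eta> i
    using that by (auto simp: PiE_iff)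
  have "\<exists>\<eta>\<in>?\<mu>. x \<eta> v0 \<noteq> 0"
  proof (rule ccontr)
    assume "\<not> ?thesis"
    \<comment> \<open>Fourier inversion at \<open>g0\<close>: weighting the coefficients by inverse
      character values leaves \<open>S (v0, g0)\<close> times the number of characters, which is
      nonzero in characteristic 0.\<close>
    then have "0 = (\<Sum>\<eta>\<in>?\<mu>. padic_char n \<eta> (- \<gamma>0) * x \<eta> v0)"
      by simp
    also have "\<dots> = (\<Sum>g\<in>cosets n. S (v0, g) * (\<Sum>\<eta>\<in>?\<mu>. coset_char n \<eta> g * padic_char n \<eta> (- \<gamma>0)))"
      unfolding x_def sum_distrib_left by (subst sum.swap) (simp add: mult_ac)
    also have "\<dots> = (\<Sum>g\<in>cosets n. if g = g0 then S (v0, g0) * of_nat ?N ^ CARD('d) else 0)"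
    proof (rule sum.cong)
      fix g assume g: "g \<in> cosets n"
      then obtain \<gamma> where \<gamma>: "g = reduction n \<gamma>"
        by blast
      have "padic_char n \<eta> (\<gamma> - \<gamma>0) = padic_char n \<eta> \<gamma> * padic_char n \<eta> (- \<gamma>0)" if "\<eta> \<in> ?\<mu>" for \<eta>
        using padic_char_add[where \<zeta> = \<eta> and n = n and \<gamma> = \<gamma> and \<delta> = "- \<gamma>0"] \<mu>[OF that] by simp
      then have "(\<Sum>\<eta>\<in>?\<mu>. coset_char n \<eta> g * padic_char n \<eta> (- \<gamma>0)) = (\<Sum>\<eta>\<in>?\<mu>. padic_char n \<eta> (\<gamma> - \<gamma>0))"
        by (intro sum.cong) (simp_all add: \<gamma> coset_char_reduction)
      also have "(\<forall>i. residue ((\<gamma> - \<gamma>0) i) n = 0) \<longleftrightarrow> g = g0"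
        unfolding \<gamma> \<gamma>0 reduction_eq_iff
        by (simp add: minus_padic_int.rep_eq) (metis mod_eq_dvd_iff mod_eq_0_iff_dvd residue_mod)
      then have "(\<Sum>\<eta>\<in>?\<mu>. padic_char n \<eta> (\<gamma> - \<gamma>0)) = (if g = g0 then of_nat ?N ^ CARD('d) else 0)"
        by (simp only: padic_char_orthogonal)
      finally show "S (v0, g) * (\<Sum>\<eta>\<in>?\<mu>. coset_char n \<eta> g * padic_char n \<eta> (- \<gamma>0)) =
          (if g = g0 then S (v0, g0) * of_nat ?N ^ CARD('d) else 0)"
        by simp
    qed simp
    also have "\<dots> = S (v0, g0) * of_nat ?N ^ CARD('d)"
      by (subst sum.delta) (use v0 finite_range_reduction in simp_all)
    finally show False
      using v0 by simp
  qed
  then obtain \<eta> where \<eta>: "\<And>i. \<eta> i ^ ?N = 1" and nz: "x \<eta> v0 \<noteq> 0"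
    using \<mu> by blast
  define \<zeta> where "\<zeta> i = inverse (\<eta> i)" for i
  have "\<zeta> = (\<lambda>i. inverse (\<eta> i))"
    by (rule ext) (simp add: \<zeta>_def)
  then have \<zeta>: "padic_char n \<zeta> \<gamma> = inverse (padic_char n \<eta> \<gamma>)" for \<gamma>
    by (simp add: padic_char_inverse)
  have shift: "(\<Sum>g\<in>cosets n. coset_char n \<eta> g * S (w, g + reduction n \<gamma>)) = padic_char n \<zeta> \<gamma> * x \<eta> w" for w \<gamma>
  proof -
    have nz: "padic_char n \<eta> \<gamma> \<noteq> 0"
      using padic_char_neg[where \<zeta> = \<eta> and n = n and \<gamma> = \<gamma>] \<eta> by auto
    have "(\<Sum>g\<in>cosets n. coset_char n \<eta> g * S (w, g + reduction n \<gamma>)) =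
        (\<Sum>g\<in>cosets n. padic_char n \<zeta> \<gamma> * (coset_char n \<eta> (g + reduction n \<gamma>) * S (w, g + reduction n \<gamma>)))"
      using nz by (intro sum.cong) (simp_all add: coset_char_add[OF \<eta>] \<zeta>)
    also have "\<dots> = (\<Sum>g\<in>cosets n. padic_char n \<zeta> \<gamma> * (coset_char n \<eta> g * S (w, g)))"
      by (rule sum.reindex_bij_witness[where i = "\<lambda>g. g + reduction n (- \<gamma>)" and j = "\<lambda>g. g + reduction n \<gamma>"])
        (simp_all only: coset_add coset_add_neg)
    finally show ?thesis
      by (simp add: x_def sum_distrib_left)
  qed
  have "(u\<^sup>2 + 1) * x \<eta> v =
      u * (\<Sum>e\<in>out_arcs G v. 2 / of_nat (out_degree G v) * padic_char n \<zeta> (\<alpha> e) * x \<eta> (head G e))"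
    if v: "v \<in> verts G" for v
  proof -
    have "(u\<^sup>2 + 1) * x \<eta> v = (\<Sum>g\<in>cosets n. coset_char n \<eta> g * ((u\<^sup>2 + 1) * S (v, g)))"
      by (simp add: x_def sum_distrib_left mult_ac)
    also have "\<dots> = (\<Sum>g\<in>cosets n. coset_char n \<eta> g *
        (u * (\<Sum>e\<in>out_arcs G v. 2 / of_nat (out_degree G v) * S (head G e, g + reduction n (\<alpha> e)))))"
    proof (rule sum.cong)
      fix g assume "g \<in> cosets n"
      then have "(u\<^sup>2 + 1) * S (v, g) =
          u * (\<Sum>e\<in>out_arcs G v. 2 / of_nat (out_degree G v) * S (head G e, g + reduction n (\<alpha> e)))"
        using S v unfolding cover_eigenfunction_iff by blast
      then show "coset_char n \<eta> g * ((u\<^sup>2 + 1) * S (v, g)) = coset_char n \<eta> g *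
          (u * (\<Sum>e\<in>out_arcs G v. 2 / of_nat (out_degree G v) * S (head G e, g + reduction n (\<alpha> e))))"
        by (simp only:)
    qed simp
    also have "\<dots> = (\<Sum>e\<in>out_arcs G v. u * (2 / of_nat (out_degree G v)) *
        (\<Sum>g\<in>cosets n. coset_char n \<eta> g * S (head G e, g + reduction n (\<alpha> e))))"
      unfolding sum_distrib_left by (subst sum.swap) (simp add: mult_ac)
    finally show ?thesis
      unfolding shift sum_distrib_left by (simp only: mult.assoc)
  qed
  then have "twisted_eigenvalue n \<zeta> u"
    unfolding twisted_eigenvalue_def using v0 nz by blast
  moreover have "\<zeta> i ^ ?N = 1" for i
    using \<eta> by (simp add: \<zeta>_def power_inverse)
  ultimately show ?thesis
    by blast
qed

lemma grover_cover_eigenvalue_iff: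
  assumes "u\<^sup>2 \<noteq> 1"
  shows "det (u \<cdot>\<^sub>m 1\<^sub>m (card (arcs (cover n))) - grover_matrix (cover n) (cover_rev arev \<alpha> n)) = 0 \<longleftrightarrow>
    (\<exists>\<zeta>. (\<forall>i. \<zeta> i ^ (CARD('p) ^ n) = 1) \<and> twisted_eigenvalue n \<zeta> u)"
proof -
  interpret H: reversible_digraph "cover n" "cover_rev arev \<alpha> n"
    by (rule reversible_cover)
  show ?thesis
    unfolding H.grover_eigenvalue_iff[OF assms] cover_eigenfunction_def[symmetric]
    using lift_eigenfunction project_eigenfunction by blast
qed

section \<open>The spectral polynomial and its resultant at a torsion point\<close>

definition twisted_matrix :: "nat \<Rightarrow> ('d \<Rightarrow> 'p padic_closure) \<Rightarrow> 'p padic_closure mat" where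
  "twisted_matrix n \<zeta> = matrix_on (verts G) (\<lambda>u v.
     \<Sum>e\<in>{e \<in> arcs G. tail G e = u \<and> head G e = v}.
       2 / of_nat (out_degree G (tail G e)) * padic_char n \<zeta> (\<alpha> e))"

definition twisted_poly :: "nat \<Rightarrow> ('d \<Rightarrow> 'p padic_closure) \<Rightarrow> 'p padic_closure poly" where
  "twisted_poly n \<zeta> = det ([:1, 0, 1:] \<cdot>\<^sub>m 1\<^sub>m (card (verts G)) -
     [:0, 1:] \<cdot>\<^sub>m map_mat (\<lambda>x. [:x:]) (twisted_matrix n \<zeta>))"

lemma twisted_matrix_carrier: "twisted_matrix n \<zeta> \<in> carrier_mat (card (verts G)) (card (verts G))"
  unfolding twisted_matrix_def by (rule matrix_on_carrier[OF finite_verts])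

lemma weighted_matrix_carrier: "weighted_matrix G \<alpha> \<in> carrier_mat (card (verts G)) (card (verts G))"
  unfolding weighted_matrix_def by (rule matrix_on_carrier[OF finite_verts])

lemma poly_twisted_poly_eq_0_iff: "poly (twisted_poly n \<zeta>) u = 0 \<longleftrightarrow> twisted_eigenvalue n \<zeta> u"
proof -
  let ?m = "card (verts G)"
  have "poly (twisted_poly n \<zeta>) u = det ((u\<^sup>2 + 1) \<cdot>\<^sub>m 1\<^sub>m ?m - u \<cdot>\<^sub>m twisted_matrix n \<zeta>)"
    unfolding twisted_poly_def using twisted_matrix_carrier[of n \<zeta>]
    by (intro poly_det_cong[of _ ?m]) (auto simp: power2_eq_square)
  also have "\<dots> = 0 \<longleftrightarrow> twisted_eigenvalue n \<zeta> u"
  proof -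
    define W where "W u v = (\<Sum>e\<in>{e \<in> arcs G. tail G e = u \<and> head G e = v}.
       2 / of_nat (out_degree G (tail G e)) * padic_char n \<zeta> (\<alpha> e))" for u v
    have "(\<Sum>t\<in>verts G. ((if s = t then u\<^sup>2 + 1 else 0) - u * W s t) * x t) =
        (u\<^sup>2 + 1) * x s - u * (\<Sum>e\<in>out_arcs G s. 2 / of_nat (out_degree G s) * padic_char n \<zeta> (\<alpha> e) * x (head G e))"
      if s: "s \<in> verts G" for s x
    proof -
      \<comment> \<open>Grouping the out-arcs of \<open>s\<close> by their heads identifies the
        matrix product with the sum over arcs.\<close>
      have "(\<Sum>t\<in>verts G. W s t * x t) = (\<Sum>t\<in>verts G. \<Sum>e\<in>{e \<in> out_arcs G s. head G e = t}.
          2 / of_nat (out_degree G s) * padic_char n \<zeta> (\<alpha> e) * x (head G e))"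
        unfolding W_def sum_distrib_right by (intro sum.cong) auto
      also have "\<dots> = (\<Sum>e\<in>out_arcs G s. 2 / of_nat (out_degree G s) * padic_char n \<zeta> (\<alpha> e) * x (head G e))"
        by (rule sum.group) auto
      finally have eq: "(\<Sum>t\<in>verts G. W s t * x t) =
          (\<Sum>e\<in>out_arcs G s. 2 / of_nat (out_degree G s) * padic_char n \<zeta> (\<alpha> e) * x (head G e))" .
      have "(\<Sum>t\<in>verts G. ((if s = t then u\<^sup>2 + 1 else 0) - u * W s t) * x t) =
          (\<Sum>t\<in>verts G. if s = t then (u\<^sup>2 + 1) * x t else 0) - u * (\<Sum>t\<in>verts G. W s t * x t)"
        unfolding sum_distrib_left sum_subtractf[symmetric]
        by (intro sum.cong) (simp_all add: left_diff_distrib mult.assoc)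
      then show ?thesis
        unfolding eq using s by simp
    qed
    then show ?thesis
      unfolding twisted_matrix_def matrix_on_diff_diag[OF finite_verts] W_def[symmetric]
        det_matrix_on_eq_0_iff[OF finite_verts] twisted_eigenvalue_def
      by simp
  qed
  finally show ?thesis .
qed

text \<open>Only the diagonal entries reach degree 2, each with coefficient 1, so the matrix of top
  coefficients is the identity. This holds over any commutative ring, hence before and after
  evaluation.\<close>

lemma monic_det:
  fixes W :: "'a :: comm_ring_1 mat"
  assumes W: "W \<in> carrier_mat m m"
  defines "F \<equiv> det ([:1, 0, 1:] \<cdot>\<^sub>m 1\<^sub>m m - [:0, 1:] \<cdot>\<^sub>m map_mat (\<lambda>x. [:x:]) W)"
  shows "degree F = 2 * m" "lead_coeff F = 1"
proof -
  let ?A = "[:1, 0, 1:] \<cdot>\<^sub>m 1\<^sub>m m - [:0, 1:] \<cdot>\<^sub>m map_mat (\<lambda>x. [:x:]) W"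
  have A: "?A \<in> carrier_mat m m"
    using W by (intro minus_carrier_mat smult_carrier_mat) simp
  have "degree (?A $$ (i, j)) \<le> 2" if "i < m" "j < m" for i j
  proof -
    have "?A $$ (i, j) = [:if i = j then 1 else 0, - (W $$ (i, j)), if i = j then 1 else 0:]"
      using that W by (cases "i = j") simp_all
    then show ?thesis
      by (simp add: degree_pCons_eq_if)
  qed
  note d = coeff_det_degree_le[OF A this]
  have "map_mat (\<lambda>p. coeff p 2) ?A = 1\<^sub>m m"
    using W by (intro eq_matI) (auto simp: numeral_2_eq_2)
  with d have "degree F \<le> 2 * m" "coeff F (2 * m) = 1"
    unfolding F_def by auto
  then show "degree F = 2 * m" "lead_coeff F = 1"
    using le_degree[of F "2 * m"] by auto
qed

lemma evaluates_weighted_matrix: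
  assumes \<zeta>: "\<And>i. \<zeta> i ^ (CARD('p) ^ n) = 1" and "i < card (verts G)" "j < card (verts G)"
  shows "nilpotent_point.evaluates (\<lambda>i. \<zeta> i - 1) (weighted_matrix G \<alpha> $$ (i, j)) (twisted_matrix n \<zeta> $$ (i, j))"
proof -
  interpret nilpotent_point "\<lambda>i. \<zeta> i - 1"
    by (rule nilpotent_point_root_of_unity[OF \<zeta>])
  interpret ring_rel evaluates
    by (rule ring_rel_evaluates)
  \<comment> \<open>Both matrices are built from the same chosen enumeration of the vertices, so
    entries with equal indices correspond.\<close>
  define xs where "xs = (SOME xs. distinct xs \<and> set xs = verts G)"
  have "\<exists>xs. distinct xs \<and> set xs = verts G"
    using finite_distinct_list[OF finite_verts] by blast
  then have "distinct xs \<and> set xs = verts G"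
    unfolding xs_def by (rule someI_ex)
  then have "length xs = card (verts G)"
    using distinct_card by fastforce
  then show ?thesis
    using assms(2,3) unfolding weighted_matrix_def twisted_matrix_def matrix_on_def Let_def xs_def[symmetric]
    by (auto intro!: rel_sum evaluates_mult evaluates_const evaluates_tau[OF \<zeta>, folded padic_char_def]
      simp del: times_divide_eq_left)
qed

text \<open>Evaluation is carried from matrix entries to the coefficients of the spectral
  polynomial, and from there through the Sylvester determinant. Uniqueness of values then compares
  the value of the resultant with 0.\<close>

lemma spectral_resultant_eq_0_iff:
  assumes \<zeta>: "\<And>i. \<zeta> i ^ (CARD('p) ^ n) = 1"
  shows "mfps_has_value (spectral_resultant G \<alpha> P) (\<lambda>i. \<zeta> i - 1) 0 \<longleftrightarrow>
    (\<exists>u. poly P u = 0 \<and> twisted_eigenvalue n \<zeta> u)"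
proof -
  interpret nilpotent_point "\<lambda>i. \<zeta> i - 1"
    by (rule nilpotent_point_root_of_unity[OF \<zeta>])
  interpret ring_rel evaluates
    by (rule ring_rel_evaluates)
  interpret poly: ring_rel rel_poly
    by (rule ring_rel_poly)
  let ?m = "card (verts G)"
  note W = weighted_matrix_carrier and W' = twisted_matrix_carrier[of n \<zeta>]
  have const: "rel_poly [:a:] [:b:]" if "evaluates a b" for a b
    using that by (intro rel_poly_pCons poly.rel_0)
  have "rel_poly (spectral_poly G \<alpha>) (twisted_poly n \<zeta>)"
    unfolding spectral_poly_def twisted_poly_def
  proof (rule poly.rel_det)
    show "[:1, 0, 1:] \<cdot>\<^sub>m 1\<^sub>m ?m - [:0, 1:] \<cdot>\<^sub>m map_mat (\<lambda>x. [:x:]) (weighted_matrix G \<alpha>) \<in> carrier_mat ?m ?m"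
      "[:1, 0, 1:] \<cdot>\<^sub>m 1\<^sub>m ?m - [:0, 1:] \<cdot>\<^sub>m map_mat (\<lambda>x. [:x:]) (twisted_matrix n \<zeta>) \<in> carrier_mat ?m ?m"
      using W W' by (auto intro!: minus_carrier_mat smult_carrier_mat)
    fix i j assume ij: "i < ?m" "j < ?m"
    have "rel_poly ([:1, 0, 1:] * (if i = j then 1 else 0) - [:0, 1:] * [:weighted_matrix G \<alpha> $$ (i, j):])
        ([:1, 0, 1:] * (if i = j then 1 else 0) - [:0, 1:] * [:twisted_matrix n \<zeta> $$ (i, j):])"
      using evaluates_weighted_matrix[OF \<zeta> ij]
      by (intro poly.rel_diff poly.rel_mult) (auto intro!: rel_poly_pCons rel_0 rel_1 poly.rel_0 poly.rel_1)
    then show "rel_poly (([:1, 0, 1:] \<cdot>\<^sub>m 1\<^sub>m ?m - [:0, 1:] \<cdot>\<^sub>m map_mat (\<lambda>x. [:x:]) (weighted_matrix G \<alpha>)) $$ (i, j))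
        (([:1, 0, 1:] \<cdot>\<^sub>m 1\<^sub>m ?m - [:0, 1:] \<cdot>\<^sub>m map_mat (\<lambda>x. [:x:]) (twisted_matrix n \<zeta>)) $$ (i, j))"
      using ij W W' by (simp del: mult_pCons_left mult_pCons_right)
  qed
  moreover have "coeff (map_poly mfps_const P :: ('d, _) mfps poly) i = mfps_const (coeff P i)" for i
    by (rule coeff_map_poly) (simp add: mfps_const_0_1)
  then have "rel_poly (map_poly mfps_const P) P"
    by (simp add: rel_poly_def evaluates_const)
  \<comment> \<open>Evaluation could lower a degree, but both polynomials are monic of degree
    \<open>2 * ?m\<close>.\<close>
  moreover have "degree (spectral_poly G \<alpha>) = degree (twisted_poly n \<zeta>)"
    unfolding spectral_poly_def twisted_poly_def by (simp only: monic_det(1)[OF W] monic_det(1)[OF W'])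
  moreover have "(mfps_const c :: ('d, _) mfps) \<noteq> 0" if "c \<noteq> 0" for c :: "'p padic_closure"
  proof
    assume "(mfps_const c :: ('d, _) mfps) = 0"
    from arg_cong[OF this, of "\<lambda>f. mfps_nth f (\<lambda>_. 0)"] that show False
      by (simp add: mfps_const_def zero_mfps.rep_eq)
  qed
  from this[of "lead_coeff P"] have "degree (map_poly mfps_const P :: ('d, _) mfps poly) = degree P"
    by (intro degree_map_poly) (auto simp: mfps_const_0_1)
  ultimately have ev: "evaluates (spectral_resultant G \<alpha> P) (resultant (twisted_poly n \<zeta>) P)"
    unfolding spectral_resultant_def by (rule rel_resultant)
  then have "mfps_has_value (spectral_resultant G \<alpha> P) (\<lambda>i. \<zeta> i - 1) 0 \<longleftrightarrow> evaluates (spectral_resultant G \<alpha> P) 0"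
    by (intro evaluates_iff_has_value[symmetric]) (simp add: evaluates_def)
  also have "\<dots> \<longleftrightarrow> resultant (twisted_poly n \<zeta>) P = 0"
    using ev evaluates_unique by metis
  also have "\<dots> \<longleftrightarrow> (\<exists>u. poly P u = 0 \<and> twisted_eigenvalue n \<zeta> u)"
    unfolding resultant_monic_eq_0_iff[OF monic_det(2)[OF W', folded twisted_poly_def]] poly_twisted_poly_eq_0_iff
    by blast
  finally show ?thesis .
qed

end

theorem theorem6p2:
  fixes G :: "('v, 'e) pre_digraph"
    and arev :: "'e \<Rightarrow> 'e"
    and \<alpha> :: "'e \<Rightarrow> 'd :: finite \<Rightarrow> 'p :: prime_card padic_int"
    and K :: "'p padic_closure set"
    and P :: "'p padic_closure poly"
  assumes "fin_digraph G"
    and "bidirected_digraph G arev"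
    and "connected G"
    and "\<forall>v\<in>verts G. out_degree G v \<ge> 1"
    and "voltage_assignment G arev \<alpha>"
    and "finite_padic_extension K"
    and "\<forall>i. coeff P i \<in> K"
    and "lead_coeff P = 1"
    and "coprime P [:-1, 0, 1:]"
  shows "\<forall>n. det (poly_of_mat P (grover_matrix (voltage_cover G \<alpha> n) (cover_rev arev \<alpha> n))) = 0 \<longleftrightarrow>
           (\<exists>\<zeta> :: 'd \<Rightarrow> 'p padic_closure. (\<forall>i. \<zeta> i ^ (CARD('p) ^ n) = 1) \<and>
              mfps_has_value (spectral_resultant G \<alpha> P) (\<lambda>i. \<zeta> i - 1) 0)"
proof
  fix n
  interpret voltage_graph G arev \<alpha>
    by (intro voltage_graph.intro voltage_graph_axioms.intro assms)
  interpret H: reversible_digraph "cover n" "cover_rev arev \<alpha> n"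
    by (rule reversible_cover)
  let ?U = "grover_matrix (cover n) (cover_rev arev \<alpha> n) :: 'p padic_closure mat"
  have u1: "u\<^sup>2 \<noteq> 1" if "poly P u = 0" for u
  proof
    assume "u\<^sup>2 = 1"
    then have "poly [:-1, 0, 1:] u = 0"
      by (simp add: power2_eq_square)
    with that have "[:- u, 1:] dvd P" "[:- u, 1:] dvd [:-1, 0, 1:]"
      by (simp_all only: poly_eq_0_iff_dvd)
    then have "is_unit [:- u, 1:]"
      by (rule coprime_common_divisor[OF assms(9)])
    then show False
      by (simp add: is_unit_iff_degree)
  qed
  have "det (poly_of_mat P ?U) = 0 \<longleftrightarrow> (\<exists>u. poly P u = 0 \<and> det (u \<cdot>\<^sub>m 1\<^sub>m (card (arcs (cover n))) - ?U) = 0)"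
    by (rule det_poly_of_mat_eq_0_iff[OF H.grover_matrix_carrier assms(8)])
  also have "\<dots> \<longleftrightarrow> (\<exists>u. poly P u = 0 \<and> (\<exists>\<zeta>. (\<forall>i. \<zeta> i ^ (CARD('p) ^ n) = 1) \<and> twisted_eigenvalue n \<zeta> u))"
    using u1 grover_cover_eigenvalue_iff by blast
  also have "\<dots> \<longleftrightarrow> (\<exists>\<zeta>. (\<forall>i. \<zeta> i ^ (CARD('p) ^ n) = 1) \<and> (\<exists>u. poly P u = 0 \<and> twisted_eigenvalue n \<zeta> u))"
    by blast
  also have "\<dots> \<longleftrightarrow> (\<exists>\<zeta>. (\<forall>i. \<zeta> i ^ (CARD('p) ^ n) = 1) \<and>
      mfps_has_value (spectral_resultant G \<alpha> P) (\<lambda>i. \<zeta> i - 1) 0)"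
    by (intro ex_cong1 conj_cong refl spectral_resultant_eq_0_iff[symmetric]) blast
  finally show "det (poly_of_mat P ?U) = 0 \<longleftrightarrow> (\<exists>\<zeta>. (\<forall>i. \<zeta> i ^ (CARD('p) ^ n) = 1) \<and>
      mfps_has_value (spectral_resultant G \<alpha> P) (\<lambda>i. \<zeta> i - 1) 0)" .
qed

end
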